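(* Let $\beta,k$ be positive integers. Then the exact degree in $x^{-1}$ of the polynomial $z(\chi_t^\beta,x,-k)$ is $$\phi(\beta,k):=\min_{0\leq i<\log_p(q)}\left\lfloor \frac{l(p^i\beta)+l(p^ik)}{q-1}\right\rfloor .$$
   Context: Let $q=p^n$ be a power of a prime $p$, $A=\mathbb{F}_q[\theta]$, and $A_+(d)$ the set of monic polynomials in $A$ of degree $d$. Let $t$ be an indeterminate and $\chi_t:A\to\mathbb{F}_q[t]$ the $\mathbb{F}_q$-algebra morphism with $\theta\mapsto t$. For non-negative integers $\beta,k,d$ let $S_d(\chi_t^\beta,k):=\sum_{a\in A_+(d)}\chi_t(a)^\beta a^k\in A[t]$; these vanish for $d$ large, and $z(\chi_t^\beta,x,-k):=\sum_{d\ge0}x^{-d}S_d(\chi_t^\beta,k)\in A[t][x^{-1}]$. For a positive integer $\alpha=\sum_i a_iq^i$ written in base $q$ ($0\le a_i\le q-1$), $l(\alpha):=\sum_i a_i$ is the sum of its base-$q$ digits. The index $i$ in the minimum ranges over $0,1,\dots,n-1$. *)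

theory Defs
  imports "HOL-Computational_Algebra.Polynomial"
begin

function digit_sum :: "nat \<Rightarrow> nat \<Rightarrow> nat" where
  "digit_sum q m = (if q \<le> 1 \<or> m = 0 then 0 else m mod q + digit_sum q (m div q))"
  by auto
termination by (relation "measure snd") auto

definition monic_deg :: "nat \<Rightarrow> ('a::field) poly set" where
  "monic_deg d = {a. lead_coeff a = 1 \<and> degree a = d}"

text \<open>A[t] is modelled as (A) poly, i.e. polynomials in t with coefficients in A = F_q[theta].
  chi_t(a) replaces theta by t: its coefficients (in t) are constants of A.\<close>
definition chi_t :: "('a::field) poly \<Rightarrow> 'a poly poly" where
  "chi_t a = map_poly (\<lambda>c. [:c:]) a"

definition S_d :: "nat \<Rightarrow> nat \<Rightarrow> nat \<Rightarrow> ('a::{finite,field}) poly poly" where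
  "S_d \<beta> k d = (\<Sum>a\<in>monic_deg d. chi_t a ^ \<beta> * [:a ^ k:])"

end

theory Submission
  imports
    Defs
    "Jordan_Normal_Form.Determinant"
    "HOL-Library.Poly_Mapping"
    "HOL-Library.Function_Algebras"
    "HOL-Library.FuncSet"
    "HOL-Library.Cardinality"
    "HOL-Combinatorics.Transposition"
begin

text \<open>
  Substituting \<open>t = \<theta> ^ (q ^ N)\<close> turns \<open>S_d\<close> into the power sum \<open>T_d(K)\<close> of \<open>a ^ K\<close> over monic \<open>a\<close> of
  degree \<open>d\<close>, with \<open>K = k + q ^ N * \<beta>\<close>; for large \<open>N\<close> digit sums add up. Since \<open>T_d(p ^ i * K)\<close> is a power
  of \<open>T_d(K)\<close>, the minimum may be assumed to be attained at \<open>i = 0\<close>. Vanishing for large \<open>d\<close>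
  follows by expanding \<open>a ^ K = \<Prod> a(x_s)\<close>, where \<open>x_s\<close> runs through \<open>l(K)\<close> elements
  \<open>\<theta> ^ (q ^ s)\<close>, and summing over the coefficients of \<open>a\<close>.

  For the top degree put \<open>f(y) = \<Prod> (x_s - y)\<close>. Then \<open>T_d(K)\<close> is, up to a constant, the determinant of the
  \<open>d \<times> d\<close> matrix with entries \<open>[y ^ (q i - j)] f\<close>: both extract the same coefficient from the product of
  \<open>f(\<rho>_1) \<dots> f(\<rho>_d)\<close> with the Vandermonde polynomial. Factoring \<open>f(y) = \<Prod> G_e(y ^ (p ^ e))\<close> according to the
  base-\<open>p\<close> digits of \<open>K\<close> writes the matrix as a product of \<open>n\<close> factors, and the determinant as a signed sum
  over families of \<open>d\<close> non-intersecting paths through \<open>n\<close> levels. Each family contributes a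
  polynomial in \<open>\<theta>\<close> of known degree, and the family of maximal degree exists and is unique, so nothing cancels.
\<close>

\<comment> \<open>As a rewrite rule the defining equation does not terminate.\<close>
declare digit_sum.simps [simp del]

section \<open>Coefficients of alternating Laurent polynomials\<close>

text \<open>The obstacle is cancellation in characteristic p. Expanding the power sum gives
  monomials indexed by assignments of tokens to exponents. Permuting equal tokens repeats a monomial
  a multinomial number of times, and for n > 1 this number can vanish modulo p, so the top degree
  cannot be read off that sum. Base-p digits are below p, hence their binomial coefficients survive;
  the determinant is the device by which the base-q expansion is regrouped according to base-p
  digits. One direction is asked of it: a nonzero determinant forces a nonzero power sum, whatever
  the constant. Minimality at shift 0 enters twice. The bound l(K) < (d + 1)(q - 1) makes all
  unwanted terms of the expansions vanish, and d (q - 1) <= l(p^i K) for all i < n ensures that the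
  low classes hold enough tokens for a path family to exist. Uniqueness of the best family rests on
  convexity of the cost, which reduces the comparison to nested families, and on the largest token
  in which two nested optimal families differ.\<close>

lemma lookup_single_mult:
  fixes \<kappa> :: "'k::ab_group_add" and h :: "'k \<Rightarrow>\<^sub>0 'r::semiring_0"
  shows "Poly_Mapping.lookup (Poly_Mapping.single \<kappa> c * h) \<alpha> = c * Poly_Mapping.lookup h (\<alpha> - \<kappa>)"
proof -
  have "Poly_Mapping.lookup (Poly_Mapping.single \<kappa> c * h) \<alpha> = (\<Sum>l. c * (\<Sum>q. Poly_Mapping.lookup h q when \<alpha> = l + q) when \<kappa> = l)"
    by (simp add: lookup_mult lookup_single when_mult)
  also have "\<dots> = c * (\<Sum>q. Poly_Mapping.lookup h q when \<alpha> = \<kappa> + q)" by simp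
  also have "(\<Sum>q. Poly_Mapping.lookup h q when \<alpha> = \<kappa> + q) = (\<Sum>q. Poly_Mapping.lookup h q when \<alpha> - \<kappa> = q)"
    by (intro Sum_any.cong when_cong) (auto simp: diff_eq_eq add.commute)
  finally show ?thesis by simp
qed

lemma CHAR_poly_mapping: "CHAR('k::monoid_add \<Rightarrow>\<^sub>0 'r::semiring_1) = CHAR('r)"
proof (rule CHAR_eqI)
  have *: "of_nat m = (0 :: 'k \<Rightarrow>\<^sub>0 'r) \<longleftrightarrow> of_nat m = (0 :: 'r)" for m
  proof
    assume "of_nat m = (0 :: 'k \<Rightarrow>\<^sub>0 'r)"
    then have "Poly_Mapping.lookup (of_nat m :: 'k \<Rightarrow>\<^sub>0 'r) 0 = 0" by simp
    then show "of_nat m = (0 :: 'r)" by (simp add: lookup_of_nat)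
  next
    assume "of_nat m = (0 :: 'r)"
    then have "Poly_Mapping.single (0 :: 'k) (of_nat m :: 'r) = 0" by simp
    then show "of_nat m = (0 :: 'k \<Rightarrow>\<^sub>0 'r)" by simp
  qed
  show "of_nat CHAR('r) = (0 :: 'k \<Rightarrow>\<^sub>0 'r)" by (simp add: *)
  show "CHAR('r) dvd m" if "of_nat m = (0 :: 'k \<Rightarrow>\<^sub>0 'r)" for m
    using that by (simp add: * of_nat_eq_0_iff_char_dvd)
qed

text \<open>
  Polynomials in \<open>\<rho>_0, \<rho>_1, \<dots>\<close> are modelled with integer exponents, so that multiplying by a monomial
  shifts the coefficients without a side condition. The polynomial \<open>eps d j\<close> is the coefficient of \<open>x ^ j\<close> in
  the product of the \<open>x - \<rho>_i\<close> with \<open>i < d\<close>.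
\<close>

definition set_exp :: "nat set \<Rightarrow> nat \<Rightarrow> int" where
  "set_exp T = (\<lambda>i. if i \<in> T then 1 else 0)"

definition eps :: "nat \<Rightarrow> nat \<Rightarrow> (nat \<Rightarrow> int) \<Rightarrow>\<^sub>0 'r::comm_ring_1" where
  "eps d j = (\<Sum>T | T \<subseteq> {..<d} \<and> d - card T = j. Poly_Mapping.single (set_exp T) ((-1) ^ card T))"

definition perm_exp :: "nat \<Rightarrow> (nat \<Rightarrow> nat) \<Rightarrow> nat \<Rightarrow> int" where
  "perm_exp d \<pi> = (\<lambda>i. if i < d then int (\<pi> i) else 0)"

definition vandermonde :: "nat \<Rightarrow> (nat \<Rightarrow> int) \<Rightarrow>\<^sub>0 'r::comm_ring_1" where
  "vandermonde d = (\<Sum>\<pi> | \<pi> permutes {0..<d}. Poly_Mapping.single (perm_exp d \<pi>) (signof \<pi>))"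

text \<open>The bound concerns each single exponent, not the total degree: multiplying by one
  \<open>eps d j\<close> raises every exponent by at most one.\<close>

definition sym_bounded :: "nat \<Rightarrow> nat \<Rightarrow> ((nat \<Rightarrow> int) \<Rightarrow>\<^sub>0 'r::comm_ring_1) \<Rightarrow> bool" where
  "sym_bounded d N g \<longleftrightarrow> (\<forall>\<beta> i j. i < d \<longrightarrow> j < d \<longrightarrow> Poly_Mapping.lookup g (\<beta> \<circ> Transposition.transpose i j) = Poly_Mapping.lookup g \<beta>)
     \<and> (\<forall>\<beta> i. i < d \<longrightarrow> Poly_Mapping.lookup g \<beta> \<noteq> 0 \<longrightarrow> 0 \<le> \<beta> i \<and> \<beta> i \<le> int N)"

lemma lookup_eps_mult:
  "Poly_Mapping.lookup (eps d j * g) \<beta> = (\<Sum>T | T \<subseteq> {..<d} \<and> d - card T = j. (-1) ^ card T * Poly_Mapping.lookup g (\<beta> - set_exp T))"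
  by (simp add: eps_def sum_distrib_right lookup_sum lookup_single_mult)

lemma lookup_mult_vandermonde:
  "Poly_Mapping.lookup (g * vandermonde d) \<alpha> = (\<Sum>\<pi> | \<pi> permutes {0..<d}. signof \<pi> * Poly_Mapping.lookup g (\<alpha> - perm_exp d \<pi>))"
  by (simp add: vandermonde_def sum_distrib_right lookup_sum lookup_single_mult mult.commute[of g])

lemma sym_bounded_one: "sym_bounded d 0 1"
proof -
  have "\<beta> \<circ> Transposition.transpose i j = 0 \<longleftrightarrow> \<beta> = 0" for \<beta> :: "nat \<Rightarrow> int" and i j
  proof
    assume "\<beta> \<circ> Transposition.transpose i j = 0"
    then have "(\<beta> \<circ> Transposition.transpose i j) \<circ> Transposition.transpose i j = 0" by auto
    then show "\<beta> = 0" by (simp add: comp_assoc)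
  qed auto
  then show ?thesis unfolding sym_bounded_def
    by (auto simp: lookup_one when_def split: if_splits)
qed

lemma sym_bounded_eps_mult:
  assumes "sym_bounded d N g" shows "sym_bounded d (Suc N) (eps d j * g)"
  unfolding sym_bounded_def
proof (intro conjI allI impI)
  fix \<beta> :: "nat \<Rightarrow> int" and i l assume il: "i < d" "l < d"
  let ?t = "Transposition.transpose i l"
  let ?S = "{T. T \<subseteq> {..<d} \<and> d - card T = j}"
  have t: "?t ` {..<d} = {..<d}" using il by (auto simp: Transposition.transpose_def image_iff)
  have c: "card (?t ` T) = card T" for T by (intro card_image inj_onI) (metis transpose_involutory)
  have "(\<Sum>T\<in>?S. (-1) ^ card T * Poly_Mapping.lookup g ((\<beta> \<circ> ?t) - set_exp T)) =
        (\<Sum>T\<in>?S. (-1) ^ card T * Poly_Mapping.lookup g (\<beta> - set_exp T))"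
  proof (rule sum.reindex_bij_witness[where i = "image ?t" and j = "image ?t"])
    fix T assume T: "T \<in> ?S"
    show "?t ` ?t ` T = T" "?t ` ?t ` T = T" by (simp_all add: image_image)
    have "?t ` T \<subseteq> {..<d}" using T image_mono[of T "{..<d}" ?t] t by simp
    then show "?t ` T \<in> ?S" "?t ` T \<in> ?S" using T c[of T] by simp_all
    have "(\<beta> \<circ> ?t) - set_exp T = (\<beta> - set_exp (?t ` T)) \<circ> ?t"
    proof
      fix x
      have "x \<in> T \<longleftrightarrow> ?t x \<in> ?t ` T" by (metis imageE imageI transpose_involutory)
      then show "((\<beta> \<circ> ?t) - set_exp T) x = ((\<beta> - set_exp (?t ` T)) \<circ> ?t) x" by (simp add: set_exp_def)
    qed
    then have "Poly_Mapping.lookup g ((\<beta> \<circ> ?t) - set_exp T) = Poly_Mapping.lookup g (\<beta> - set_exp (?t ` T))"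
      using assms il unfolding sym_bounded_def by metis
    then show "(-1) ^ card (?t ` T) * Poly_Mapping.lookup g (\<beta> - set_exp (?t ` T)) = (-1) ^ card T * Poly_Mapping.lookup g ((\<beta> \<circ> ?t) - set_exp T)"
      using c by simp
  qed
  then show "Poly_Mapping.lookup (eps d j * g) (\<beta> \<circ> ?t) = Poly_Mapping.lookup (eps d j * g) \<beta>"
    by (simp add: lookup_eps_mult)
next
  fix \<beta> i assume i: "i < d" and nz: "Poly_Mapping.lookup (eps d j * g) \<beta> \<noteq> 0"
  then obtain T where "Poly_Mapping.lookup g (\<beta> - set_exp T) \<noteq> 0"
    unfolding lookup_eps_mult by (metis (mono_tags, lifting) mult_zero_right sum.neutral)
  then have "0 \<le> (\<beta> - set_exp T) i \<and> (\<beta> - set_exp T) i \<le> int N"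
    using assms i unfolding sym_bounded_def by blast
  then show "0 \<le> \<beta> i" "\<beta> i \<le> int (Suc N)" by (auto simp: set_exp_def split: if_splits)
qed

lemma sym_bounded_eps_power:
  assumes "sym_bounded d N g" shows "sym_bounded d (m + N) (eps d j ^ m * g)"
proof (induction m)
  case (Suc m)
  then show ?case using sym_bounded_eps_mult[of d "m + N" "eps d j ^ m * g" j] by (simp add: mult.assoc)
qed (use assms in simp)

lemma sym_bounded_eps_prod:
  "sym_bounded d (\<Sum>j<k. m j) (\<Prod>j<k. eps d j ^ m j)"
proof (induction k)
  case 0
  then show ?case using sym_bounded_one by simp
next
  case (Suc k)
  then show ?case using sym_bounded_eps_power[OF Suc, of "m k" k] by (simp add: add.commute mult.commute)
qed

text \<open>Composing a permutation with the transposition of \<open>i\<close> and \<open>j\<close>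
  keeps the coefficient of \<open>g\<close> and flips the sign. Even permutations are paired with
  odd ones, because in characteristic 2 a quantity equal to its own negative need not
  vanish.\<close>

lemma alternating_coincidence:
  fixes g :: "(nat \<Rightarrow> int) \<Rightarrow>\<^sub>0 'r::comm_ring_1"
  assumes g: "sym_bounded d N g" and ij: "i < d" "j < d" "i \<noteq> j" and eq: "\<alpha> i = \<alpha> j"
  shows "Poly_Mapping.lookup (g * vandermonde d) \<alpha> = 0"
proof -
  let ?t = "Transposition.transpose i j"
  let ?P = "{\<pi>. \<pi> permutes {0..<d}}"
  let ?f = "\<lambda>\<pi>. signof \<pi> * Poly_Mapping.lookup g (\<alpha> - perm_exp d \<pi>)"
  have t: "?t permutes {0..<d}" using ij by (intro permutes_swap_id) auto
  have st: "sign ?t = (-1 :: int)" using ij by (simp add: sign_swap_id)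
  have flip: "?f (\<pi> \<circ> ?t) = - ?f \<pi>" if "\<pi> permutes {0..<d}" for \<pi>
  proof -
    have "sign (\<pi> \<circ> ?t) = - sign \<pi>"
      using that t st by (subst sign_compose) (auto simp: permutation_permutes)
    then have "signof (\<pi> \<circ> ?t) = - (signof \<pi> :: 'r)" by simp
    moreover have "\<alpha> - perm_exp d (\<pi> \<circ> ?t) = (\<alpha> - perm_exp d \<pi>) \<circ> ?t"
      using ij eq by (auto simp: fun_eq_iff perm_exp_def Transposition.transpose_def)
    then have "Poly_Mapping.lookup g (\<alpha> - perm_exp d (\<pi> \<circ> ?t)) = Poly_Mapping.lookup g (\<alpha> - perm_exp d \<pi>)"
      using g ij unfolding sym_bounded_def by metis
    ultimately show ?thesis by simp
  qed
  let ?E = "{\<pi>\<in>?P. sign \<pi> = (1::int)}" and ?O = "{\<pi>\<in>?P. sign \<pi> = (-1::int)}"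
  have "sum ?f ?O = (\<Sum>\<pi>\<in>?E. ?f (\<pi> \<circ> ?t))"
  proof (rule sum.reindex_bij_witness[where i = "\<lambda>\<pi>. \<pi> \<circ> ?t" and j = "\<lambda>\<pi>. \<pi> \<circ> ?t"])
    fix \<pi> 
    have s: "sign (\<pi> \<circ> ?t) = - sign \<pi>" if "\<pi> permutes {0..<d}"
      using that t st by (subst sign_compose) (auto simp: permutation_permutes)
    have "(\<pi> \<circ> ?t) permutes {0..<d}" if "\<pi> permutes {0..<d}"
      using that t by (rule permutes_compose[rotated])
    note s = s this
    show "\<pi> \<in> ?O \<Longrightarrow> \<pi> \<circ> ?t \<in> ?E" "\<pi> \<in> ?E \<Longrightarrow> \<pi> \<circ> ?t \<in> ?O" using s by auto
  qed (auto simp: comp_assoc)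
  also have "\<dots> = - sum ?f ?E" using flip by (simp add: sum_negf)
  finally have "sum ?f ?E + sum ?f ?O = 0" by simp
  moreover have "?P = ?E \<union> ?O" by (auto simp: sign_def)
  moreover have "sum ?f (?E \<union> ?O) = sum ?f ?E + sum ?f ?O"
    by (rule sum.union_disjoint) (auto simp: finite_permutations)
  ultimately show ?thesis unfolding lookup_mult_vandermonde by metis
qed

text \<open>
  Exponents congruent to \<open>-1\<close> modulo \<open>q\<close> that are too small to be distinct must coincide, which an
  alternating polynomial does not allow.
\<close>

lemma alternating_low_degree:
  fixes g :: "(nat \<Rightarrow> int) \<Rightarrow>\<^sub>0 'r::comm_ring_1"
  assumes g: "sym_bounded d N g" and N: "N + d < d * q" and cong: "\<And>i. i < d \<Longrightarrow> \<exists>\<beta>. \<alpha> i = int q * \<beta> - 1"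
  shows "Poly_Mapping.lookup (g * vandermonde d) \<alpha> = 0"
proof (rule ccontr)
  assume nz: "Poly_Mapping.lookup (g * vandermonde d) \<alpha> \<noteq> 0"
  have q: "q > 0" using N by (cases q) auto
  have "\<exists>\<pi>. \<pi> permutes {0..<d} \<and> Poly_Mapping.lookup g (\<alpha> - perm_exp d \<pi>) \<noteq> 0"
    using nz unfolding lookup_mult_vandermonde by (metis (mono_tags, lifting) mem_Collect_eq mult_zero_right sum.neutral)
  then obtain \<pi> where \<pi>: "\<pi> permutes {0..<d}" "Poly_Mapping.lookup g (\<alpha> - perm_exp d \<pi>) \<noteq> 0" by blast
  obtain \<beta> where \<beta>: "\<And>i. i < d \<Longrightarrow> \<alpha> i = int q * \<beta> i - 1" using cong by metis
  \<comment> \<open>The exponent \<open>\<alpha> i\<close> lies between 0 and N + d - 1, so q times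
    \<open>\<beta> i\<close> lies between 1 and N + d < d q. This leaves only d - 1 values for
    \<open>d\<close> indices.\<close>
  have rng: "\<beta> i \<in> {1..<int d}" if "i < d" for i
  proof -
    have "0 \<le> (\<alpha> - perm_exp d \<pi>) i \<and> (\<alpha> - perm_exp d \<pi>) i \<le> int N"
      using g \<pi>(2) that unfolding sym_bounded_def by blast
    moreover have "\<pi> i < d" using permutes_in_image[OF \<pi>(1), of i] that by simp
    ultimately have "0 < int q * \<beta> i" "int q * \<beta> i < int q * int d"
      using \<beta>[OF that] that N by (auto simp: perm_exp_def mult.commute simp flip: of_nat_mult)
    then show ?thesis using q by (simp add: zero_less_mult_iff)
  qed
  have "inj_on \<beta> {..<d}"
  proof (rule inj_onI, rule ccontr)
    fix i j assume "i \<in> {..<d}" "j \<in> {..<d}" "\<beta> i = \<beta> j" "i \<noteq> j"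
    then show False using alternating_coincidence[OF g, of i j \<alpha>] \<beta> nz by simp
  qed
  then have "card {..<d} \<le> card {1..<int d}" using rng by (intro card_inj_on_le[of \<beta>]) auto
  moreover have "d > 0" using N by (cases d) auto
  ultimately show False by simp
qed

lemma single_power: "Poly_Mapping.single (\<kappa> :: nat \<Rightarrow> int) (c::'r::comm_ring_1) ^ m = Poly_Mapping.single (\<lambda>i. int m * \<kappa> i) (c ^ m)"
proof (induction m)
  case 0
  then show ?case by (simp flip: zero_fun_def)
next
  case (Suc m)
  have "\<kappa> + (\<lambda>i. int m * \<kappa> i) = (\<lambda>i. int (Suc m) * \<kappa> i)" by (auto simp: fun_eq_iff algebra_simps)
  then show ?case by (simp add: Suc mult_single)
qed

lemma eps_power_char:
  assumes "prime CHAR('r::comm_ring_1)" "q = CHAR('r) ^ n"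
  shows "(eps d j :: _ \<Rightarrow>\<^sub>0 'r) ^ q = (\<Sum>T | T \<subseteq> {..<d} \<and> d - card T = j. Poly_Mapping.single (\<lambda>i. int q * set_exp T i) (((-1) ^ card T) ^ q))"
  unfolding eps_def
  by (subst freshmans_dream_sum'[of q n]) (use assms in \<open>auto simp: CHAR_poly_mapping single_power\<close>)

text \<open>If some exponent reaches \<open>q\<close>, one q-th power splits off; it moves the
  exponents of the variables by multiples of \<open>q\<close>, so they stay -1 modulo
  \<open>q\<close>, and the remaining total is small enough. Otherwise all exponents are at most q -
  1 and one is smaller, so the total is already below d (q - 1).\<close>

lemma lookup_eps_vandermonde_eq_0:
  fixes m :: "nat \<Rightarrow> nat"
  assumes ch: "prime CHAR('r::comm_ring_1)" "q = CHAR('r) ^ n"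
    and m: "(\<Sum>j<d. m j) < (d + 1) * (q - 1)" and ne: "\<exists>j<d. m j \<noteq> q - 1"
    and cong: "\<And>i. i < d \<Longrightarrow> \<exists>\<beta>. \<alpha> i = int q * \<beta> - 1"
  shows "Poly_Mapping.lookup ((\<Prod>j<d. eps d j ^ m j) * vandermonde d :: _ \<Rightarrow>\<^sub>0 'r) \<alpha> = 0"
proof (cases "\<exists>j<d. q \<le> m j")
  case True
  then obtain l where l: "l < d" "q \<le> m l" by blast
  have q: "q > 0" using ch by (simp add: prime_gt_0_nat)
  define m' where "m' = m(l := m l - q)"
  define g where "g = (\<Prod>j<d. eps d j ^ m' j :: _ \<Rightarrow>\<^sub>0 'r)"
  have "(\<Prod>j<d. eps d j ^ m j) = eps d l ^ m l * (\<Prod>j\<in>{..<d}-{l}. eps d j ^ m j :: _ \<Rightarrow>\<^sub>0 'r)"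
    using l by (subst prod.remove[of _ l]) auto
  also have "eps d l ^ m l = (eps d l ^ q * eps d l ^ m' l :: _ \<Rightarrow>\<^sub>0 'r)"
    using l by (simp add: m'_def flip: power_add)
  also have "(\<Prod>j\<in>{..<d}-{l}. eps d j ^ m j :: _ \<Rightarrow>\<^sub>0 'r) = (\<Prod>j\<in>{..<d}-{l}. eps d j ^ m' j)"
    by (intro prod.cong) (auto simp: m'_def)
  also have "eps d l ^ q * eps d l ^ m' l * (\<Prod>j\<in>{..<d}-{l}. eps d j ^ m' j) = eps d l ^ q * g"
    unfolding g_def using l by (subst (2) prod.remove[of _ l]) (auto simp: mult.assoc)
  finally have 1: "(\<Prod>j<d. eps d j ^ m j) = eps d l ^ q * g" .
  have "(\<Sum>j<d. m j) = m l + (\<Sum>j\<in>{..<d}-{l}. m j)" using l by (subst sum.remove[of _ l]) auto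
  moreover have "(\<Sum>j<d. m' j) = m' l + (\<Sum>j\<in>{..<d}-{l}. m j)" 
    using l by (subst sum.remove[of _ l]) (auto simp: m'_def)
  ultimately have "(\<Sum>j<d. m' j) + q = (\<Sum>j<d. m j)" using l by (simp add: m'_def)
  then have N: "(\<Sum>j<d. m' j) + d < d * q" using m q by (cases q) auto
  have 2: "Poly_Mapping.lookup (g * vandermonde d) (\<alpha> - (\<lambda>i. int q * set_exp T i)) = 0" for T
  proof (rule alternating_low_degree[OF _ N])
    show "sym_bounded d (\<Sum>j<d. m' j) g" unfolding g_def by (rule sym_bounded_eps_prod)
    fix i assume "i < d"
    then obtain b where "\<alpha> i = int q * b - 1" using cong by blast
    then show "\<exists>\<beta>. (\<alpha> - (\<lambda>i. int q * set_exp T i)) i = int q * \<beta> - 1"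
      by (intro exI[of _ "b - set_exp T i"]) (simp add: algebra_simps)
  qed
  show ?thesis unfolding 1 eps_power_char[OF ch] mult.assoc
    by (simp add: sum_distrib_right lookup_sum lookup_single_mult 2)
next
  case False
  obtain l where l: "l < d" "m l \<noteq> q - 1" using ne by blast
  moreover have "\<not> q \<le> m l" using False l by blast
  ultimately have l: "l < d" "m l < q - 1" by auto
  have "(\<Sum>j<d. m j) < (\<Sum>j<d. q - 1)"
  proof (rule sum_strict_mono_ex1)
    show "\<forall>j\<in>{..<d}. m j \<le> q - 1" using False by fastforce
    show "\<exists>j\<in>{..<d}. m j < q - 1" using l by blast
  qed simp
  then have "(\<Sum>j<d. m j) + d < d * (q - 1) + d" by simp
  also have "\<dots> = d * q" using l by (cases q) auto
  finally show ?thesis using cong by (intro alternating_low_degree[OF sym_bounded_eps_prod])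
qed

section \<open>Dual Jacobi-Trudi determinants\<close>

definition coeff_at_diff :: "'r::zero poly \<Rightarrow> nat \<Rightarrow> nat \<Rightarrow> 'r" where
  "coeff_at_diff f a b = (if b \<le> a then coeff f (a - b) else 0)"

abbreviation sgl :: "'k \<Rightarrow> 'r::zero \<Rightarrow> 'k \<Rightarrow>\<^sub>0 'r" where "sgl \<equiv> Poly_Mapping.single"

lemma prod_neg_rho:
  "finite T \<Longrightarrow> (\<Prod>i\<in>T. - sgl (set_exp {i}) (1::'r::comm_ring_1)) = sgl (set_exp T) ((-1) ^ card T)"
proof (induction T rule: finite_induct)
  case empty
  have "set_exp {} = 0" by (simp add: set_exp_def fun_eq_iff)
  then show ?case by (simp flip: zero_fun_def)
next
  case (insert i T)
  have "set_exp {i} + set_exp T = set_exp (insert i T)" using insert by (auto simp: set_exp_def fun_eq_iff)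
  then show ?case using insert by (simp add: mult_single flip: single_uminus)
qed

lemma prod_diff_rho:
  "(\<Prod>i<d. sgl 0 x - sgl (set_exp {i}) (1::'r::comm_ring_1)) = (\<Sum>j\<le>d. sgl 0 (x ^ j) * eps d j)"
proof -
  have pw: "sgl (0 :: nat \<Rightarrow> int) x ^ m = sgl 0 (x ^ m)" for m
    by (simp add: single_power flip: zero_fun_def)
  have "(\<Prod>i<d. sgl 0 x - sgl (set_exp {i}) (1::'r)) = (\<Prod>i<d. - sgl (set_exp {i}) 1 + sgl 0 x)"
    by simp
  also have "\<dots> = (\<Sum>T\<in>Pow {..<d}. sgl (set_exp T) ((-1) ^ card T) * sgl 0 (x ^ (d - card T)))"
    by (subst prod_add) (auto intro!: sum.cong simp: prod_neg_rho finite_subset pw card_Diff_subset)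
  also have "\<dots> = (\<Sum>j\<le>d. \<Sum>T\<in>{T \<in> Pow {..<d}. d - card T = j}. sgl (set_exp T) ((-1) ^ card T) * sgl 0 (x ^ (d - card T)))"
    by (rule sum.group[symmetric]) auto
  also have "\<dots> = (\<Sum>j\<le>d. sgl 0 (x ^ j) * eps d j)"
    unfolding eps_def by (intro sum.cong refl) (auto simp: sum_distrib_left mult.commute intro!: sum.cong)
  finally show ?thesis .
qed

text \<open>Here f(y), the product of the x_s - y, is evaluated at the variable of index
  \<open>i\<close>; powers of y become exponents.\<close>

lemma linear_prod_eval:
  fixes x :: "'s \<Rightarrow> 'r::comm_ring_1"
  assumes "finite I"
  shows "(\<Prod>s\<in>I. sgl 0 (x s) - sgl (set_exp {i}) 1) =
    (\<Sum>w\<le>card I. sgl (\<lambda>j. int w * set_exp {i} j) (coeff (\<Prod>s\<in>I. [:x s, -1:]) w))"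
  using assms
proof (induction I rule: finite_induct)
  case empty
  then show ?case by (simp flip: zero_fun_def)
next
  case (insert a I)
  define f where "f = (\<Prod>s\<in>I. [:x s, -1:])"
  let ?e = "\<lambda>w. \<lambda>j. int w * set_exp {i} j"
  have deg: "degree f \<le> card I"
    unfolding f_def using degree_prod_sum_le[OF insert(1), of "\<lambda>s. [:x s, -1:]"]
    by (rule order_trans) (auto intro!: sum_bounded_above[where K = 1, simplified] simp: degree_linear_power)
  have c0: "coeff f (Suc (card I)) = 0" using deg by (simp add: coeff_eq_0)
  have sh: "set_exp {i} + ?e w = ?e (Suc w)" for w by (auto simp: fun_eq_iff algebra_simps)
  have co: "coeff (\<Prod>s\<in>insert a I. [:x s, -1:]) w = x a * coeff f w - (case w of 0 \<Rightarrow> 0 | Suc w' \<Rightarrow> coeff f w')" for w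
    using insert by (simp add: f_def coeff_pCons split: nat.split)
  have "(\<Prod>s\<in>insert a I. sgl 0 (x s) - sgl (set_exp {i}) 1) =
     (sgl 0 (x a) - sgl (set_exp {i}) 1) * (\<Sum>w\<le>card I. sgl (?e w) (coeff f w))"
    by (simp only: f_def prod.insert[OF insert(1,2)] insert(3))
  also have "\<dots> = (\<Sum>w\<le>card I. sgl (?e w) (x a * coeff f w)) - (\<Sum>w\<le>card I. sgl (?e (Suc w)) (coeff f w))"
    by (simp only: left_diff_distrib sum_distrib_left mult_single sh add_0 mult_1 sum_subtractf)
  also have "(\<Sum>w\<le>card I. sgl (?e w) (x a * coeff f w)) = (\<Sum>w\<le>Suc (card I). sgl (?e w) (x a * coeff f w))"
    by (simp add: c0)
  also have "(\<Sum>w\<le>card I. sgl (?e (Suc w)) (coeff f w)) =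
     (\<Sum>w\<le>Suc (card I). sgl (?e w) (case w of 0 \<Rightarrow> 0 | Suc w' \<Rightarrow> coeff f w'))"
    by (subst sum.atMost_Suc_shift) simp
  finally show ?case
    by (simp only: card_insert_disjoint[OF insert(1,2)] co single_diff sum_subtractf)
qed

lemma prod_single:
  "finite I \<Longrightarrow> (\<Prod>i\<in>I. sgl (\<kappa> i :: nat \<Rightarrow> int) (a i :: 'r::comm_ring_1)) = sgl (\<Sum>i\<in>I. \<kappa> i) (\<Prod>i\<in>I. a i)"
proof (induction I rule: finite_induct)
  case empty
  then show ?case by (simp only: prod.empty sum.empty single_one)
next
  case (insert i I)
  show ?case unfolding prod.insert[OF insert(1,2)] sum.insert[OF insert(1,2)] insert(3) mult_single ..
qed

lemma prod_when: "finite I \<Longrightarrow> (\<Prod>i\<in>I. (c i :: 'r::comm_semiring_1) when P i) = ((\<Prod>i\<in>I. c i) when (\<forall>i\<in>I. P i))"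
  by (induction I rule: finite_induct) (auto simp: when_def)

text \<open>Different factors involve different variables, so extracting a coefficient splits into
  one extraction per variable.\<close>

lemma lookup_prod_eval:
  fixes c :: "nat \<Rightarrow> 'r::comm_ring_1"
  assumes c: "\<And>w. N < w \<Longrightarrow> c w = 0" and \<beta>: "\<And>i. d \<le> i \<Longrightarrow> \<beta> i = 0"
  shows "Poly_Mapping.lookup (\<Prod>i<d. \<Sum>w\<le>N. sgl (\<lambda>j. int w * set_exp {i} j) (c w)) \<beta> =
    (\<Prod>i<d. if 0 \<le> \<beta> i then c (nat (\<beta> i)) else 0)"
proof -
  have e: "(\<Sum>i<d. (\<lambda>j. int (w i) * set_exp {i} j)) = perm_exp d w" for w
  proof
    fix j
    have "(\<Sum>i<d. (\<lambda>j. int (w i) * set_exp {i} j)) j = (\<Sum>i<d. int (w i) * set_exp {i} j)"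
      by (induction d) auto
    also have "\<dots> = (\<Sum>i<d. if j = i then int (w i) else 0)" by (intro sum.cong) (auto simp: set_exp_def)
    finally show "(\<Sum>i<d. (\<lambda>j. int (w i) * set_exp {i} j)) j = perm_exp d w j" by (simp add: perm_exp_def)
  qed
  have "Poly_Mapping.lookup (\<Prod>i<d. \<Sum>w\<le>N. sgl (\<lambda>j. int w * set_exp {i} j) (c w)) \<beta>
     = (\<Sum>w\<in>PiE {..<d} (\<lambda>_. {..N}). (\<Prod>i<d. c (w i)) when perm_exp d w = \<beta>)"
    by (subst prod_sum_PiE) (auto simp: prod_single e lookup_sum lookup_single)
  also have "\<dots> = (\<Sum>w\<in>PiE {..<d} (\<lambda>_. {..N}). \<Prod>i<d. c (w i) when int (w i) = \<beta> i)"
  proof (intro sum.cong refl)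
    fix w
    have "perm_exp d w = \<beta> \<longleftrightarrow> (\<forall>i\<in>{..<d}. int (w i) = \<beta> i)"
      using \<beta> by (auto simp: perm_exp_def fun_eq_iff)
    then show "((\<Prod>i<d. c (w i)) when perm_exp d w = \<beta>) = (\<Prod>i<d. c (w i) when int (w i) = \<beta> i)"
      by (simp add: prod_when)
  qed
  also have "\<dots> = (\<Prod>i<d. \<Sum>w\<le>N. c w when int w = \<beta> i)"
    by (subst prod_sum_PiE) auto
  also have "\<dots> = (\<Prod>i<d. if 0 \<le> \<beta> i then c (nat (\<beta> i)) else 0)"
  proof (intro prod.cong refl)
    fix i
    show "(\<Sum>w\<le>N. c w when int w = \<beta> i) = (if 0 \<le> \<beta> i then c (nat (\<beta> i)) else 0)"
    proof (cases "0 \<le> \<beta> i")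
      case True
      then have "(\<Sum>w\<le>N. c w when int w = \<beta> i) = (\<Sum>w\<le>N. if w = nat (\<beta> i) then c w else 0)"
        by (intro sum.cong) (auto simp: when_def)
      then show ?thesis using True c by (simp add: not_le)
    next
      case False
      then show ?thesis by (intro trans[OF sum.neutral]) (auto simp: when_def)
    qed
  qed
  finally show ?thesis .
qed

text \<open>Up to sign the coefficients of f are the elementary symmetric functions of the
  \<open>x s\<close>, so this is a dual Jacobi-Trudi matrix. The guard in
  \<open>coeff_at_diff\<close> prevents a negative exponent from being truncated to the constant
  term.\<close>

definition dual_matrix :: "nat \<Rightarrow> nat \<Rightarrow> 'r::comm_ring_1 poly \<Rightarrow> 'r mat" where
  "dual_matrix d q f = mat d d (\<lambda>(i, j). coeff_at_diff f (q * Suc i) (Suc j))"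

text \<open>In the expansion of a product of values a(x_s), the number \<open>J s\<close> tells
  which power of \<open>x s\<close> is chosen. Each of the \<open>d\<close> free coefficients is
  chosen q - 1 times and the leading one for all remaining \<open>s\<close>.\<close>

definition balanced :: "'s set \<Rightarrow> nat \<Rightarrow> nat \<Rightarrow> ('s \<Rightarrow> nat) set" where
  "balanced I d q = {J \<in> PiE I (\<lambda>_. {..d}). \<forall>j<d. card {s \<in> I. J s = j} = q - 1}"

lemma sum_card_fibres:
  fixes J :: "'s \<Rightarrow> nat"
  assumes "finite I" shows "(\<Sum>j<d. card {s \<in> I. J s = j}) \<le> card I"
proof -
  have "(\<Sum>j<d. card {s \<in> I. J s = j}) = card (\<Union>j<d. {s \<in> I. J s = j})"
    using assms by (subst card_UN_disjoint) auto
  also have "\<dots> \<le> card I" using assms by (intro card_mono) auto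
  finally show ?thesis .
qed

text \<open>The value \<open>d\<close> stands for a leading coefficient 1. The lemma serves both for
  \<open>eps d\<close> and for the coefficients of a monic polynomial.\<close>

lemma prod_fibres:
  fixes h :: "nat \<Rightarrow> 'b::comm_monoid_mult"
  assumes "finite I" "J \<in> PiE I (\<lambda>_. {..d})" "h d = 1"
  shows "(\<Prod>s\<in>I. h (J s)) = (\<Prod>j<d. h j ^ card {s \<in> I. J s = j})"
proof -
  have "(\<Prod>s\<in>I. h (J s)) = (\<Prod>j\<le>d. \<Prod>s\<in>{s \<in> I. J s = j}. h (J s))"
    using assms by (intro prod.group[symmetric]) auto
  also have "\<dots> = (\<Prod>j\<le>d. h j ^ card {s \<in> I. J s = j})" by (intro prod.cong) auto
  also have "\<dots> = (\<Prod>j<d. h j ^ card {s \<in> I. J s = j})"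
    using assms by (simp add: lessThan_Suc_atMost[symmetric])
  finally show ?thesis .
qed

lemma eps_top: "eps d d = (1 :: _ \<Rightarrow>\<^sub>0 'r::comm_ring_1)"
proof -
  have "{T. T \<subseteq> {..<d} \<and> d - card T = d} = {{}}"
  proof (intro equalityI subsetI)
    fix T assume "T \<in> {T. T \<subseteq> {..<d} \<and> d - card T = d}"
    then have T: "finite T" "T \<subseteq> {..<d}" "card T = 0 \<or> d = 0" by (auto dest: finite_subset)
    then show "T \<in> {{}}" by auto
  qed auto
  moreover have "set_exp {} = 0" by (simp add: set_exp_def fun_eq_iff)
  ultimately show ?thesis by (simp add: eps_def flip: zero_fun_def)
qed

text \<open>Grouped by variables, the double product over \<open>i\<close> and \<open>s\<close> is a
  product of values of f, and multiplication with the Vandermonde sum gives the Leibniz formula.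
  Grouped by \<open>s\<close>, it is a sum over \<open>J\<close> of products of \<open>eps\<close>;
  there all but the balanced \<open>J\<close> drop out, and these share one coefficient.\<close>

theorem det_dual_matrix:
  fixes x :: "'s \<Rightarrow> 'r::comm_ring_1"
  assumes ch: "prime CHAR('r)" "q = CHAR('r) ^ n" and I: "finite I" "card I < (d + 1) * (q - 1)"
  shows "\<exists>c. det (dual_matrix d q (\<Prod>s\<in>I. [:x s, -1:])) = c * (\<Sum>J\<in>balanced I d q. \<Prod>s\<in>I. x s ^ J s)"
proof -
  define f where "f = (\<Prod>s\<in>I. [:x s, -1:])"
  \<comment> \<open>Subtracting \<open>\<pi> i\<close> leaves q (i + 1) - (\<open>\<pi> i\<close> +
    1), the index of a matrix entry. Also each of these exponents is -1 modulo \<open>q\<close>, as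
    the vanishing criterion demands.\<close>
  define \<alpha> where "\<alpha> i = (if i < d then int q * (int i + 1) - 1 else 0)" for i
  define c where "c = Poly_Mapping.lookup ((\<Prod>j<d. eps d j ^ (q - 1)) * vandermonde d :: _ \<Rightarrow>\<^sub>0 'r) \<alpha>"
  have deg: "degree f \<le> card I"
    unfolding f_def using degree_prod_sum_le[OF I(1), of "\<lambda>s. [:x s, -1:]"]
    by (rule order_trans) (auto intro!: sum_bounded_above[where K = 1, simplified] simp: degree_linear_power)
  let ?G = "\<Prod>i<d. \<Prod>s\<in>I. sgl 0 (x s) - sgl (set_exp {i}) 1"
  have G1: "Poly_Mapping.lookup ?G \<beta> = (\<Prod>i<d. if 0 \<le> \<beta> i then coeff f (nat (\<beta> i)) else 0)"
    if "\<And>i. d \<le> i \<Longrightarrow> \<beta> i = 0" for \<beta>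
    unfolding linear_prod_eval[OF I(1)] f_def[symmetric]
    using deg that by (intro lookup_prod_eval) (auto simp: coeff_eq_0)
  have "Poly_Mapping.lookup (?G * vandermonde d) \<alpha> = det (dual_matrix d q f)"
    unfolding lookup_mult_vandermonde det_def'[of "dual_matrix d q f" d, unfolded dual_matrix_def, OF mat_carrier, folded dual_matrix_def]
  proof (intro sum.cong refl)
    fix \<pi> assume "\<pi> \<in> {\<pi>. \<pi> permutes {0..<d}}"
    then have \<pi>: "\<And>i. i < d \<Longrightarrow> \<pi> i < d" using permutes_in_image by fastforce
    have "Poly_Mapping.lookup ?G (\<alpha> - perm_exp d \<pi>) = (\<Prod>i = 0..<d. dual_matrix d q f $$ (i, \<pi> i))"
      unfolding atLeast0LessThan
    proof (subst G1, goal_cases)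
      case 2
      show ?case
      proof (intro prod.cong refl)
        fix i assume i: "i \<in> {..<d}"
        have e: "(\<alpha> - perm_exp d \<pi>) i = int (q * Suc i) - int (Suc (\<pi> i))"
          using i by (simp add: \<alpha>_def perm_exp_def algebra_simps)
        show "(if 0 \<le> (\<alpha> - perm_exp d \<pi>) i then coeff f (nat ((\<alpha> - perm_exp d \<pi>) i)) else 0) = dual_matrix d q f $$ (i, \<pi> i)"
          unfolding e using i \<pi>[of i] by (auto simp: dual_matrix_def coeff_at_diff_def nat_diff_distrib' simp del: of_nat_Suc of_nat_mult mult_Suc_right)
      qed
    qed (simp add: \<alpha>_def perm_exp_def)
    then show "signof \<pi> * Poly_Mapping.lookup ?G (\<alpha> - perm_exp d \<pi>) = signof \<pi> * (\<Prod>i = 0..<d. dual_matrix d q f $$ (i, \<pi> i))"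
      by simp
  qed
  moreover have "Poly_Mapping.lookup (?G * vandermonde d) \<alpha> = c * (\<Sum>J\<in>balanced I d q. \<Prod>s\<in>I. x s ^ J s)"
  proof -
    have pr: "(\<Prod>s\<in>I. sgl (0 :: nat \<Rightarrow> int) (a s)) = sgl 0 (\<Prod>s\<in>I. a s :: 'r)" for a
      by (simp add: prod_single[OF I(1)])
    have "?G = (\<Prod>s\<in>I. \<Prod>i<d. sgl 0 (x s) - sgl (set_exp {i}) 1)" by (rule prod.swap)
    also have "\<dots> = (\<Sum>J\<in>PiE I (\<lambda>_. {..d}). \<Prod>s\<in>I. sgl 0 (x s ^ J s) * eps d (J s))"
      unfolding prod_diff_rho using I by (subst prod_sum_PiE) auto
    also have "\<dots> = (\<Sum>J\<in>PiE I (\<lambda>_. {..d}). sgl 0 (\<Prod>s\<in>I. x s ^ J s) * (\<Prod>j<d. eps d j ^ card {s \<in> I. J s = j}))"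
      by (intro sum.cong refl) (simp add: prod.distrib pr prod_fibres[OF I(1), where h = "eps d"] eps_top)
    finally have "Poly_Mapping.lookup (?G * vandermonde d) \<alpha> = (\<Sum>J\<in>PiE I (\<lambda>_. {..d}).
       (\<Prod>s\<in>I. x s ^ J s) * Poly_Mapping.lookup ((\<Prod>j<d. eps d j ^ card {s \<in> I. J s = j}) * vandermonde d) \<alpha>)"
      by (simp add: sum_distrib_right lookup_sum mult.assoc lookup_single_mult)
    also have "\<dots> = (\<Sum>J\<in>balanced I d q. (\<Prod>s\<in>I. x s ^ J s) * c)"
    proof (rule sum.mono_neutral_cong_right)
      show "finite (PiE I (\<lambda>_. {..d}))" using I by (intro finite_PiE) auto
      show "\<forall>J\<in>PiE I (\<lambda>_. {..d}) - balanced I d q. (\<Prod>s\<in>I. x s ^ J s) *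
         Poly_Mapping.lookup ((\<Prod>j<d. eps d j ^ card {s \<in> I. J s = j}) * vandermonde d) \<alpha> = 0"
      proof
        fix J assume J: "J \<in> PiE I (\<lambda>_. {..d}) - balanced I d q"
        have "Poly_Mapping.lookup ((\<Prod>j<d. eps d j ^ card {s \<in> I. J s = j}) * vandermonde d :: _ \<Rightarrow>\<^sub>0 'r) \<alpha> = 0"
        proof (rule lookup_eps_vandermonde_eq_0[OF ch])
          show "(\<Sum>j<d. card {s \<in> I. J s = j}) < (d + 1) * (q - 1)"
            using sum_card_fibres[OF I(1), of J d] I(2) by simp
          show "\<exists>j<d. card {s \<in> I. J s = j} \<noteq> q - 1" using J by (auto simp: balanced_def)
          show "\<exists>\<beta>. \<alpha> i = int q * \<beta> - 1" if "i < d" for i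
            using that by (intro exI[of _ "int i + 1"]) (simp add: \<alpha>_def)
        qed
        then show "(\<Prod>s\<in>I. x s ^ J s) *
         Poly_Mapping.lookup ((\<Prod>j<d. eps d j ^ card {s \<in> I. J s = j}) * vandermonde d) \<alpha> = 0" by simp
      qed
    qed (auto simp: balanced_def c_def)
    finally show ?thesis by (simp add: sum_distrib_left mult.commute)
  qed
  ultimately show ?thesis unfolding f_def by metis
qed


section \<open>Power sums over a finite field\<close>

lemma of_nat_card_eq_0: "of_nat CARD('a::{finite,ring_1}) = (0::'a)"
proof -
  have "(\<Sum>a\<in>UNIV. a + 1) = (\<Sum>a\<in>UNIV. a :: 'a)"
    by (rule sum.reindex_bij_witness[where i = "\<lambda>a. a - 1" and j = "\<lambda>a. a + 1"]) auto
  then show ?thesis by (simp add: sum.distrib)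
qed

lemma card_ge_2: "2 \<le> CARD('a::{finite,zero_neq_one})"
proof -
  have "card {0, 1 :: 'a} \<le> CARD('a)" by (intro card_mono) auto
  then show ?thesis by simp
qed

lemma power_card_minus_1:
  fixes a :: "'a::{finite,field}" assumes "a \<noteq> 0"
  shows "a ^ (CARD('a) - 1) = 1"
proof -
  let ?U = "UNIV - {0 :: 'a}"
  have "(\<Prod>b\<in>?U. a * b) = (\<Prod>b\<in>?U. b)"
    by (rule prod.reindex_bij_witness[where i = "\<lambda>b. b / a" and j = "\<lambda>b. a * b"]) (use assms in auto)
  moreover have "(\<Prod>b\<in>?U. b) \<noteq> 0" by simp
  ultimately have "a ^ card ?U = 1" by (simp add: prod.distrib)
  then show ?thesis by (simp add: card_Diff_singleton)
qed

lemma power_card: "(a :: 'a::{finite,field}) ^ CARD('a) = a"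
proof (cases "a = 0")
  case False
  have "a ^ CARD('a) = a * a ^ (CARD('a) - 1)" using card_ge_2[where 'a='a]
    by (simp flip: power_Suc)
  then show ?thesis by (simp only: power_card_minus_1[OF False] mult_1_right)
qed simp

text \<open>Since y^m - 1 has at most \<open>m\<close> roots, some unit \<open>c\<close> has c^m
  different from 1, and scaling by \<open>c\<close> multiplies the sum by c^m. For m = 0 the sum
  counts the field, as 0^0 = 1.\<close>

lemma finite_field_power_sum_small:
  assumes "m < CARD('a) - 1" shows "(\<Sum>a\<in>UNIV. a ^ m) = (0 :: 'a::{finite,field})"
proof (cases "m = 0")
  case True
  then show ?thesis by (simp add: of_nat_card_eq_0)
next
  case False
  have "\<exists>c::'a. c \<noteq> 0 \<and> c ^ m \<noteq> 1"
  proof (rule ccontr)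
    assume "\<not> ?thesis"
    then have sub: "UNIV - {0} \<subseteq> {c :: 'a. poly (monom 1 m - 1) c = 0}"
      by (auto simp: poly_monom)
    have nz: "monom 1 m - 1 \<noteq> (0 :: 'a poly)"
      using False by (metis degree_1 degree_monom_eq eq_iff_diff_eq_0 one_neq_zero)
    have "degree (monom 1 m - 1 :: 'a poly) \<le> m"
      by (intro degree_diff_le) (auto simp: degree_monom_le)
    then have "card {c :: 'a. poly (monom 1 m - 1) c = 0} \<le> m"
      using card_poly_roots_bound[OF nz] by simp
    moreover have "card (UNIV - {0 :: 'a}) \<le> card {c :: 'a. poly (monom 1 m - 1) c = 0}"
      using sub by (intro card_mono) auto
    ultimately show False using assms by (simp add: card_Diff_singleton)
  qed
  then obtain c :: 'a where c: "c \<noteq> 0" "c ^ m \<noteq> 1" by blast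
  have "(\<Sum>a\<in>UNIV. (c * a) ^ m) = (\<Sum>a\<in>UNIV. a ^ m)"
    by (rule sum.reindex_bij_witness[where i = "\<lambda>b. b / c" and j = "\<lambda>b. c * b"]) (use c in auto)
  then have "(c ^ m - 1) * (\<Sum>a\<in>UNIV. a ^ m) = 0"
    by (simp add: power_mult_distrib left_diff_distrib flip: sum_distrib_left)
  then show ?thesis using c by simp
qed

text \<open>For positive \<open>m\<close> only the residue modulo q - 1 matters, and q - 1 is its
  only positive multiple below 2 (q - 1).\<close>

lemma finite_field_power_sum:
  assumes "m < 2 * (CARD('a) - 1)"
  shows "(\<Sum>a\<in>UNIV. a ^ m) = (if m = CARD('a) - 1 then - 1 else 0 :: 'a::{finite,field})"
proof -
  consider "m < CARD('a) - 1" | "m = CARD('a) - 1" | "CARD('a) - 1 < m" by linarith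
  then show ?thesis
  proof cases
    case 1
    then show ?thesis using finite_field_power_sum_small by auto
  next
    case 2
    have m: "m > 0" using card_ge_2[where 'a='a] 2 by simp
    have "(\<Sum>a\<in>UNIV. a ^ m :: 'a) = 0 ^ m + (\<Sum>a\<in>UNIV - {0}. a ^ m)"
      by (subst sum.remove[of _ 0]) auto
    also have "(\<Sum>a\<in>UNIV - {0::'a}. a ^ m) = (\<Sum>a\<in>UNIV - {0::'a}. 1)"
      unfolding 2 by (intro sum.cong refl power_card_minus_1) simp
    also have "(0::'a) ^ m + (\<Sum>a\<in>UNIV - {0::'a}. 1) = (\<Sum>a\<in>UNIV - {0::'a}. 1)" using m by simp
    also have "\<dots> = of_nat (CARD('a) - 1)" by (simp add: card_Diff_singleton)
    also have "\<dots> = of_nat CARD('a) - 1" using card_ge_2[where 'a='a] by (subst of_nat_diff) auto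
    finally show ?thesis using 2 of_nat_card_eq_0[where 'a='a] by simp
  next
    case 3
    have "a ^ m = a ^ (m - (CARD('a) - 1))" for a :: 'a
    proof (cases "a = 0")
      case False
      have "a ^ m = a ^ (CARD('a) - 1) * a ^ (m - (CARD('a) - 1))" using 3 by (simp flip: power_add)
      then show ?thesis using power_card_minus_1[OF False] by simp
    next
      case True
      have "0 < m" "0 < m - (CARD('a) - 1)" using 3 by simp_all
      then show ?thesis unfolding True by (simp only: zero_power)
    qed
    then have "(\<Sum>a\<in>UNIV. a ^ m :: 'a) = (\<Sum>a\<in>UNIV. a ^ (m - (CARD('a) - 1)))" by simp
    also have "\<dots> = 0" by (rule finite_field_power_sum_small) (use assms in simp)
    finally show ?thesis using 3 by simp
  qed
qed

lemma sum_const_poly: "(\<Sum>a\<in>A. [:f a:]) = [:\<Sum>a\<in>A. f a:]"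
  by (induction A rule: infinite_finite_induct) auto

text \<open>After expansion each coefficient of the monic polynomial is summed separately, which
  gives a product of power sums over the field. The surviving assignments are the same as in the
  determinant identity.\<close>

lemma monic_sum_eq:
  fixes x :: "'s \<Rightarrow> 'a::{finite,field} poly"
  assumes I: "finite I" "card I < (d + 1) * (CARD('a) - 1)"
  shows "(\<Sum>c\<in>PiE {..<d} (\<lambda>_. UNIV :: 'a set). \<Prod>s\<in>I. (\<Sum>j<d. [:c j:] * x s ^ j) + x s ^ d) =
    (-1) ^ d * (\<Sum>J\<in>balanced I d CARD('a). \<Prod>s\<in>I. x s ^ J s)"
proof -
  let ?q = "CARD('a)"
  let ?C = "PiE {..<d} (\<lambda>_. UNIV :: 'a set)" and ?J = "PiE I (\<lambda>_. {..d})"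
  define c' where "c' c j = [:if j < d then c j else (1 :: 'a):]" for c j
  have in1: "(\<Sum>j<d. [:c j:] * x s ^ j) + x s ^ d = (\<Sum>j\<le>d. c' c j * x s ^ j)" for c s
    by (simp add: c'_def lessThan_Suc_atMost[symmetric])
  have pw: "(\<Sum>a\<in>UNIV. [:a:] ^ m) = [:\<Sum>a\<in>UNIV. (a :: 'a) ^ m:]" for m
    by (simp add: poly_const_pow sum_const_poly)
  have S: "(\<Sum>c\<in>?C. \<Prod>s\<in>I. c' c (J s)) = (if J \<in> balanced I d ?q then (-1) ^ d else 0)" if J: "J \<in> ?J" for J
  proof -
    let ?m = "\<lambda>j. card {s \<in> I. J s = j}"
    have "(\<Sum>c\<in>?C. \<Prod>s\<in>I. c' c (J s)) = (\<Sum>c\<in>?C. \<Prod>j<d. c' c j ^ ?m j)"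
      using J by (intro sum.cong refl prod_fibres[OF I(1)]) (auto simp: c'_def one_pCons)
    also have "\<dots> = (\<Sum>c\<in>?C. \<Prod>j<d. [:c j:] ^ ?m j)"
      by (intro sum.cong prod.cong refl) (auto simp: c'_def)
    also have "\<dots> = (\<Prod>j<d. \<Sum>a\<in>UNIV. [:a:] ^ ?m j)"
      by (rule prod_sum_PiE[symmetric]) simp_all
    also have "\<dots> = (\<Prod>j<d. [:\<Sum>a\<in>UNIV. (a :: 'a) ^ ?m j:])" by (simp only: pw)
    also have "\<dots> = (if J \<in> balanced I d ?q then (-1) ^ d else 0)"
    proof (cases "J \<in> balanced I d ?q")
      case True
      then have "(\<Sum>a\<in>UNIV. (a :: 'a) ^ ?m j) = -1" if "j < d" for j
        using finite_field_power_sum[of "?m j", where 'a='a] that card_ge_2[where 'a='a] by (auto simp: balanced_def)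
      then have "(\<Prod>j<d. [:\<Sum>a\<in>UNIV. (a :: 'a) ^ ?m j:]) = (\<Prod>j<d. [:-1:])" by (intro prod.cong) auto
      also have "\<dots> = (-1) ^ d" by (simp add: one_pCons)
      finally show ?thesis using True by simp
    next
      case False
      then obtain l where l: "l < d" "?m l \<noteq> ?q - 1" using J by (auto simp: balanced_def)
      \<comment> \<open>If no multiplicity is below q - 1, those other than the one at
        \<open>l\<close> use up at least (d - 1)(q - 1) of the fewer than (d + 1)(q - 1) elements of
        \<open>I\<close>, so the one at \<open>l\<close> stays below 2 (q - 1).\<close>
      have "\<exists>j<d. ?m j \<noteq> ?q - 1 \<and> ?m j < 2 * (?q - 1)"
      proof (cases "\<exists>j<d. ?m j < ?q - 1")
        case True
        then obtain j where "j < d" "?m j < ?q - 1" by blast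
        then show ?thesis by (intro exI[of _ j]) simp
      next
        case False
        have "(\<Sum>j<d. ?m j) = ?m l + (\<Sum>j\<in>{..<d} - {l}. ?m j)" using l by (subst sum.remove[of _ l]) auto
        moreover have "(\<Sum>j\<in>{..<d} - {l}. ?q - 1) \<le> (\<Sum>j\<in>{..<d} - {l}. ?m j)"
          by (intro sum_mono) (metis DiffD1 False lessThan_iff not_le_imp_less)
        moreover have "(\<Sum>j<d. ?m j) < (d + 1) * (?q - 1)" using sum_card_fibres[OF I(1), of J d] I(2) by simp
        ultimately have "?m l + (d - 1) * (?q - 1) < (d + 1) * (?q - 1)" using l by simp
        also have "(d + 1) * (?q - 1) = 2 * (?q - 1) + (d - 1) * (?q - 1)"
        proof -
          have "(d + 1) * r = 2 * r + (d - 1) * r" for r using l by (cases d) simp_all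
          then show ?thesis .
        qed
        finally show ?thesis using l by auto
      qed
      then obtain j where j: "j < d" "?m j \<noteq> ?q - 1" "?m j < 2 * (?q - 1)" by blast
      then have "(\<Sum>a\<in>UNIV. (a :: 'a) ^ ?m j) = 0" using finite_field_power_sum[of "?m j", where 'a='a] by simp
      then have "(\<Prod>j<d. [:\<Sum>a\<in>UNIV. (a :: 'a) ^ ?m j:]) = 0" using j by (intro prod_zero) auto
      then show ?thesis using False by simp
    qed
    finally show ?thesis .
  qed
  have "(\<Sum>c\<in>?C. \<Prod>s\<in>I. (\<Sum>j<d. [:c j:] * x s ^ j) + x s ^ d) =
    (\<Sum>c\<in>?C. \<Sum>J\<in>?J. (\<Prod>s\<in>I. c' c (J s)) * (\<Prod>s\<in>I. x s ^ J s))"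
  proof (intro sum.cong refl)
    fix c
    have "(\<Prod>s\<in>I. \<Sum>j\<le>d. c' c j * x s ^ j) = (\<Sum>J\<in>?J. \<Prod>s\<in>I. c' c (J s) * x s ^ J s)"
      using I(1) by (rule prod_sum_PiE) simp
    then show "(\<Prod>s\<in>I. (\<Sum>j<d. [:c j:] * x s ^ j) + x s ^ d) = (\<Sum>J\<in>?J. (\<Prod>s\<in>I. c' c (J s)) * (\<Prod>s\<in>I. x s ^ J s))"
      by (simp only: in1 prod.distrib)
  qed
  also have "\<dots> = (\<Sum>J\<in>?J. (\<Sum>c\<in>?C. \<Prod>s\<in>I. c' c (J s)) * (\<Prod>s\<in>I. x s ^ J s))"
    unfolding sum_distrib_right by (rule sum.swap)
  also have "\<dots> = (\<Sum>J\<in>?J. if J \<in> balanced I d ?q then (-1) ^ d * (\<Prod>s\<in>I. x s ^ J s) else 0)"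
    by (intro sum.cong refl) (auto simp: S)
  also have "\<dots> = (\<Sum>J\<in>balanced I d ?q. (-1) ^ d * (\<Prod>s\<in>I. x s ^ J s))"
    using I by (intro sum.mono_neutral_cong_right) (auto simp: balanced_def intro!: finite_PiE)
  finally show ?thesis by (simp add: sum_distrib_left)
qed

lemma monic_deg_bij:
  "bij_betw (\<lambda>a. restrict (coeff a) {..<d}) (monic_deg d :: 'a::field poly set) (PiE {..<d} (\<lambda>_. UNIV :: 'a set))"
proof -
  let ?h = "\<lambda>c. (\<Sum>j<d. monom (c j) j) + monom 1 d :: 'a poly"
  have co: "coeff (?h c) i = (if i < d then c i else if i = d then 1 else 0)" for c i
    by (simp add: coeff_sum)
  show ?thesis
  proof (rule bij_betw_byWitness[where f' = ?h])
    show "\<forall>c\<in>PiE {..<d} (\<lambda>_. UNIV). restrict (coeff (?h c)) {..<d} = c"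
    proof
      fix c assume "c \<in> PiE {..<d} (\<lambda>_. UNIV :: 'a set)"
      then show "restrict (coeff (?h c)) {..<d} = c"
        by (intro PiE_ext[of _ "{..<d}" "\<lambda>_. UNIV"]) (simp_all only: restrict_PiE Pi_UNIV UNIV_I co restrict_apply if_True lessThan_iff)
    qed
    show "\<forall>a\<in>monic_deg d. ?h (restrict (coeff a) {..<d}) = a"
    proof
      fix a :: "'a poly" assume "a \<in> monic_deg d"
      then have "coeff a d = 1" "\<And>i. d < i \<Longrightarrow> coeff a i = 0" by (auto simp: monic_deg_def coeff_eq_0)
      then show "?h (restrict (coeff a) {..<d}) = a"
        by (intro poly_eqI) (simp only: co restrict_apply lessThan_iff split: if_splits, metis linorder_neqE_nat)
    qed
    show "?h ` PiE {..<d} (\<lambda>_. UNIV) \<subseteq> monic_deg d"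
    proof
      fix a assume "a \<in> ?h ` PiE {..<d} (\<lambda>_. UNIV)"
      then obtain c where a: "a = ?h c" by blast
      have "degree a \<le> d" unfolding a by (intro degree_le allI impI) (simp only: co, simp)
      moreover have "coeff a d = 1" by (simp only: a co, simp)
      ultimately have "degree a = d" by (metis le_antisym le_degree zero_neq_one)
      then show "a \<in> monic_deg d" using \<open>coeff a d = 1\<close> by (simp add: monic_deg_def)
    qed
    show "(\<lambda>a. restrict (coeff a) {..<d}) ` (monic_deg d :: 'a poly set) \<subseteq> PiE {..<d} (\<lambda>_. UNIV)"
      by (intro image_subsetI) (simp only: restrict_PiE Pi_UNIV UNIV_I)
  qed
qed


section \<open>Optimal path systems\<close>

text \<open>
  A token of class \<open>b\<close> stands for one unit of a base-\<open>p\<close> digit of \<open>K\<close> at a position congruent to \<open>b\<close> modulo \<open>n\<close>;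
  \<open>v b i\<close> is the place value of the \<open>i\<close>-th smallest of the \<open>A b\<close> tokens of class \<open>b\<close>. The assumptions
  reflect that a digit is at most \<open>p - 1\<close> and that distinct classes have distinct place values.

  In a path system \<open>x g j\<close> is the position of path \<open>j\<close> at level \<open>g\<close>, and \<open>pos x b j\<close> is the number of
  smallest tokens of class \<open>b\<close> consumed by path \<open>j\<close>; the degree of its contribution is a constant minus \<open>cost x\<close>.
\<close>

locale token_classes =
  fixes p n d :: nat and A :: "nat \<Rightarrow> nat" and v :: "nat \<Rightarrow> nat \<Rightarrow> nat"
  assumes p2: "2 \<le> p"
    and v_mono: "\<lbrakk>b < n; i \<le> j; j < A b\<rbrakk> \<Longrightarrow> v b i \<le> v b j"
    and v_pos: "\<lbrakk>b < n; i < A b\<rbrakk> \<Longrightarrow> 0 < v b i"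
    and v_double: "\<lbrakk>b < n; i + (p - 1) < A b\<rbrakk> \<Longrightarrow> 2 * v b i \<le> v b (i + (p - 1))"
    and v_sep: "\<lbrakk>b < n; c < n; b \<noteq> c; i < A b; j < A c\<rbrakk> \<Longrightarrow> 2 * v b i \<le> v c j \<or> 2 * v c j \<le> v b i"
    and v_sum: "\<lbrakk>b < n; i < A b\<rbrakk> \<Longrightarrow> (\<Sum>c<n. \<Sum>j\<in>{j. j < A c \<and> v c j < v b i}. v c j) < v b i"
begin

definition pos :: "(nat \<Rightarrow> nat \<Rightarrow> nat) \<Rightarrow> nat \<Rightarrow> nat \<Rightarrow> nat" where
  "pos x b j = p * x (Suc b) j - x b j"

definition valid :: "(nat \<Rightarrow> nat \<Rightarrow> nat) \<Rightarrow> bool" where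
  "valid x \<longleftrightarrow> (\<forall>b<n. \<forall>j<d. x b j \<le> p * x (Suc b) j \<and> pos x b j \<le> A b)"

text \<open>The ends may be permuted, as in a Leibniz expansion. Positions on a level are only
  required to be distinct; that optimal systems are ordered is proved below.\<close>

definition path_system :: "(nat \<Rightarrow> nat \<Rightarrow> nat) \<Rightarrow> bool" where
  "path_system x \<longleftrightarrow> (\<forall>j<d. x 0 j = Suc j) \<and> x n ` {..<d} = Suc ` {..<d}
     \<and> (\<forall>g\<le>n. inj_on (x g) {..<d}) \<and> valid x"

definition sorted_system :: "(nat \<Rightarrow> nat \<Rightarrow> nat) \<Rightarrow> bool" where
  "sorted_system x \<longleftrightarrow> (\<forall>j<d. x 0 j = Suc j \<and> x n j = Suc j)
     \<and> (\<forall>g\<le>n. \<forall>j. Suc j < d \<longrightarrow> x g j < x g (Suc j)) \<and> valid x"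

definition prefix_sum :: "nat \<Rightarrow> nat \<Rightarrow> nat" where
  "prefix_sum b m = (\<Sum>i<m. v b i)"

definition cost :: "(nat \<Rightarrow> nat \<Rightarrow> nat) \<Rightarrow> nat" where
  "cost x = (\<Sum>b<n. \<Sum>j<d. prefix_sum b (pos x b j))"

definition optimal :: "(nat \<Rightarrow> nat \<Rightarrow> nat) \<Rightarrow> bool" where
  "optimal x \<longleftrightarrow> path_system x \<and> (\<forall>z. path_system z \<longrightarrow> cost x \<le> cost z)"

lemma prefix_sum_Suc [simp]: "prefix_sum b (Suc m) = prefix_sum b m + v b m"
  by (simp add: prefix_sum_def)

lemma prefix_sum_mono: "m \<le> m' \<Longrightarrow> prefix_sum b m \<le> prefix_sum b m'"
  unfolding prefix_sum_def by (rule sum_mono2) auto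

lemma prefix_sum_less_add: "m < m' \<Longrightarrow> prefix_sum b m + v b (m' - 1) \<le> prefix_sum b m'"
  using prefix_sum_mono[of m "m' - 1" b] by (cases m') auto

lemma prefix_sum_convex_aux:
  assumes "b < n" "s2 \<le> A b" "s1 + 2 * m \<le> s2"
  shows "prefix_sum b (s1 + m) + prefix_sum b (s2 - m) \<le> prefix_sum b s1 + prefix_sum b s2"
  using assms(3)
proof (induction m)
  case (Suc m)
  have "prefix_sum b (s2 - m) = prefix_sum b (s2 - Suc m) + v b (s2 - Suc m)"
    using Suc.prems prefix_sum_Suc[of b "s2 - Suc m"] by (simp add: Suc_diff_Suc)
  moreover have "v b (s1 + m) \<le> v b (s2 - Suc m)"
    using Suc.prems assms by (intro v_mono) auto
  ultimately show ?case using Suc by simp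
qed simp

text \<open>The increments of \<open>prefix_sum b\<close> are the sorted token values, so it is
  convex up to \<open>A b\<close>, and the more balanced pair costs no more.\<close>

lemma prefix_sum_convex:
  assumes "b < n" "s2 \<le> A b" "s1 \<le> r1" "s1 \<le> r2" "r1 + r2 = s1 + s2"
  shows "prefix_sum b r1 + prefix_sum b r2 \<le> prefix_sum b s1 + prefix_sum b s2"
proof (cases "r1 \<le> r2")
  case True
  then have "r1 = s1 + (r1 - s1)" "r2 = s2 - (r1 - s1)" "s1 + 2 * (r1 - s1) \<le> s2" using assms by auto
  then show ?thesis using prefix_sum_convex_aux[OF assms(1,2), of s1 "r1 - s1"] by simp
next
  case False
  then have "r2 = s1 + (r2 - s1)" "r1 = s2 - (r2 - s1)" "s1 + 2 * (r2 - s1) \<le> s2" using assms by auto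
  then show ?thesis using prefix_sum_convex_aux[OF assms(1,2), of s1 "r2 - s1"] by simp
qed

lemma v_less: 
  assumes "b < n" "i + (p - 1) \<le> j" "j < A b"
  shows "v b i < v b j"
proof -
  have "0 < v b i" using assms by (intro v_pos) auto
  moreover have "2 * v b i \<le> v b (i + (p - 1))" using assms by (intro v_double) auto
  moreover have "v b (i + (p - 1)) \<le> v b j" using assms by (intro v_mono) auto
  ultimately show ?thesis by simp
qed

text \<open>Tokens of one class that are p - 1 places apart differ in value. As s2 - 1 >= s1 + (p -
  1), releasing token s2 - 1 and taking token \<open>s1\<close> is a strict gain.\<close>

lemma prefix_sum_strict_convex:
  assumes "b < n" "s2 \<le> A b" "s1 < r1" "s1 < r2" "r1 + r2 = s1 + s2" "s1 + p \<le> s2"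
  shows "prefix_sum b r1 + prefix_sum b r2 < prefix_sum b s1 + prefix_sum b s2"
proof -
  have "prefix_sum b r1 + prefix_sum b r2 \<le> prefix_sum b (Suc s1) + prefix_sum b (s2 - 1)"
    using assms by (intro prefix_sum_convex) auto
  moreover have "prefix_sum b s2 = prefix_sum b (s2 - 1) + v b (s2 - 1)"
    using assms prefix_sum_Suc[of b "s2 - 1"] p2 by simp
  moreover have "v b s1 < v b (s2 - 1)"
    using assms p2 by (intro v_less) auto
  ultimately show ?thesis by simp
qed

lemma sorted_system_less:
  assumes "sorted_system x" "g \<le> n" "i < j" "j < d"
  shows "x g i < x g j"
  using assms(3,4)
proof (induction j)
  case (Suc j)
  then show ?case using assms(1,2) unfolding sorted_system_def
    by (metis Suc_lessD less_SucE less_trans)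
qed simp

lemma sorted_imp_path_system:
  assumes "sorted_system x" shows "path_system x"
proof -
  have "inj_on (x g) {..<d}" if "g \<le> n" for g
    using sorted_system_less[OF assms that] by (intro inj_onI) (metis lessThan_iff linorder_neq_iff)
  then show ?thesis using assms unfolding sorted_system_def path_system_def by auto
qed

text \<open>Exchange argument: where two paths first change order, between levels g and g + 1,
  swapping their continuations keeps the set of positions on every level and brings the two
  consumptions closer together, which lowers the cost.\<close>

lemma optimal_imp_sorted:
  assumes opt: "optimal x" shows "sorted_system x"
proof -
  have sys: "path_system x" and val: "valid x" using opt by (auto simp: optimal_def path_system_def)
  have mono: "\<forall>i j. i < j \<longrightarrow> j < d \<longrightarrow> x g i < x g j" if "g \<le> n" for g
    using that
  proof (induction g)
    case 0
    then show ?case using sys by (auto simp: path_system_def)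
  next
    case (Suc g)
    then have IH: "\<And>i j. i < j \<Longrightarrow> j < d \<Longrightarrow> x g i < x g j" and g: "g < n" by auto
    show ?case
    proof (rule ccontr)
      assume "\<not> ?thesis"
      then obtain i j where ij: "i < j" "j < d" "x (Suc g) j \<le> x (Suc g) i" by force
      then have lt: "x (Suc g) j < x (Suc g) i"
        using sys Suc.prems unfolding path_system_def inj_on_def
        by (metis lessThan_iff less_trans nat_less_le)
      define \<tau> where "\<tau> = Transposition.transpose i j"
      have bij: "bij_betw \<tau> {..<d} {..<d}"
        unfolding \<tau>_def using ij by (intro bij_betw_byWitness[where f'="Transposition.transpose i j"]) 
          (auto simp: Transposition.transpose_def)
      then have \<tau>lt: "j' < d \<Longrightarrow> \<tau> j' < d" for j' using bij_betwE by fastforce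
      define z where "z h = (if h \<le> g then x h else x h \<circ> \<tau>)" for h
      have pos_other: "pos z h = (if h < g then pos x h else pos x h \<circ> \<tau>)" if "h \<noteq> g" for h
        using that by (auto simp: z_def pos_def fun_eq_iff)
      have xi: "x g i < x g j" using IH ij by simp
      have vi: "x g i \<le> p * x (Suc g) i" "p * x (Suc g) i - x g i \<le> A g"
        and vj: "x g j \<le> p * x (Suc g) j" "p * x (Suc g) j - x g j \<le> A g"
        using val g ij unfolding valid_def pos_def by auto
      have pgi: "pos z g i = p * x (Suc g) j - x g i" and pgj: "pos z g j = p * x (Suc g) i - x g j"
        by (auto simp: pos_def z_def \<tau>_def)
      \<comment> \<open>Distinct positions at level g + 1 are at least one apart, and the factor
        \<open>p\<close> turns this into the gap that strict convexity asks for.\<close>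
      have plt: "p * x (Suc g) j + p \<le> p * x (Suc g) i" using lt
        by (metis Suc_leI add.commute mult_Suc_right mult_le_mono2)
      have pgo: "pos z g l = pos x g l" if "l \<noteq> i" "l \<noteq> j" for l
        using that by (auto simp: pos_def z_def \<tau>_def)
      have zval: "valid z"
        unfolding valid_def
      proof (intro allI impI)
        fix b l assume bl: "b < n" "l < d"
        consider "b < g" | "b > g" | "b = g" "l = i" | "b = g" "l = j" | "b = g" "l \<noteq> i" "l \<noteq> j" by linarith
        then show "z b l \<le> p * z (Suc b) l \<and> pos z b l \<le> A b"
        proof cases
          case 1
          then show ?thesis using val bl pos_other[of b] by (auto simp: valid_def z_def)
        next
          case 2
          then show ?thesis using val bl pos_other[of b] \<tau>lt[of l] by (auto simp: valid_def z_def)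
        next
          case 3
          then show ?thesis using pgi xi plt vi vj by (auto simp: z_def \<tau>_def)
        next
          case 4
          then show ?thesis using pgj xi plt vi vj by (auto simp: z_def \<tau>_def)
        next
          case 5
          then show ?thesis using pgo[of l] val bl by (auto simp: z_def \<tau>_def valid_def)
        qed
      qed
      have inj: "inj_on (z h) {..<d}" if "h \<le> n" for h
      proof (cases "h \<le> g")
        case True
        then show ?thesis using sys that by (auto simp: z_def path_system_def)
      next
        case False
        have "inj_on (x h \<circ> \<tau>) {..<d}"
          using sys that bij by (intro comp_inj_on) (auto simp: path_system_def bij_betw_def)
        then show ?thesis using False by (simp add: z_def)
      qed
      have "z n ` {..<d} = x n ` {..<d}"
        using g bij unfolding z_def bij_betw_def by (auto simp flip: image_image simp: image_comp[symmetric])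
      then have zsys: "path_system z"
        using sys zval inj unfolding path_system_def by (auto simp: z_def)
      have eq: "(\<Sum>l<d. prefix_sum b (pos z b l)) = (\<Sum>l<d. prefix_sum b (pos x b l))" if "b \<noteq> g" for b
      proof (cases "b < g")
        case True
        then show ?thesis using pos_other[of b] by simp
      next
        case False
        have "(\<Sum>l<d. prefix_sum b (pos x b (\<tau> l))) = (\<Sum>l<d. prefix_sum b (pos x b l))"
          using sum.reindex_bij_betw[OF bij] .
        then show ?thesis using pos_other[OF that] False by simp
      qed
      have split: "(\<Sum>l<d. f l) = f i + f j + (\<Sum>l\<in>{..<d} - {i, j}. f l)" for f :: "nat \<Rightarrow> nat"
      proof -
        have "(\<Sum>l<d. f l) = (\<Sum>l\<in>{i,j}. f l) + (\<Sum>l\<in>{..<d} - {i, j}. f l)"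
          using ij by (subst sum.subset_diff[of "{i,j}"]) auto
        then show ?thesis using ij by simp
      qed
      have "prefix_sum g (pos z g i) + prefix_sum g (pos z g j) < prefix_sum g (p * x (Suc g) j - x g j) + prefix_sum g (p * x (Suc g) i - x g i)"
        unfolding pgi pgj
        using xi plt vi vj p2 g by (intro prefix_sum_strict_convex) linarith+
      then have less_g: "(\<Sum>l<d. prefix_sum g (pos z g l)) < (\<Sum>l<d. prefix_sum g (pos x g l))"
        unfolding split using pgo by (simp add: pos_def)
      have "cost z < cost x" unfolding cost_def
      proof (rule sum_strict_mono_ex1)
        show "\<forall>b\<in>{..<n}. (\<Sum>l<d. prefix_sum b (pos z b l)) \<le> (\<Sum>l<d. prefix_sum b (pos x b l))"
        proof
          show "(\<Sum>l<d. prefix_sum b (pos z b l)) \<le> (\<Sum>l<d. prefix_sum b (pos x b l))" for b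
            using eq[of b] less_g by (cases "b = g") auto
        qed
      qed (use g less_g in auto)
      then show False using opt zsys by (auto simp: optimal_def)
    qed
  qed
  \<comment> \<open>An increasing sequence of \<open>d\<close> numbers between 1 and
    \<open>d\<close> leaves no choice.\<close>
  have gap: "i + k < d \<Longrightarrow> x n i + k \<le> x n (i + k)" for i k
  proof (induction k)
    case (Suc k)
    then have "x n (i + k) < x n (i + Suc k)" using mono[of n] by simp
    then show ?case using Suc by simp
  qed simp
  have "x n j = Suc j" if "j < d" for j
  proof -
    have im: "x n i \<in> Suc ` {..<d}" if "i < d" for i
      using sys that unfolding path_system_def by blast
    have "1 \<le> x n 0" using im[of 0] that by auto
    moreover have "x n (d - 1) \<le> d" using im[of "d - 1"] that by auto
    ultimately show ?thesis using gap[of 0 j] gap[of j "d - 1 - j"] that by auto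
  qed
  then show ?thesis using sys mono unfolding sorted_system_def path_system_def by auto
qed

section \<open>Uniqueness of the optimal system\<close>

lemma pos_eq: "valid x \<Longrightarrow> b < n \<Longrightarrow> j < d \<Longrightarrow> p * x (Suc b) j = pos x b j + x b j"
  by (simp add: valid_def pos_def)

text \<open>The cost is submodular: each summand is a convex function of the difference between
  \<open>p\<close> times a position and the position one level earlier. Passing to minimum and
  maximum either keeps the two differences or replaces them by a pair lying between them.\<close>

lemma meet_join:
  assumes x: "sorted_system x" and y: "sorted_system y"
  defines "m \<equiv> \<lambda>g j. min (x g j) (y g j)" and "M \<equiv> \<lambda>g j. max (x g j) (y g j)"
  shows "sorted_system m" "sorted_system M" "cost m + cost M \<le> cost x + cost y"
proof -
  have step: "m b j \<le> p * m (Suc b) j \<and> pos m b j \<le> A b \<and> M b j \<le> p * M (Suc b) j \<and> pos M b j \<le> A b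
      \<and> prefix_sum b (pos m b j) + prefix_sum b (pos M b j) \<le> prefix_sum b (pos x b j) + prefix_sum b (pos y b j)"
    if bj: "b < n" "j < d" for b j
  proof -
    have vx: "x b j \<le> p * x (Suc b) j" "p * x (Suc b) j - x b j \<le> A b"
      and vy: "y b j \<le> p * y (Suc b) j" "p * y (Suc b) j - y b j \<le> A b"
      using x y bj unfolding sorted_system_def valid_def pos_def by auto
    \<comment> \<open>The crossed pairs (X, Q) and (Y, P) are given; the uncrossed pairs (X, P) and
      (Y, Q) have consumptions between theirs and the same sum.\<close>
    have *: "P \<le> p * X \<and> p * X - P \<le> A b \<and> Q \<le> p * Y \<and> p * Y - Q \<le> A b \<and>
       prefix_sum b (p * X - P) + prefix_sum b (p * Y - Q) \<le> prefix_sum b (p * X - Q) + prefix_sum b (p * Y - P)"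
      if "X \<le> Y" "P \<le> Q" "Q \<le> p * X" "p * X - Q \<le> A b" "P \<le> p * Y" "p * Y - P \<le> A b" for X Y P Q
    proof -
      have "p * X \<le> p * Y" using that by simp
      then show ?thesis using that bj
        by (intro conjI prefix_sum_convex) linarith+
    qed
    show ?thesis
    proof (cases "x (Suc b) j \<le> y (Suc b) j")
      case True
      then have "p * x (Suc b) j \<le> p * y (Suc b) j" by simp
      then show ?thesis using True *[of "x (Suc b) j" "y (Suc b) j" "y b j" "x b j"] vx vy
        unfolding m_def M_def pos_def by (cases "x b j \<le> y b j") auto
    next
      case False
      then have "p * y (Suc b) j \<le> p * x (Suc b) j" by simp
      then show ?thesis using False *[of "y (Suc b) j" "x (Suc b) j" "x b j" "y b j"] vx vy
        unfolding m_def M_def pos_def by (cases "y b j \<le> x b j") auto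
    qed
  qed
  then have "valid m" "valid M" by (auto simp: valid_def)
  moreover have "m g j < m g (Suc j) \<and> M g j < M g (Suc j)" if "g \<le> n" "Suc j < d" for g j
  proof -
    have "x g j < x g (Suc j)" "y g j < y g (Suc j)"
      using x y that by (auto simp: sorted_system_def)
    then show ?thesis unfolding m_def M_def by auto
  qed
  moreover have "m 0 j = Suc j \<and> m n j = Suc j \<and> M 0 j = Suc j \<and> M n j = Suc j" if "j < d" for j
    using x y that by (auto simp: sorted_system_def m_def M_def)
  ultimately show "sorted_system m" "sorted_system M"
    by (auto simp: sorted_system_def)
  have "cost m + cost M = (\<Sum>b<n. \<Sum>j<d. prefix_sum b (pos m b j) + prefix_sum b (pos M b j))"
    by (simp add: cost_def sum.distrib)
  also have "\<dots> \<le> (\<Sum>b<n. \<Sum>j<d. prefix_sum b (pos x b j) + prefix_sum b (pos y b j))"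
    using step by (intro sum_mono) auto
  also have "\<dots> = cost x + cost y"
    by (simp add: cost_def sum.distrib)
  finally show "cost m + cost M \<le> cost x + cost y" .
qed

lemma row_eqI:
  assumes "sorted_system x" "sorted_system y" "k < d" "\<And>b. b < n \<Longrightarrow> pos x b k = pos y b k" "g \<le> n"
  shows "x g k = y g k"
  using assms(5)
proof (induction g)
  case 0
  then show ?case using assms by (auto simp: sorted_system_def)
next
  case (Suc g)
  then have "p * x (Suc g) k = p * y (Suc g) k"
    using assms pos_eq[of x g k] pos_eq[of y g k] by (simp add: sorted_system_def)
  then show ?case using p2 by simp
qed

text \<open>As for integers in base p, the largest token in which two rows differ decides: by
  \<open>v_sum\<close> it exceeds the sum of all smaller tokens of all classes.\<close>

lemma raise_row_cost:
  assumes val: "valid x" "valid y" and k: "k < d" and e: "e < n" and lt: "pos x e k < pos y e k"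
    and dom: "\<And>b. b < n \<Longrightarrow> pos y b k < pos x b k \<Longrightarrow> v b (pos x b k - 1) < v e (pos y e k - 1)"
  shows "(\<Sum>b<n. prefix_sum b (pos x b k)) < (\<Sum>b<n. prefix_sum b (pos y b k))"
proof -
  let ?t = "v e (pos y e k - 1)"
  have Ay: "pos y b k \<le> A b" and Ax: "pos x b k \<le> A b" if "b < n" for b
    using val k that by (auto simp: valid_def)
  let ?S = "\<lambda>b. \<Sum>j\<in>{j. j < A b \<and> v b j < ?t}. v b j"
  have 1: "prefix_sum b (pos x b k) \<le> prefix_sum b (pos y b k) + ?S b" if b: "b < n" for b
  proof (cases "pos y b k < pos x b k")
    case True
    have "prefix_sum b (pos x b k) = prefix_sum b (pos y b k) + (\<Sum>j\<in>{pos y b k..<pos x b k}. v b j)"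
      using sum.atLeastLessThan_concat[of 0 "pos y b k" "pos x b k" "v b"] True
      by (simp add: prefix_sum_def lessThan_atLeast0)
    also have "(\<Sum>j\<in>{pos y b k..<pos x b k}. v b j) \<le> ?S b"
    proof (intro sum_mono2 subsetI)
      fix j assume j: "j \<in> {pos y b k..<pos x b k}"
      then have "v b j \<le> v b (pos x b k - 1)" using Ax[OF b] b by (intro v_mono) auto
      then show "j \<in> {j. j < A b \<and> v b j < ?t}" using dom[OF b True] j Ax[OF b] by simp
    qed simp_all
    finally show ?thesis by simp
  next
    case False
    then show ?thesis using prefix_sum_mono[of "pos x b k" "pos y b k" b] by simp
  qed
  have "(\<Sum>b<n. prefix_sum b (pos x b k)) = prefix_sum e (pos x e k) + (\<Sum>b\<in>{..<n}-{e}. prefix_sum b (pos x b k))"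
    using e by (subst sum.remove[of _ e]) simp_all
  also have "\<dots> \<le> prefix_sum e (pos x e k) + (\<Sum>b\<in>{..<n}-{e}. prefix_sum b (pos y b k) + ?S b)"
    by (intro add_left_mono sum_mono 1) simp
  also have "\<dots> \<le> prefix_sum e (pos x e k) + (\<Sum>b\<in>{..<n}-{e}. prefix_sum b (pos y b k)) + (\<Sum>b<n. ?S b)"
  proof -
    have "(\<Sum>b\<in>{..<n}-{e}. ?S b) \<le> (\<Sum>b<n. ?S b)" by (intro sum_mono2) simp_all
    then show ?thesis by (simp add: sum.distrib)
  qed
  also have "\<dots> < prefix_sum e (pos x e k) + (\<Sum>b\<in>{..<n}-{e}. prefix_sum b (pos y b k)) + ?t"
    using v_sum[of e "pos y e k - 1"] e lt Ay[OF e] by simp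
  also have "\<dots> \<le> prefix_sum e (pos y e k) + (\<Sum>b\<in>{..<n}-{e}. prefix_sum b (pos y b k))"
    using prefix_sum_less_add[OF lt, of e] by simp
  also have "\<dots> = (\<Sum>b<n. prefix_sum b (pos y b k))"
    using e by (subst sum.remove[of _ e]) simp_all
  finally show ?thesis .
qed

lemma sum_halves: "(\<Sum>j<k. (h::real) / 2 ^ (k - j)) = h - h / 2 ^ k"
proof (induction k)
  case (Suc k)
  have "(\<Sum>j<k. h / 2 ^ (Suc k - j)) = (\<Sum>j<k. h / 2 ^ (k - j)) / 2"
    unfolding sum_divide_distrib by (intro sum.cong) (auto simp: Suc_diff_le)
  then show ?case using Suc.IH by (simp add: diff_divide_distrib mult.commute)
qed simp

lemma v_geometric:
  assumes "b < n" "i + (p - 1) * t \<le> j" "j < A b"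
  shows "v b i * 2 ^ t \<le> v b j"
proof -
  have "v b i * 2 ^ t \<le> v b (i + (p - 1) * t)"
    using assms(2)
  proof (induction t)
    case (Suc t)
    then have "v b i * 2 ^ Suc t \<le> 2 * v b (i + (p - 1) * t)" by simp
    also have "\<dots> \<le> v b (i + (p - 1) * t + (p - 1))"
      using Suc.prems assms by (intro v_double) auto
    finally show ?case by (simp only: mult_Suc_right add.assoc add.commute[of "p - 1"])
  qed simp
  also have "\<dots> \<le> v b j" using assms by (intro v_mono)
  finally show ?thesis .
qed

end

context token_classes begin

text \<open>
  Push row \<open>k\<close> down by one on the levels between \<open>e\<close> and \<open>f\<close>, and let \<open>w\<close> be the largest family below \<open>x\<close>
  compatible with this. Every token that \<open>w\<close> consumes in addition to \<open>x\<close> sits at least \<open>p - 1\<close> places below the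
  corresponding one of the next row, so the added values decay geometrically and cannot make up for
  the token of class \<open>e\<close> that row \<open>k\<close> releases.
\<close>

lemma lower_row_improves:
  assumes x: "sorted_system x" and y: "sorted_system y"
    and le: "\<And>g j. g \<le> n \<Longrightarrow> j < d \<Longrightarrow> y g j \<le> x g j"
    and k: "k < d" and above: "\<And>g j. g \<le> n \<Longrightarrow> k < j \<Longrightarrow> j < d \<Longrightarrow> y g j = x g j"
    and e: "e < n" and epos: "pos y e k < pos x e k"
    and dom: "\<And>b. b < n \<Longrightarrow> pos x b k < pos y b k \<Longrightarrow> 2 * v b (pos x b k) \<le> v e (pos x e k - 1)"
  shows "\<exists>z. sorted_system z \<and> cost z < cost x"
proof -
  have valx: "valid x" and valy: "valid y" using x y by (auto simp: sorted_system_def)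
  have ends: "x 0 j = Suc j" "x n j = Suc j" "y 0 j = Suc j" "y n j = Suc j" if "j < d" for j
    using x y that by (auto simp: sorted_system_def)
  have "y (Suc e) k \<noteq> x (Suc e) k"
  proof
    assume "y (Suc e) k = x (Suc e) k"
    then show False using pos_eq[OF valx e k] pos_eq[OF valy e k] epos le[of e k] e k by simp
  qed
  then have De: "y (Suc e) k < x (Suc e) k" using le[of "Suc e" k] e k by simp
  \<comment> \<open>After level \<open>e\<close>, row \<open>k\<close> of \<open>y\<close> runs
    below that of \<open>x\<close> until level \<open>c\<close>; the rows meet again at the latest
    at level \<open>n\<close>. The last step of this stretch is the one of class \<open>f\<close>,
    where \<open>y\<close> has to consume more.\<close>
  define c where "c = (LEAST g. e < g \<and> y g k = x g k)"
  have c: "e < c \<and> y c k = x c k"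
    unfolding c_def by (rule LeastI[of _ n]) (use e ends k in auto)
  have cn: "c \<le> n" unfolding c_def by (rule Least_le) (use e ends k in auto)
  define f where "f = c - 1"
  have fc: "Suc f = c" using c by (simp add: f_def)
  have ef: "e < f" using c De fc by (metis less_antisym nat_neq_iff)
  have fn: "f < n" using cn fc by simp
  have low: "y g k < x g k" if "e < g" "g \<le> f" for g
  proof -
    have "\<not> (e < g \<and> y g k = x g k)"
      using not_less_Least[of g "\<lambda>g. e < g \<and> y g k = x g k"] that fc c_def by simp
    then show ?thesis using le[of g k] that k fn by simp
  qed
  have fpos: "pos x f k < pos y f k"
    using pos_eq[OF valx fn k] pos_eq[OF valy fn k] low[of f] ef c fc by simp
  \<comment> \<open>The bound by \<open>A b\<close> is left out on purpose: raising an entry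
    increases the consumption one level earlier by \<open>p\<close>, which would spoil the
    maximality argument. The bound is recovered for \<open>w\<close> in \<open>wA\<close>.\<close>
  define Z where "Z = {z :: nat \<Rightarrow> nat \<Rightarrow> nat. (\<forall>g\<le>n. \<forall>j<d. z g j \<le> x g j)
     \<and> (\<forall>j<d. z 0 j = Suc j \<and> z n j = Suc j)
     \<and> (\<forall>g\<le>n. \<forall>j. Suc j < d \<longrightarrow> z g j < z g (Suc j))
     \<and> (\<forall>b<n. \<forall>j<d. z b j \<le> p * z (Suc b) j)
     \<and> (\<forall>g. e < g \<and> g \<le> f \<longrightarrow> z g k < x g k)
     \<and> (\<forall>g\<le>n. \<forall>j. k < j \<and> j < d \<longrightarrow> z g j = x g j)}"
  have yZ: "y \<in> Z" using y le low above unfolding Z_def sorted_system_def valid_def by auto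
  \<comment> \<open>The constraints of \<open>Z\<close> survive pointwise maxima, so
    \<open>w\<close> satisfies them itself; the next facts check this one by one.\<close>
  define w where "w g j = Max ((\<lambda>z. z g j) ` Z)" for g j
  have fin: "finite ((\<lambda>z. z g j) ` Z)" if "g \<le> n" "j < d" for g j
    by (rule finite_subset[of _ "{..x g j}"]) (use that in \<open>auto simp: Z_def\<close>)
  have wge: "z g j \<le> w g j" if "z \<in> Z" "g \<le> n" "j < d" for z g j
    unfolding w_def using fin that by (intro Max_ge) auto
  have wex: "\<exists>z\<in>Z. w g j = z g j" if "g \<le> n" "j < d" for g j
    using Max_in[OF fin[OF that]] yZ unfolding w_def by auto
  have wle: "w g j \<le> x g j" if "g \<le> n" "j < d" for g j
    using wex[OF that] that by (auto simp: Z_def)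
  have wends: "w 0 j = Suc j" "w n j = Suc j" if "j < d" for j
    using wex[of 0 j] wex[of n j] that by (auto simp: Z_def)
  have winc: "w g j < w g (Suc j)" if gj: "g \<le> n" "Suc j < d" for g j
  proof -
    obtain z where z: "z \<in> Z" "w g j = z g j" using wex[of g j] gj by auto
    then have "z g j < z g (Suc j)" using that by (auto simp: Z_def)
    then show ?thesis using wge[OF z(1), of g "Suc j"] z that by simp
  qed
  have wstep: "w b j \<le> p * w (Suc b) j" if bj: "b < n" "j < d" for b j
  proof -
    obtain z where z: "z \<in> Z" "w b j = z b j" using wex[of b j] bj by auto
    then have "z b j \<le> p * z (Suc b) j" using that by (auto simp: Z_def)
    also have "\<dots> \<le> p * w (Suc b) j" using wge[OF z(1), of "Suc b" j] that by simp
    finally show ?thesis using z by simp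
  qed
  have wlow: "w g k < x g k" if "e < g" "g \<le> f" for g
    using wex[of g k] k that fn by (auto simp: Z_def)
  have wabove: "w g j = x g j" if "g \<le> n" "k < j" "j < d" for g j
    using wex[of g j] that by (auto simp: Z_def)
  have wpos: "p * w (Suc b) j = pos w b j + w b j" if "b < n" "j < d" for b j
    using wstep[OF that] by (simp add: pos_def)
  have xpos: "p * x (Suc b) j = pos x b j + x b j" if "b < n" "j < d" for b j
    using pos_eq[OF valx that] .
  \<comment> \<open>Maximality of \<open>w\<close>: a lowered entry cannot be raised by one inside \<open>Z\<close>.\<close>
  have tight: "(j = k \<and> e < g \<and> g \<le> f \<and> x g k = Suc (w g k)) \<or> (j < k \<and> w g (Suc j) = Suc (w g j)) \<or>
      (g < n \<and> pos w g j = 0)"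
    if g: "g \<le> n" and j: "j \<le> k" and lt: "w g j < x g j" for g j
  proof (rule ccontr)
    assume neg: "\<not> ?thesis"
    have jd: "j < d" using j k by simp
    have gn: "g < n" "g \<noteq> 0" using lt wends[OF jd] ends[OF jd] g by (metis less_irrefl nat_less_le)+
    define z where "z h i = (if h = g \<and> i = j then Suc (w g j) else w h i)" for h i
    have inc: "z h i < z h (Suc i)" if "h \<le> n" "Suc i < d" for h i
    proof (cases "h = g \<and> i = j")
      case True
      have "Suc (w g j) \<noteq> w g (Suc j)"
      proof (cases "j < k")
        case True
        then show ?thesis using neg by auto
      next
        case False
        then have "j = k" using j by simp
        then have "w g (Suc j) = x g (Suc j)" using wabove[of g "Suc j"] g that True by simp
        moreover have "x g j < x g (Suc j)" using x that True by (auto simp: sorted_system_def)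
        ultimately show ?thesis using lt by simp
      qed
      then show ?thesis using True winc[OF that] by (auto simp: z_def)
    next
      case False
      then show ?thesis using winc[OF that] by (auto simp: z_def)
    qed
    have step: "z b i \<le> p * z (Suc b) i" if "b < n" "i < d" for b i
    proof -
      have "0 < pos w g j" using neg gn by auto
      then have "Suc (w g j) \<le> p * w (Suc g) j" using wpos[OF gn(1) jd] by simp
      moreover have "w b i \<le> p * w (Suc b) i" by (rule wstep[OF that])
      moreover have "p * w (Suc b) i \<le> p * Suc (w (Suc b) i)" by simp
      ultimately show ?thesis by (auto simp: z_def)
    qed
    have "z g' k < x g' k" if "e < g'" "g' \<le> f" for g'
      using wlow[OF that] neg that by (auto simp: z_def)
    then have "z \<in> Z" using inc step wle wends gn wabove lt j unfolding Z_def by (auto simp: z_def)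
    then have "z g j \<le> w g j" using wge g jd by blast
    then show False by (simp add: z_def)
  qed
  \<comment> \<open>A lowered entry of \<open>w\<close> that still consumes is held down by the next
    row, unless it lies in row \<open>k\<close>. Moving up row by row, the consumption grows by at
    least p - 1 each time: the positions differ by one here, and on the next level by at least one,
    which counts \<open>p\<close> times.\<close>
  have chain: "e < b \<and> b \<le> f \<and> x b j = Suc (w b j) \<and> x b k = Suc (w b k) \<and>
      pos w b j + (p - 1) * (k - j) \<le> pos w b k"
    if b: "b < n" and "j \<le> k" "0 < pos w b j" "w b j < x b j" for b j
    using that(2-4)
  proof (induction "k - j" arbitrary: j)
    case 0
    then show ?case using tight[of b j] b by auto
  next
    case (Suc m)
    then have jk: "j < k" and jd: "Suc j < d" using k by auto
    have w1: "w b (Suc j) = Suc (w b j)" using tight[of b j] Suc.prems jk b by auto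
    have "x b j < x b (Suc j)" using x jd b by (auto simp: sorted_system_def)
    then have lt: "w b (Suc j) < x b (Suc j)" using Suc.prems w1 by simp
    have "w (Suc b) j < w (Suc b) (Suc j)" using winc[of "Suc b" j] b jd by simp
    then have "p * w (Suc b) j + p \<le> p * w (Suc b) (Suc j)"
      by (metis Suc_leI add.commute mult_Suc_right mult_le_mono2)
    then have ps: "pos w b j + (p - 1) \<le> pos w b (Suc j)"
      using wpos[of b j] wpos[of b "Suc j"] b jd w1 p2 by simp
    have IH: "e < b \<and> b \<le> f \<and> x b (Suc j) = Suc (w b (Suc j)) \<and> x b k = Suc (w b k) \<and>
      pos w b (Suc j) + (p - 1) * (k - Suc j) \<le> pos w b k"
      using Suc.hyps(1)[of "Suc j"] Suc.hyps(2) Suc.prems ps lt jk by simp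
    have "(p - 1) * (k - j) = (p - 1) + (p - 1) * (k - Suc j)"
      using jk by (metis Suc_diff_Suc mult_Suc_right)
    then show ?case using IH ps w1 Suc.prems(3) \<open>x b j < x b (Suc j)\<close> by linarith
  qed
  \<comment> \<open>The entry at level \<open>b\<close> is lowered by exactly one. A lowered entry
    at the next level would cost \<open>p\<close> tokens and outweigh this, so there is none and the
    gain is a single token.\<close>
  have addition: "e < b \<and> b \<le> f \<and> pos w b j = Suc (pos x b j) \<and> x (Suc b) j = w (Suc b) j \<and>
      x b k = Suc (w b k) \<and> pos w b j + (p - 1) * (k - j) \<le> pos w b k"
    if b: "b < n" and j: "j \<le> k" and lt: "pos x b j < pos w b j" for b j
  proof -
    have jd: "j < d" using j k by simp
    have "p * w (Suc b) j \<le> p * x (Suc b) j" using wle[of "Suc b" j] b jd by simp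
    then have lw: "w b j < x b j" using wpos[OF b jd] xpos[OF b jd] lt by linarith
    note ch = chain[OF b j _ lw]
    have xw: "x b j = Suc (w b j)" using ch lt by simp
    have "x (Suc b) j = w (Suc b) j"
    proof (rule ccontr)
      assume "x (Suc b) j \<noteq> w (Suc b) j"
      then have "Suc (w (Suc b) j) \<le> x (Suc b) j" using wle[of "Suc b" j] b jd by simp
      then have "p * w (Suc b) j + p \<le> p * x (Suc b) j"
        by (metis add.commute mult_Suc_right mult_le_mono2)
      then show False using wpos[OF b jd] xpos[OF b jd] lt xw p2 by linarith
    qed
    then show ?thesis using ch lt wpos[OF b jd] xpos[OF b jd] xw by auto
  qed
  \<comment> \<open>Row \<open>k\<close> of \<open>w\<close> stays strictly below \<open>x\<close>
    up to level \<open>f\<close>. A gain needs agreement with \<open>x\<close> on the following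
    level, so in this row it can only occur at \<open>f\<close>.\<close>
  have topk: "pos w b k \<le> pos x b k" if "b < n" "b \<noteq> f" for b
  proof (rule ccontr)
    assume "\<not> ?thesis"
    then have "e < b" "b \<le> f" "x (Suc b) k = w (Suc b) k" using addition[of b k] that by auto
    then show False using wlow[of "Suc b"] that by simp
  qed
  have topf: "pos w f k \<le> Suc (pos x f k)"
    using addition[OF fn order_refl] by (metis le_SucI le_refl not_le_imp_less)
  have Ax: "pos x b j \<le> A b" if "b < n" "j < d" for b j
    using valx that by (auto simp: valid_def)
  have fA: "pos x f k < A f" using fpos valy fn k by (fastforce simp: valid_def)
  have wA: "pos w b j \<le> A b" if b: "b < n" and j: "j < d" for b j
  proof (cases "j \<le> k \<and> pos x b j < pos w b j")
    case True
    then have "pos w b j \<le> pos w b k" using addition[OF b] by fastforce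
    also have "\<dots> \<le> A b" using topk[OF b] topf fA Ax[OF b k] by (cases "b = f") auto
    finally show ?thesis .
  next
    case False
    have "pos w b j \<le> pos x b j"
    proof (cases "j \<le> k")
      case False
      then show ?thesis using wabove[of b j] wabove[of "Suc b" j] b j by (simp add: pos_def)
    qed (use False in auto)
    then show ?thesis using Ax[OF b j] by simp
  qed
  have wsys: "sorted_system w"
    unfolding sorted_system_def valid_def using wends winc wstep wA by auto
  define D where "D b j = real (prefix_sum b (pos w b j)) - real (prefix_sum b (pos x b j))" for b j
  have Dle: "D b j \<le> 0" if "pos w b j \<le> pos x b j" for b j
    using prefix_sum_mono[OF that] by (simp add: D_def)
  have Dadd: "D b j = real (v b (pos w b j - 1))" if "b < n" "j \<le> k" "pos x b j < pos w b j" for b j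
    using addition[OF that] by (simp add: D_def)
  have Dgeom: "D b j \<le> real h / 2 ^ (k - j)"
    if b: "b < n" and j: "j \<le> k" and i: "pos w b k - 1 \<le> i" "i < A b" and h: "h = v b i" for b j h i
  proof (cases "pos x b j < pos w b j")
    case True
    have "v b (pos w b j - 1) * 2 ^ (k - j) \<le> h"
      unfolding h using addition[OF b j True] True i by (intro v_geometric[OF b]) auto
    then have "real (v b (pos w b j - 1)) * 2 ^ (k - j) \<le> real h"
      by (metis of_nat_le_iff of_nat_mult of_nat_numeral of_nat_power)
    then show ?thesis using Dadd[OF b j True] by (simp add: field_simps)
  next
    case False
    then have "D b j \<le> 0" using Dle by simp
    also have "0 \<le> real h / 2 ^ (k - j)" by simp
    finally show ?thesis .
  qed
  let ?R = "\<lambda>b. \<Sum>j<d. D b j"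
  have Rk: "?R b = (\<Sum>j<k. D b j) + D b k" if "b < n" for b
  proof -
    have "?R b = (\<Sum>j\<le>k. D b j)"
    proof (rule sum.mono_neutral_right)
      show "\<forall>j\<in>{..<d} - {..k}. D b j = 0"
        using wabove that by (auto simp: D_def pos_def)
    qed (use k in auto)
    then show ?thesis by (simp add: lessThan_Suc_atMost[symmetric])
  qed
  have Rlow: "?R b \<le> D b k" if b: "b < n" and nb: "\<not> (e < b \<and> b \<le> f)" for b
  proof -
    have "D b j \<le> 0" if "j < k" for j
      using addition[OF b, of j] nb that Dle[of b j] by (metis less_imp_le not_le_imp_less)
    then have "(\<Sum>j<k. D b j) \<le> 0" by (intro sum_nonpos) auto
    then show ?thesis unfolding Rk[OF b] by simp
  qed
  \<comment> \<open>A gain in a lower row forces row \<open>k\<close> to release at least one token,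
    of value at least \<open>V\<close>, while the lower rows gain at most V/2, V/4 and so
    on.\<close>
  have Rmid: "?R b \<le> 0" if b: "e < b" "b < f" for b
  proof -
    have bn: "b < n" using b fn by simp
    have Dk: "D b k \<le> 0" using topk[OF bn] b Dle by auto
    show ?thesis
    proof (cases "\<exists>j<k. pos x b j < pos w b j")
      case False
      then have "D b j \<le> 0" if "j < k" for j using Dle[of b j] that by (metis not_le_imp_less)
      then have "(\<Sum>j<k. D b j) \<le> 0" by (intro sum_nonpos) auto
      then show ?thesis using Dk Rk[OF bn] by simp
    next
      case True
      then obtain j where j: "j < k" "pos x b j < pos w b j" by blast
      have "x b k = Suc (w b k)" using addition[OF bn _ j(2)] j by simp
      moreover have "Suc (w (Suc b) k) \<le> x (Suc b) k" using wlow[of "Suc b"] b by simp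
      then have "p * w (Suc b) k + p \<le> p * x (Suc b) k"
        by (metis add.commute mult_Suc_right mult_le_mono2)
      ultimately have lt: "pos w b k < pos x b k"
        using wpos[OF bn k] xpos[OF bn k] p2 by linarith
      define V where "V = v b (pos w b k)"
      have iA: "pos w b k < A b" using lt Ax[OF bn k] by simp
      have "(\<Sum>j<k. D b j) \<le> (\<Sum>j<k. real V / 2 ^ (k - j))"
        using iA bn by (intro sum_mono Dgeom[where i = "pos w b k"]) (auto simp: V_def)
      also have "\<dots> \<le> real V" unfolding sum_halves by simp
      also have "real V \<le> - D b k"
      proof -
        have "V \<le> v b (pos x b k - 1)" unfolding V_def using lt Ax[OF bn k] bn by (intro v_mono) auto
        then have "prefix_sum b (pos w b k) + V \<le> prefix_sum b (pos x b k)" using prefix_sum_less_add[OF lt, of b] by simp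
        then have "real (prefix_sum b (pos w b k)) + real V \<le> real (prefix_sum b (pos x b k))"
          by (metis of_nat_add of_nat_le_iff)
        then show ?thesis by (simp add: D_def)
      qed
      finally show ?thesis using Rk[OF bn] by simp
    qed
  qed
  define h where "h = v f (pos x f k)"
  \<comment> \<open>At level \<open>f\<close> row \<open>k\<close> gains at most one token, of value
    \<open>h\<close>, and the rows below it together gain less than \<open>h\<close>.\<close>
  have hpos: "0 < h" unfolding h_def using fn fA by (intro v_pos)
  have Rf: "?R f < 2 * real h"
  proof -
    have g: "D f j \<le> real h / 2 ^ (k - j)" if "j \<le> k" for j
      using topf fA fn that by (intro Dgeom[where i = "pos x f k"]) (auto simp: h_def)
    have "(\<Sum>j<k. D f j) \<le> (\<Sum>j<k. real h / 2 ^ (k - j))" using g by (intro sum_mono) auto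
    also have "\<dots> < real h" unfolding sum_halves using hpos by simp
    finally show ?thesis using Rk[OF fn] g[of k] by simp
  qed
  have Re: "?R e \<le> - real (v e (pos x e k - 1))"
  proof -
    have lt: "pos w e k < pos x e k"
    proof (cases "w e k < x e k")
      case True
      then show ?thesis using tight[of e k] e epos by auto
    next
      case False
      then have "w e k = x e k" using wle[of e k] e k by simp
      moreover have "Suc (w (Suc e) k) \<le> x (Suc e) k" using wlow[of "Suc e"] ef by simp
      then have "p * w (Suc e) k + p \<le> p * x (Suc e) k"
        by (metis add.commute mult_Suc_right mult_le_mono2)
      ultimately show ?thesis using wpos[OF e k] xpos[OF e k] p2 by linarith
    qed
    then have "prefix_sum e (pos w e k) + v e (pos x e k - 1) \<le> prefix_sum e (pos x e k)" by (rule prefix_sum_less_add)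
    then have "real (prefix_sum e (pos w e k)) + real (v e (pos x e k - 1)) \<le> real (prefix_sum e (pos x e k))"
      by (metis of_nat_add of_nat_le_iff)
    then show ?thesis using Rlow[OF e] by (simp add: D_def)
  qed
  have Rother: "?R b \<le> 0" if "b < n" "b \<noteq> e" "b \<noteq> f" for b
  proof (cases "e < b \<and> b \<le> f")
    case True
    then show ?thesis using Rmid that by simp
  next
    case False
    then show ?thesis using Rlow[OF that(1)] Dle[OF topk] that by fastforce
  qed
  have "real (cost w) - real (cost x) = (\<Sum>b<n. ?R b)"
    by (simp add: cost_def D_def sum_subtractf)
  also have "\<dots> = ?R e + ?R f + (\<Sum>b\<in>{..<n} - {e, f}. ?R b)"
  proof -
    have "(\<Sum>b<n. ?R b) = (\<Sum>b\<in>{e,f}. ?R b) + (\<Sum>b\<in>{..<n} - {e, f}. ?R b)"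
      using e fn by (subst sum.subset_diff[of "{e,f}"]) auto
    then show ?thesis using ef by simp
  qed
  \<comment> \<open>The factor 2 in \<open>dom\<close>, which stems from the separation of classes,
    pays for both halves of the gain at level \<open>f\<close>: that of row \<open>k\<close> and
    that of the rows below.\<close>
  also have "\<dots> < 0"
  proof -
    have "(\<Sum>b\<in>{..<n} - {e, f}. ?R b) \<le> 0" by (rule sum_nonpos) (use Rother in auto)
    moreover have "2 * real h \<le> real (v e (pos x e k - 1))"
      using dom[OF fn fpos] unfolding h_def[symmetric] by linarith
    ultimately show ?thesis using Re Rf by linarith
  qed
  finally have "cost w < cost x" by simp
  then show ?thesis using wsys by blast
qed

text \<open>Let \<open>k\<close> be the largest row in which the systems differ and \<open>e\<close>
  the class of the largest token consumed there by only one of them. If \<open>x\<close> consumes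
  more in class \<open>e\<close>, lowering row \<open>k\<close> improves \<open>x\<close>; otherwise
  row \<open>k\<close> of \<open>x\<close> is cheaper and can replace that of
  \<open>y\<close>.\<close>

lemma optimal_unique_le:
  assumes ox: "optimal x" and oy: "optimal y"
    and le: "\<And>g j. g \<le> n \<Longrightarrow> j < d \<Longrightarrow> y g j \<le> x g j"
    and "g \<le> n" "j < d"
  shows "x g j = y g j"
proof (rule ccontr)
  assume ne: "x g j \<noteq> y g j"
  have x: "sorted_system x" and y: "sorted_system y" using ox oy optimal_imp_sorted by auto
  have valx: "valid x" and valy: "valid y" using x y by (auto simp: sorted_system_def)
  define K where "K = {j. j < d \<and> (\<exists>g\<le>n. x g j \<noteq> y g j)}"
  have K: "finite K" "K \<noteq> {}" using ne assms(4,5) by (auto simp: K_def)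
  define k where "k = Max K"
  have "k \<in> K" using K Max_in k_def by blast
  then have k: "k < d" and "\<exists>g\<le>n. x g k \<noteq> y g k" by (auto simp: K_def)
  have above: "y g j = x g j" if "g \<le> n" "k < j" "j < d" for g j
  proof (rule ccontr)
    assume "y g j \<noteq> x g j"
    then have "j \<in> K" using that unfolding K_def by force
    then show False using K(1) that k_def by (meson Max_ge leD)
  qed
  define B where "B = {b. b < n \<and> pos x b k \<noteq> pos y b k}"
  have B: "finite B" "B \<noteq> {}"
    using row_eqI[OF x y k] \<open>\<exists>g\<le>n. _\<close> by (auto simp: B_def)
  \<comment> \<open>For \<open>b\<close> in \<open>B\<close>, this is the value of the largest token
    of class \<open>b\<close> that only one of the two rows consumes.\<close>
  define t where "t b = v b (max (pos x b k) (pos y b k) - 1)" for b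
  obtain e where e: "e \<in> B" "\<And>b. b \<in> B \<Longrightarrow> t b \<le> t e"
  proof -
    have "Max (t ` B) \<in> t ` B" using B by (intro Max_in) auto
    then show ?thesis using that B by (metis (no_types, lifting) Max_ge finite_imageI image_iff)
  qed
  have en: "e < n" "pos x e k \<noteq> pos y e k" using e by (auto simp: B_def)
  have Ax: "pos x b k \<le> A b" and Ay: "pos y b k \<le> A b" if "b < n" for b
    using valx valy k that by (auto simp: valid_def)
  have tdom: "2 * t b \<le> t e" if "b \<in> B" "b \<noteq> e" for b
  proof -
    have b: "b < n" "pos x b k \<noteq> pos y b k" using that by (auto simp: B_def)
    have "2 * t b \<le> t e \<or> 2 * t e \<le> t b"
      unfolding t_def using b en that Ax[OF b(1)] Ay[OF b(1)] Ax[OF en(1)] Ay[OF en(1)]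
      by (intro v_sep) auto
    moreover have "0 < t e" unfolding t_def using en Ax[OF en(1)] Ay[OF en(1)] by (intro v_pos) auto
    ultimately show ?thesis using e(2)[OF that(1)] by linarith
  qed
  show False
  proof (cases "pos y e k < pos x e k")
    case True
    have "2 * v b (pos x b k) \<le> v e (pos x e k - 1)" if "b < n" "pos x b k < pos y b k" for b
    proof -
      have "v b (pos x b k) \<le> t b"
        unfolding t_def using that Ay[OF that(1)] by (intro v_mono) auto
      moreover have "2 * t b \<le> t e" using that True by (intro tdom) (auto simp: B_def)
      moreover have "t e = v e (pos x e k - 1)" using True by (simp add: t_def max_def)
      ultimately show ?thesis by simp
    qed
    then obtain z where "sorted_system z" "cost z < cost x"
      using lower_row_improves[OF x y le k above en(1) True] by blast
    then show False using ox sorted_imp_path_system[of z] by (auto simp: optimal_def)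
  next
    case False
    then have lt: "pos x e k < pos y e k" using en by simp
    \<comment> \<open>Above row \<open>k\<close> the systems agree, and below it \<open>y\<close>
      lies under \<open>x\<close>, so the mixed system is still increasing.\<close>
    define z where "z g j = (if j = k then x g k else y g j)" for g j
    have zpos: "pos z b j = (if j = k then pos x b k else pos y b j)" for b j
      by (simp add: pos_def z_def)
    have zinc: "z g j < z g (Suc j)" if "g \<le> n" "Suc j < d" for g j
    proof -
      have "x g j < x g (Suc j)" "y g j < y g (Suc j)"
        using x y that by (auto simp: sorted_system_def)
      moreover have "y g j \<le> x g j" using le that by simp
      moreover have "j = k \<Longrightarrow> y g (Suc j) = x g (Suc j)" using above that by simp
      ultimately show ?thesis by (auto simp: z_def)
    qed
    have "z b j \<le> p * z (Suc b) j \<and> pos z b j \<le> A b" if "b < n" "j < d" for b j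
      using valx valy that by (auto simp: zpos valid_def) (auto simp: z_def valid_def)
    then have zs: "sorted_system z"
      using x y zinc k unfolding sorted_system_def valid_def by (auto simp: z_def)
    have "v b (pos x b k - 1) < v e (pos y e k - 1)" if "b < n" "pos y b k < pos x b k" for b
    proof -
      have "2 * t b \<le> t e" using that lt by (intro tdom) (auto simp: B_def)
      moreover have "0 < t b" unfolding t_def using that Ax[OF that(1)] by (intro v_pos) auto
      ultimately show ?thesis using lt that by (simp add: t_def max_def)
    qed
    then have "(\<Sum>b<n. prefix_sum b (pos x b k)) < (\<Sum>b<n. prefix_sum b (pos y b k))"
      by (intro raise_row_cost[OF valx valy k en(1) lt])
    moreover have "cost u = (\<Sum>b<n. prefix_sum b (pos u b k)) + (\<Sum>j\<in>{..<d} - {k}. \<Sum>b<n. prefix_sum b (pos u b j))" for u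
      unfolding cost_def using k by (subst sum.swap, subst sum.remove[of _ k]) auto
    ultimately have "cost z < cost y" by (simp add: zpos)
    then show False using oy sorted_imp_path_system[OF zs] by (auto simp: optimal_def)
  qed
qed

text \<open>By submodularity the minimum and the maximum of two optimal systems are optimal as well,
  and these two are comparable.\<close>

lemma optimal_unique:
  assumes ox: "optimal x" and oy: "optimal y" and gj: "g \<le> n" "j < d"
  shows "x g j = y g j"
proof -
  have x: "sorted_system x" and y: "sorted_system y" using ox oy optimal_imp_sorted by auto
  let ?m = "\<lambda>g j. min (x g j) (y g j)" and ?M = "\<lambda>g j. max (x g j) (y g j)"
  note mj = meet_join[OF x y]
  have "cost x \<le> cost ?m" "cost x \<le> cost ?M" "cost x = cost y"
    using ox oy mj sorted_imp_path_system unfolding optimal_def by (auto intro: order_antisym)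
  then have "cost ?m = cost x" "cost ?M = cost x" using mj(3) by linarith+
  then have "optimal ?m" "optimal ?M" using ox mj sorted_imp_path_system by (auto simp: optimal_def)
  then have "?M g j = ?m g j" by (intro optimal_unique_le[OF _ _ _ gj]) auto
  then show ?thesis by (simp add: max_def min_def split: if_splits)
qed

text \<open>Greedy construction from the top row downwards, and within a row from level
  \<open>n\<close> back to level 0: every entry is as large as the next level and either the
  capacity or the row above permit.\<close>

lemma sorted_system_exists:
  assumes W: "\<And>b. b \<le> n \<Longrightarrow> (p ^ b - 1) * d \<le> (\<Sum>c<b. p ^ c * A c)"
  shows "\<exists>x. sorted_system x"
proof -
  define row where "row m X \<longleftrightarrow> X 0 = m \<and> X n = m \<and> (\<forall>g\<le>n. m \<le> X g) \<and>
    (\<forall>b<n. X b \<le> p * X (Suc b) \<and> p * X (Suc b) - X b \<le> A b)" for m and X :: "nat \<Rightarrow> nat"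
  define W where "W b = (\<Sum>c<b. p ^ c * A c)" for b
  \<comment> \<open>A path that starts at \<open>d\<close> and consumes all tokens of the classes
    below \<open>b\<close> satisfies p^b X = W b + d, whence the cap; the hypothesis makes the cap
    at least \<open>d\<close>.\<close>
  define top where "top = rec_nat d (\<lambda>i Y. min ((W (n - Suc i) + d) div p ^ (n - Suc i)) (p * Y))"
  define X where "X g = top (n - g)" for g
  have Xn: "X n = d" by (simp add: X_def top_def)
  have Xb: "X b = min ((W b + d) div p ^ b) (p * X (Suc b))" if "b < n" for b
  proof -
    have "n - b = Suc (n - Suc b)" using that by simp
    then show ?thesis using that by (simp add: X_def top_def)
  qed
  have cap: "d \<le> (W b + d) div p ^ b" if "b \<le> n" for b
  proof -
    obtain m where "p ^ b = Suc m" using p2 by (metis not0_implies_Suc not_numeral_le_zero power_not_zero)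
    then have "d * p ^ b = (p ^ b - 1) * d + d" by simp
    also have "\<dots> \<le> W b + d" using W[OF that] by (simp add: W_def)
    finally show ?thesis using p2 by (simp add: less_eq_div_iff_mult_less_eq)
  qed
  have ge: "d \<le> X g" if "g \<le> n" for g
    using that
  proof (induction rule: inc_induct)
    case base
    then show ?case using Xn by simp
  next
    case (step b)
    have "d \<le> p * d" using p2 by simp
    also have "\<dots> \<le> p * X (Suc b)" using step by simp
    finally show ?case using Xb[of b] cap[of b] step by simp
  qed
  have capX: "X g \<le> (W g + d) div p ^ g" if "g \<le> n" for g
    using Xb[of g] Xn cap[of n] that by (cases "g = n") auto
  have rX: "row d X"
  proof -
    have "X 0 = d" using capX[of 0] ge[of 0] by (simp add: W_def)
    moreover have "X b \<le> p * X (Suc b) \<and> p * X (Suc b) - X b \<le> A b" if b: "b < n" for b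
    proof (cases "X b = p * X (Suc b)")
      case False
      then have xb: "X b = (W b + d) div p ^ b" "X b \<le> p * X (Suc b)" using Xb[OF b] by (auto simp: min_def split: if_splits)
      have "X (Suc b) \<le> (W (Suc b) + d) div p ^ Suc b" using capX[of "Suc b"] b by simp
      also have "\<dots> = (W (Suc b) + d) div p ^ b div p" by (metis div_mult2_eq mult.commute power_Suc)
      also have "W (Suc b) + d = (W b + d) + A b * p ^ b" by (simp add: W_def algebra_simps)
      also have "((W b + d) + A b * p ^ b) div p ^ b = X b + A b" using xb p2 by simp
      finally have "p * X (Suc b) \<le> p * ((X b + A b) div p)" by simp
      also have "\<dots> \<le> X b + A b" by simp
      finally show ?thesis using xb by simp
    qed simp
    ultimately show ?thesis using Xn ge by (simp add: row_def)
  qed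
  have down: "\<exists>x. (\<forall>j<m. row (Suc j) (\<lambda>g. x g j)) \<and> (\<forall>g\<le>n. \<forall>j. Suc j < m \<longrightarrow> x g j < x g (Suc j))
     \<and> (0 < m \<longrightarrow> (\<forall>g. x g (m - 1) = X g))" if "row m X" for m X
    using that
  proof (induction m arbitrary: X)
    case (Suc m)
    \<comment> \<open>Staying one below \<open>X\<close> keeps the rows distinct. Where this
      constraint is active at \<open>b\<close>, the next position is also lower by one, which counts
      \<open>p\<close> times, so \<open>Y\<close> consumes less than \<open>X\<close> and inherits
      its capacity bound.\<close>
    define Y where "Y g = rec_nat m (\<lambda>i Z. min (X (n - Suc i) - 1) (p * Z)) (n - g)" for g
    have Yn: "Y n = m" by (simp add: Y_def)
    have Yb: "Y b = min (X b - 1) (p * Y (Suc b))" if "b < n" for b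
    proof -
      have "n - b = Suc (n - Suc b)" using that by simp
      then show ?thesis using that by (simp add: Y_def)
    qed
    have Xge: "Suc m \<le> X g" if "g \<le> n" for g using Suc.prems that by (simp add: row_def)
    have Xr: "X 0 = Suc m" "X n = Suc m" and Xst: "\<And>b. b < n \<Longrightarrow> X b \<le> p * X (Suc b) \<and> p * X (Suc b) - X b \<le> A b"
      using Suc.prems by (auto simp: row_def)
    have Yge: "m \<le> Y g" if "g \<le> n" for g
      using that
    proof (induction rule: inc_induct)
      case base
      then show ?case using Yn by simp
    next
      case (step b)
      have "m \<le> p * m" using p2 by simp
      also have "\<dots> \<le> p * Y (Suc b)" using step by simp
      finally show ?case using Yb[of b] Xge[of b] step by simp
    qed
    have Yle: "Y g \<le> X g - 1" if "g \<le> n" for g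
      using Yb[of g] Yn Xr that by (cases "g = n") auto
    have "Y b \<le> p * Y (Suc b) \<and> p * Y (Suc b) - Y b \<le> A b" if b: "b < n" for b
    proof (cases "Y b = p * Y (Suc b)")
      case False
      then have yb: "Y b = X b - 1" "Y b \<le> p * Y (Suc b)" using Yb[OF b] by (auto simp: min_def split: if_splits)
      have "Suc (Y (Suc b)) \<le> X (Suc b)" using Yle[of "Suc b"] Xge[of "Suc b"] b by simp
      then have "p * Y (Suc b) + p \<le> p * X (Suc b)"
        by (metis add.commute mult_Suc_right mult_le_mono2)
      then show ?thesis using yb Xst[OF b] Xge[of b] b p2 by linarith
    qed simp
    moreover have "Y 0 = m" using Yge[of 0] Yle[of 0] Xr by simp
    ultimately have "row m Y" using Yn Yge by (simp add: row_def)
    then obtain x where x: "\<forall>j<m. row (Suc j) (\<lambda>g. x g j)" "\<forall>g\<le>n. \<forall>j. Suc j < m \<longrightarrow> x g j < x g (Suc j)"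
      "0 < m \<longrightarrow> (\<forall>g. x g (m - 1) = Y g)" using Suc.IH by blast
    define z where "z g j = (if j = m then X g else x g j)" for g j
    have "z g j < z g (Suc j)" if "g \<le> n" "Suc j < Suc m" for g j
    proof (cases "Suc j = m")
      case True
      then have "x g j = Y g" using x(3) by auto
      then show ?thesis using True Yle[of g] Xge[of g] that by (simp add: z_def)
    next
      case False
      then show ?thesis using x(2) that by (simp add: z_def)
    qed
    moreover have "row (Suc j) (\<lambda>g. z g j)" if "j < Suc m" for j
      using x(1) Suc.prems that by (cases "j = m") (auto simp: z_def)
    ultimately show ?case by (intro exI[of _ z]) (auto simp: z_def)
  qed simp
  obtain x where "\<forall>j<d. row (Suc j) (\<lambda>g. x g j)" "\<forall>g\<le>n. \<forall>j. Suc j < d \<longrightarrow> x g j < x g (Suc j)"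
    using down[OF rX] by blast
  then have "sorted_system x" by (auto simp: sorted_system_def valid_def row_def pos_def)
  then show ?thesis by blast
qed

lemma unique_optimal:
  assumes "\<And>b. b \<le> n \<Longrightarrow> (p ^ b - 1) * d \<le> (\<Sum>c<b. p ^ c * A c)"
  obtains x where "sorted_system x"
    and "\<And>z. path_system z \<Longrightarrow> cost z \<le> cost x \<Longrightarrow> \<forall>g\<le>n. \<forall>j<d. z g j = x g j"
proof -
  obtain x0 where "path_system x0" using sorted_system_exists assms sorted_imp_path_system by blast
  then obtain x where x: "path_system x" "\<And>z. path_system z \<Longrightarrow> cost x \<le> cost z"
    using ex_has_least_nat[of path_system x0 cost] by blast
  then have ox: "optimal x" by (simp add: optimal_def)
  have "\<forall>g\<le>n. \<forall>j<d. z g j = x g j" if "path_system z" "cost z \<le> cost x" for z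
  proof -
    have "optimal z" unfolding optimal_def using that x order_trans by blast
    then show ?thesis using optimal_unique[OF _ ox] by blast
  qed
  then show ?thesis using that optimal_imp_sorted[OF ox] by blast
qed

end


section \<open>Expansion of the determinant over path systems\<close>

lemma coeff_pcompose_monom_1:
  fixes F :: "'r::comm_ring_1 poly"
  assumes "p > 0" shows "coeff (pcompose F (monom 1 p)) k = (if p dvd k then coeff F (k div p) else 0)"
proof (induction F arbitrary: k)
  case (pCons a F)
  show ?case
  proof (cases "k < p")
    case True
    then have "p dvd k \<longleftrightarrow> k = 0" using assms by (auto dest: dvd_imp_le)
    then show ?thesis using True by (auto simp: pcompose_pCons coeff_monom_mult coeff_pCons split: nat.split)
  next
    case False
    have k: "k \<noteq> 0" using False assms by (cases k) auto
    have d: "p dvd k \<longleftrightarrow> p dvd (k - p)" using False by (metis dvd_minus_self not_less)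
    have "k div p = Suc ((k - p) div p)" using False assms by (simp add: le_div_geq)
    then show ?thesis using False k d by (auto simp: pcompose_pCons coeff_monom_mult pCons.IH coeff_pCons split: nat.split)
  qed
qed simp

text \<open>The exponent splits as p a - b = (p X - b) + p (a - X). Terms with X > a vanish, so the
  range of summation can be independent of \<open>a\<close>; the identity is then a product of
  matrices.\<close>

lemma coeff_at_diff_step:
  fixes G F :: "'r::idom poly"
  assumes p: "p > 0" and B: "a \<le> B"
  shows "coeff_at_diff (G * pcompose F (monom 1 p)) (p * a) b = (\<Sum>X\<le>B. coeff_at_diff G (p * X) b * coeff_at_diff F a X)"
proof -
  let ?H = "pcompose F (monom 1 p)"
  let ?S = "{X. X \<le> a \<and> b \<le> p * X}"
  have R: "(\<Sum>X\<le>B. coeff_at_diff G (p * X) b * coeff_at_diff F a X) = (\<Sum>X\<in>?S. coeff G (p * X - b) * coeff F (a - X))"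
    using B by (intro sum.mono_neutral_cong_right) (auto simp: coeff_at_diff_def)
  show ?thesis
  proof (cases "b \<le> p * a")
    case True
    define m where "m = p * a - b"
    have "coeff_at_diff (G * ?H) (p * a) b = (\<Sum>k\<le>m. coeff ?H k * coeff G (m - k))"
      using True by (simp add: coeff_at_diff_def m_def mult.commute[of G] coeff_mult)
    also have "\<dots> = (\<Sum>k\<in>(\<lambda>X. p * (a - X)) ` ?S. coeff ?H k * coeff G (m - k))"
    proof (intro sum.mono_neutral_right)
      show "(\<lambda>X. p * (a - X)) ` ?S \<subseteq> {..m}"
      proof (intro image_subsetI)
        fix X assume "X \<in> ?S"
        then have "p * (a - X) = p * a - p * X" "b \<le> p * X" by (simp_all add: diff_mult_distrib2)
        then show "p * (a - X) \<in> {..m}" unfolding m_def atMost_iff by linarith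
      qed
      show "\<forall>k\<in>{..m} - (\<lambda>X. p * (a - X)) ` ?S. coeff ?H k * coeff G (m - k) = 0"
      proof
        fix k assume k: "k \<in> {..m} - (\<lambda>X. p * (a - X)) ` ?S"
        have "\<not> p dvd k"
        proof
          assume "p dvd k"
          then obtain w where w: "k = p * w" by blast
          moreover have "k \<le> p * a - b" using k by (simp add: m_def)
          ultimately have "b + p * w \<le> p * a" using True by linarith
          then have "p * w \<le> p * a" by linarith
          then have "w \<le> a" using p by simp
          then have "a - w \<in> ?S" "k = p * (a - (a - w))"
            using w \<open>b + p * w \<le> p * a\<close> by (auto simp: diff_mult_distrib2)
          then show False using k by blast
        qed
        then show "coeff ?H k * coeff G (m - k) = 0" using p by (simp add: coeff_pcompose_monom_1)
      qed
    qed auto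
    also have "\<dots> = (\<Sum>X\<in>?S. coeff ?H (p * (a - X)) * coeff G (m - p * (a - X)))"
    proof (rule sum.reindex_cong[OF _ refl refl])
      show "inj_on (\<lambda>X. p * (a - X)) ?S"
      proof (rule inj_onI)
        fix X Y assume "X \<in> ?S" "Y \<in> ?S" "p * (a - X) = p * (a - Y)"
        then have "X \<le> a" "Y \<le> a" "a - X = a - Y" using p by simp_all
        then show "X = Y" by linarith
      qed
    qed
    also have "\<dots> = (\<Sum>X\<in>?S. coeff G (p * X - b) * coeff F (a - X))"
    proof (intro sum.cong refl)
      fix X assume "X \<in> ?S"
      then have X: "X \<le> a" "b \<le> p * X" by auto
      have "p * X \<le> p * a" "p * (a - X) = p * a - p * X" using X by (simp_all add: diff_mult_distrib2)
      then have "m - p * (a - X) = p * X - b" using X unfolding m_def by linarith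
      then show "coeff ?H (p * (a - X)) * coeff G (m - p * (a - X)) = coeff G (p * X - b) * coeff F (a - X)"
        using p by (simp add: coeff_pcompose_monom_1 mult.commute)
    qed
    finally show ?thesis using R by simp
  next
    case False
    have "?S = {}"
    proof -
      have "\<not> b \<le> p * X" if "X \<le> a" for X using False mult_le_mono2[OF that, of p] by linarith
      then show ?thesis by auto
    qed
    then have "(\<Sum>X\<in>?S. coeff G (p * X - b) * coeff F (a - X)) = 0" by (simp only: sum.empty)
    then show ?thesis using False R by (simp only: coeff_at_diff_def if_False)
  qed
qed

lemma sum_unique_degree:
  fixes f :: "'s \<Rightarrow> 'r::comm_ring_1 poly"
  assumes "finite S" "s0 \<in> S" "f s0 \<noteq> 0" "\<And>s. s \<in> S \<Longrightarrow> s \<noteq> s0 \<Longrightarrow> f s = 0 \<or> degree (f s) < degree (f s0)"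
  shows "sum f S \<noteq> 0" "degree (sum f S) = degree (f s0)"
proof -
  let ?N = "degree (f s0)"
  have "coeff (sum f S) ?N = coeff (f s0) ?N + (\<Sum>s\<in>S - {s0}. coeff (f s) ?N)"
    using assms by (simp add: coeff_sum sum.remove[of _ s0])
  also have "(\<Sum>s\<in>S - {s0}. coeff (f s) ?N) = 0"
  proof (rule sum.neutral, rule ballI)
    fix s assume "s \<in> S - {s0}"
    then have "f s = 0 \<or> degree (f s) < ?N" using assms(4) by blast
    then show "coeff (f s) ?N = 0" by (auto simp: coeff_eq_0)
  qed
  finally have c: "coeff (sum f S) ?N \<noteq> 0" using assms(3) by simp
  then show "sum f S \<noteq> 0" by auto
  have "degree (sum f S) \<le> ?N"
  proof (rule degree_sum_le[OF assms(1)])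
    fix s assume "s \<in> S"
    then show "degree (f s) \<le> ?N" using assms(4)[of s] by (cases "s = s0") auto
  qed
  then show "degree (sum f S) = ?N" using c le_degree by (metis antisym)
qed

text \<open>There are \<open>m\<close> levels left, and \<open>y\<close> holds the current
  positions, one per row. For m = n and y = \<open>Suc\<close> this is the determinant of the
  transposed \<open>dual_matrix\<close>.\<close>

definition level_det :: "nat \<Rightarrow> nat \<Rightarrow> nat \<Rightarrow> 'r::comm_ring_1 poly \<Rightarrow> (nat \<Rightarrow> nat) \<Rightarrow> 'r" where
  "level_det d p m F y = det (mat d d (\<lambda>(j, i). coeff_at_diff F (p ^ m * Suc i) (y j)))"

lemma level_det_leibniz:
  "level_det d p m F y = (\<Sum>\<pi> | \<pi> permutes {0..<d}. signof \<pi> * (\<Prod>j=0..<d. coeff_at_diff F (p ^ m * Suc (\<pi> j)) (y j)))"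
proof -
  let ?M = "mat d d (\<lambda>(j, i). coeff_at_diff F (p ^ m * Suc i) (y j))"
  have "(\<Prod>j=0..<d. ?M $$ (j, \<pi> j)) = (\<Prod>j=0..<d. coeff_at_diff F (p ^ m * Suc (\<pi> j)) (y j))"
    if "\<pi> permutes {0..<d}" for \<pi>
  proof (rule prod.cong[OF refl])
    fix j assume j: "j \<in> {0..<d}"
    then have "\<pi> j \<in> {0..<d}" using permutes_in_image[OF that] by blast
    then show "?M $$ (j, \<pi> j) = coeff_at_diff F (p ^ m * Suc (\<pi> j)) (y j)" using j by simp
  qed
  then show ?thesis
    unfolding level_det_def det_def'[OF mat_carrier] by (intro sum.cong) (auto simp del: index_mat)
qed

text \<open>A Cauchy-Binet expansion over ordered tuples \<open>X\<close> instead of subsets: every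
  path is followed individually, and all signs stay inside the last determinant.\<close>

lemma level_det_step:
  fixes G F :: "'r::idom poly"
  assumes p: "p > 0" and B: "p ^ m * d \<le> B"
  shows "level_det d p (Suc m) (G * pcompose F (monom 1 p)) y =
    (\<Sum>X\<in>PiE {0..<d} (\<lambda>_. {..B}). (\<Prod>j=0..<d. coeff_at_diff G (p * X j) (y j)) * level_det d p m F X)"
proof -
  let ?P = "{\<pi>. \<pi> permutes {0..<d}}"
  have "level_det d p (Suc m) (G * pcompose F (monom 1 p)) y =
    (\<Sum>\<pi>\<in>?P. signof \<pi> * (\<Prod>j=0..<d. coeff_at_diff (G * pcompose F (monom 1 p)) (p * (p ^ m * Suc (\<pi> j))) (y j)))"
    by (simp only: level_det_leibniz power_Suc mult.assoc)
  also have "\<dots> = (\<Sum>\<pi>\<in>?P. signof \<pi> * (\<Sum>X\<in>PiE {0..<d} (\<lambda>_. {..B}). \<Prod>j=0..<d. coeff_at_diff G (p * X j) (y j) * coeff_at_diff F (p ^ m * Suc (\<pi> j)) (X j)))"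
  proof (rule sum.cong[OF refl])
    fix \<pi> assume \<pi>: "\<pi> \<in> ?P"
    have "(\<Prod>j=0..<d. coeff_at_diff (G * pcompose F (monom 1 p)) (p * (p ^ m * Suc (\<pi> j))) (y j)) =
       (\<Prod>j=0..<d. \<Sum>X\<le>B. coeff_at_diff G (p * X) (y j) * coeff_at_diff F (p ^ m * Suc (\<pi> j)) X)"
    proof (intro prod.cong refl coeff_at_diff_step[OF p])
      fix j assume "j \<in> {0..<d}"
      then have "\<pi> j \<in> {0..<d}" using permutes_in_image[of \<pi> "{0..<d}" j] \<pi> by blast
      then have "Suc (\<pi> j) \<le> d" by simp
      then have "p ^ m * Suc (\<pi> j) \<le> p ^ m * d" by (rule mult_le_mono2)
      then show "p ^ m * Suc (\<pi> j) \<le> B" using B by simp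
    qed
    also have "\<dots> = (\<Sum>X\<in>PiE {0..<d} (\<lambda>_. {..B}). \<Prod>j=0..<d. coeff_at_diff G (p * X j) (y j) * coeff_at_diff F (p ^ m * Suc (\<pi> j)) (X j))"
      by (rule prod_sum_PiE) simp_all
    finally show "signof \<pi> * (\<Prod>j=0..<d. coeff_at_diff (G * pcompose F (monom 1 p)) (p * (p ^ m * Suc (\<pi> j))) (y j)) =
      signof \<pi> * (\<Sum>X\<in>PiE {0..<d} (\<lambda>_. {..B}). \<Prod>j=0..<d. coeff_at_diff G (p * X j) (y j) * coeff_at_diff F (p ^ m * Suc (\<pi> j)) (X j))"
      by simp
  qed
  also have "\<dots> = (\<Sum>X\<in>PiE {0..<d} (\<lambda>_. {..B}). \<Sum>\<pi>\<in>?P. (\<Prod>j=0..<d. coeff_at_diff G (p * X j) (y j)) * (signof \<pi> * (\<Prod>j=0..<d. coeff_at_diff F (p ^ m * Suc (\<pi> j)) (X j))))"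
    unfolding sum_distrib_left prod.distrib mult.left_commute[of "signof _"] by (rule sum.swap)
  also have "\<dots> = (\<Sum>X\<in>PiE {0..<d} (\<lambda>_. {..B}). (\<Prod>j=0..<d. coeff_at_diff G (p * X j) (y j)) * level_det d p m F X)"
    by (simp only: level_det_leibniz sum_distrib_left)
  finally show ?thesis .
qed

lemma level_det_not_inj:
  assumes "\<not> inj_on y {0..<d}" shows "level_det d p m F y = 0"
proof -
  obtain i j where ij: "i < d" "j < d" "i \<noteq> j" "y i = y j" using assms by (auto simp: inj_on_def)
  show ?thesis unfolding level_det_def
    by (rule det_identical_rows[of _ d i j]) (use ij in \<open>auto intro!: eq_vecI\<close>)
qed

lemma level_det_final_eq:
  "level_det d p 0 1 y = (\<Sum>\<pi> | \<pi> permutes {0..<d}. signof \<pi> * (\<Prod>i=0..<d. coeff_at_diff (1 :: 'r::comm_ring_1 poly) (Suc (\<pi> i)) (y i)))"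
  by (simp only: level_det_leibniz power_0 mult_1)

text \<open>With no level left an entry is 1 if position and end place agree and 0 otherwise, so a
  position that is not an end place gives a zero row.\<close>

lemma level_det_final_eq_0:
  assumes "\<not> y ` {0..<d} \<subseteq> Suc ` {0..<d}" shows "level_det d p 0 1 y = (0 :: 'r::comm_ring_1)"
proof -
  obtain j where j: "j < d" "y j \<notin> Suc ` {0..<d}" using assms by (meson atLeastLessThan_iff image_subsetI)
  have "coeff_at_diff (1 :: 'r poly) (Suc i) (y j) = 0" if "i < d" for i
  proof -
    have "y j \<noteq> Suc i" using j that by auto
    then show ?thesis by (auto simp: coeff_at_diff_def)
  qed
  then have "(\<Prod>i=0..<d. coeff_at_diff (1 :: 'r poly) (Suc (\<pi> i)) (y i)) = 0" if "\<pi> permutes {0..<d}" for \<pi>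
    using j that by (intro prod_zero bexI[of _ j]) (auto simp: permutes_in_image)
  moreover have "level_det d p 0 1 y = (\<Sum>\<pi> | \<pi> permutes {0..<d}. signof \<pi> * (\<Prod>i=0..<d. coeff_at_diff (1 :: 'r poly) (Suc (\<pi> i)) (y i)))"
    by (rule level_det_final_eq)
  ultimately show ?thesis by simp
qed

lemma level_det_final_degree:
  "degree (level_det d p 0 1 y :: 'r::idom poly) = 0"
proof -
  have c: "degree (coeff_at_diff (1 :: 'r poly poly) a b) = 0" for a b
    by (auto simp: coeff_at_diff_def)
  have "degree (signof \<pi> * (\<Prod>i=0..<d. coeff_at_diff (1 :: 'r poly poly) (Suc (\<pi> i)) (y i))) \<le> 0" for \<pi>
  proof -
    have "degree (\<Prod>i=0..<d. coeff_at_diff (1 :: 'r poly poly) (Suc (\<pi> i)) (y i)) \<le> 0"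
      using degree_prod_sum_le[of "{0..<d}" "\<lambda>i. coeff_at_diff (1 :: 'r poly poly) (Suc (\<pi> i)) (y i)"] by (simp add: c)
    then show ?thesis
      using degree_mult_le[of "signof \<pi> :: 'r poly" "\<Prod>i=0..<d. coeff_at_diff (1 :: 'r poly poly) (Suc (\<pi> i)) (y i)"] by simp
  qed
  then have "degree (level_det d p 0 1 y :: 'r poly) \<le> 0"
    unfolding level_det_final_eq by (intro degree_sum_le) (auto simp: finite_permutations)
  then show ?thesis by simp
qed

lemma level_det_final_one:
  assumes "\<And>j. j < d \<Longrightarrow> y j = Suc j" shows "level_det d p 0 1 y = (1 :: 'r::comm_ring_1)"
proof -
  have "mat d d (\<lambda>(j, i). coeff_at_diff (1 :: 'r poly) (p ^ 0 * Suc i) (y j)) = 1\<^sub>m d"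
    using assms by (intro eq_matI) (auto simp: coeff_at_diff_def)
  then show ?thesis by (simp add: level_det_def)
qed

text \<open>The list holds the positions after the current level; the sign of the permutation of the
  ends sits in the final determinant.\<close>

primrec path_weight :: "nat \<Rightarrow> nat \<Rightarrow> (nat \<Rightarrow> 'r::comm_ring_1 poly) \<Rightarrow> nat \<Rightarrow> (nat \<Rightarrow> nat) \<Rightarrow> (nat \<Rightarrow> nat) list \<Rightarrow> 'r" where
  "path_weight d p G g y [] = level_det d p 0 1 y"
| "path_weight d p G g y (x # xs) = (\<Prod>j=0..<d. coeff_at_diff (G g) (p * x j) (y j)) * path_weight d p G (Suc g) x xs"

text \<open>Extensional functions let a family of positions correspond to exactly one list, so that
  uniqueness of the optimum carries over to lists.\<close>

definition level_lists :: "nat \<Rightarrow> nat \<Rightarrow> nat \<Rightarrow> (nat \<Rightarrow> nat) list set" where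
  "level_lists d B m = {xs. set xs \<subseteq> {X \<in> PiE {0..<d} (\<lambda>_. {..B}). inj_on X {0..<d}} \<and> length xs = m}"

lemma finite_level_lists: "finite (level_lists d B m)"
  unfolding level_lists_def by (intro finite_lists_length_eq finite_subset[OF _ finite_PiE[of "{0..<d}" "\<lambda>_. {..B}"]]) auto

lemma level_listsD:
  assumes "xs \<in> level_lists d B m"
  shows "length xs = m"
    and "g < m \<Longrightarrow> xs ! g \<in> PiE {0..<d} (\<lambda>_. {..B})" and "g < m \<Longrightarrow> inj_on (xs ! g) {0..<d}"
proof -
  have sub: "set xs \<subseteq> {X \<in> PiE {0..<d} (\<lambda>_. {..B}). inj_on X {0..<d}}" and len: "length xs = m"
    using assms by (simp_all only: level_lists_def mem_Collect_eq)
  show "length xs = m" by (rule len)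
  assume "g < m"
  then have "xs ! g \<in> {X \<in> PiE {0..<d} (\<lambda>_. {..B}). inj_on X {0..<d}}"
    using sub len nth_mem subsetD by metis
  then show "xs ! g \<in> PiE {0..<d} (\<lambda>_. {..B})" "inj_on (xs ! g) {0..<d}" by (simp_all only: mem_Collect_eq)
qed

text \<open>Here \<open>m\<close> counts the levels still to come, while \<open>F\<close>,
  \<open>G\<close> and \<open>path_weight\<close> are indexed by the levels already passed.\<close>

lemma level_det_unroll:
  fixes F G :: "nat \<Rightarrow> 'r::idom poly"
  assumes p: "p > 0" and B: "p ^ n * d \<le> B"
    and F: "\<And>g. g < n \<Longrightarrow> F g = G g * pcompose (F (Suc g)) (monom 1 p)" "F n = 1"
  shows "m \<le> n \<Longrightarrow> level_det d p m (F (n - m)) y = (\<Sum>xs\<in>level_lists d B m. path_weight d p G (n - m) y xs)"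
proof (induction m arbitrary: y)
  case 0
  have "level_lists d B 0 = {[]}" by (auto simp: level_lists_def)
  then show ?case by (simp add: F)
next
  case (Suc m)
  let ?P = "PiE {0..<d} (\<lambda>_. {..B})"
  let ?I = "{X \<in> ?P. inj_on X {0..<d}}"
  have nm: "Suc (n - Suc m) = n - m" using Suc.prems by simp
  have "p ^ m \<le> p ^ n" using p Suc.prems by (intro power_increasing) auto
  then have Bm: "p ^ m * d \<le> B" using B mult_le_mono1 order_trans by blast
  have "level_det d p (Suc m) (F (n - Suc m)) y =
    (\<Sum>X\<in>?P. (\<Prod>j=0..<d. coeff_at_diff (G (n - Suc m)) (p * X j) (y j)) * level_det d p m (F (n - m)) X)"
    using level_det_step[OF p Bm, of "G (n - Suc m)" "F (n - m)" y] F(1)[of "n - Suc m"] Suc.prems nm by simp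
  also have "\<dots> = (\<Sum>X\<in>?I. (\<Prod>j=0..<d. coeff_at_diff (G (n - Suc m)) (p * X j) (y j)) * level_det d p m (F (n - m)) X)"
    by (intro sum.mono_neutral_right finite_PiE) (auto simp: level_det_not_inj)
  also have "\<dots> = (\<Sum>X\<in>?I. \<Sum>xs\<in>level_lists d B m. path_weight d p G (n - Suc m) y (X # xs))"
    using Suc nm by (simp add: sum_distrib_left)
  also have "\<dots> = (\<Sum>(X, xs)\<in>?I \<times> level_lists d B m. path_weight d p G (n - Suc m) y (X # xs))"
    by (rule sum.cartesian_product)
  also have "\<dots> = (\<Sum>xs\<in>level_lists d B (Suc m). path_weight d p G (n - Suc m) y xs)"
  proof (rule sum.reindex_bij_witness[where i = "\<lambda>xs. (hd xs, tl xs)" and j = "\<lambda>(X, xs). X # xs"])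
    fix xs assume xs: "xs \<in> level_lists d B (Suc m)"
    then have ne: "xs \<noteq> []" by (auto simp: level_lists_def)
    then show "(case (hd xs, tl xs) of (X, xs) \<Rightarrow> X # xs) = xs" by simp
    obtain X ys where "xs = X # ys" using ne by (cases xs) auto
    then show "(hd xs, tl xs) \<in> ?I \<times> level_lists d B m"
      using xs unfolding level_lists_def by simp
  qed (auto simp: level_lists_def)
  finally show ?case .
qed

lemma path_weight_prod:
  "path_weight d p G g y xs = (\<Prod>i<length xs. \<Prod>j=0..<d. coeff_at_diff (G (g + i)) (p * (xs ! i) j) (((y # xs) ! i) j))
     * level_det d p 0 1 (last (y # xs))"
proof (induction xs arbitrary: g y)
  case (Cons x xs)
  show ?case
    unfolding path_weight.simps Cons.IH length_Cons prod.lessThan_Suc_shift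
    by (simp add: mult.assoc)
qed simp

context token_classes
begin

text \<open>By the assumptions on \<open>G\<close>, the factor of a step with \<open>w\<close>
  consumed tokens is nonzero exactly if w <= \<open>A g\<close>, and its degree is the total value
  of the tokens left over. Least cost thus means greatest degree.\<close>

lemma level_det_neq_0:
  fixes F G :: "nat \<Rightarrow> 'r::idom poly poly"
  assumes W: "\<And>b. b \<le> n \<Longrightarrow> (p ^ b - 1) * d \<le> (\<Sum>c<b. p ^ c * A c)"
    and F: "\<And>g. g < n \<Longrightarrow> F g = G g * pcompose (F (Suc g)) (monom 1 p)" "F n = 1"
    and G: "\<And>g w. g < n \<Longrightarrow> w \<le> A g \<Longrightarrow> coeff (G g) w \<noteq> 0 \<and> degree (coeff (G g) w) + prefix_sum g w = prefix_sum g (A g)"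
    and G0: "\<And>g w. g < n \<Longrightarrow> A g < w \<Longrightarrow> coeff (G g) w = 0"
  shows "level_det d p n (F 0) Suc \<noteq> 0"
proof -
  define B where "B = p ^ n * d"
  let ?L = "level_lists d B n"
  let ?w = "path_weight d p G 0 Suc"
  define sys where "sys xs g j = ((Suc # xs) ! g) j" for xs :: "(nat \<Rightarrow> nat) list" and g j
  have sys0: "sys xs 0 j = Suc j" and sysS: "sys xs (Suc g) j = (xs ! g) j" for xs g j
    by (simp_all add: sys_def)
  have sysS_fun: "sys xs (Suc g) = xs ! g" for xs g by (simp add: fun_eq_iff sysS)
  have w_eq: "?w xs = (\<Prod>g<n. \<Prod>j=0..<d. coeff_at_diff (G g) (p * sys xs (Suc g) j) (sys xs g j)) * level_det d p 0 1 (sys xs n)"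
    if "xs \<in> ?L" for xs
  proof -
    have len: "length xs = n" using that by (simp add: level_lists_def)
    have "last (Suc # xs) = sys xs n"
      using len unfolding sys_def by (subst last_conv_nth) auto
    then show ?thesis unfolding path_weight_prod len by (simp add: sys_def)
  qed
  have cc_ne: "coeff_at_diff (G g) (p * X) Y \<noteq> 0 \<longleftrightarrow> Y \<le> p * X \<and> p * X - Y \<le> A g" if "g < n" for g X Y
    using G[OF that, of "p * X - Y"] G0[OF that, of "p * X - Y"] by (cases "p * X - Y \<le> A g") (auto simp: coeff_at_diff_def)
  have cc_deg: "degree (coeff_at_diff (G g) (p * X) Y) + prefix_sum g (p * X - Y) = prefix_sum g (A g)"
    if "g < n" "Y \<le> p * X" "p * X - Y \<le> A g" for g X Y
    using G[OF that(1,3)] that by (simp add: coeff_at_diff_def)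
  have path: "path_system (sys xs)" if xs: "xs \<in> ?L" and nz: "?w xs \<noteq> 0" for xs
  proof -
    have inj: "inj_on (sys xs g) {..<d}" if "g \<le> n" for g
    proof (cases g)
      case 0
      then show ?thesis by (auto simp: sys0 inj_on_def)
    next
      case (Suc g')
      then show ?thesis using level_listsD(3)[OF xs, of g'] that sysS_fun[of xs g'] by (simp add: atLeast0LessThan)
    qed
    have "level_det d p 0 1 (sys xs n) \<noteq> (0 :: 'r poly)" using nz w_eq[OF xs] by auto
    then have "sys xs n ` {0..<d} \<subseteq> Suc ` {0..<d}" using level_det_final_eq_0 by blast
    moreover have "card (sys xs n ` {0..<d}) = card (Suc ` {0..<d})"
      using inj[of n] by (simp add: card_image atLeast0LessThan)
    ultimately have "sys xs n ` {..<d} = Suc ` {..<d}"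
      by (metis atLeast0LessThan card_subset_eq finite_atLeastLessThan finite_imageI)
    moreover have "valid (sys xs)"
      unfolding valid_def pos_def
    proof (intro allI impI)
      fix b j assume b: "b < n" and j: "j < d"
      have "coeff_at_diff (G b) (p * sys xs (Suc b) j) (sys xs b j) \<noteq> 0"
        using nz w_eq[OF xs] b j by auto
      then show "sys xs b j \<le> p * sys xs (Suc b) j \<and> p * sys xs (Suc b) j - sys xs b j \<le> A b"
        using cc_ne[OF b] by blast
    qed
    ultimately show ?thesis using inj sys0 by (simp add: path_system_def)
  qed
  have deg: "degree (\<Prod>g<n. \<Prod>j=0..<d. coeff_at_diff (G g) (p * sys xs (Suc g) j) (sys xs g j)) + cost (sys xs) = (\<Sum>g<n. \<Sum>j<d. prefix_sum g (A g))"
    if val: "valid (sys xs)" for xs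
  proof -
    have v: "sys xs g j \<le> p * sys xs (Suc g) j \<and> p * sys xs (Suc g) j - sys xs g j \<le> A g" if "g < n" "j < d" for g j
      using val that by (auto simp: valid_def pos_def)
    have nz: "coeff_at_diff (G g) (p * sys xs (Suc g) j) (sys xs g j) \<noteq> 0" if "g < n" "j < d" for g j
      using v[OF that] cc_ne[OF that(1)] by blast
    have "degree (\<Prod>g<n. \<Prod>j=0..<d. coeff_at_diff (G g) (p * sys xs (Suc g) j) (sys xs g j)) =
       (\<Sum>g<n. degree (\<Prod>j=0..<d. coeff_at_diff (G g) (p * sys xs (Suc g) j) (sys xs g j)))"
      using nz by (intro degree_prod_eq_sum_degree) simp
    also have "\<dots> = (\<Sum>g<n. \<Sum>j=0..<d. degree (coeff_at_diff (G g) (p * sys xs (Suc g) j) (sys xs g j)))"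
      using nz by (intro sum.cong refl degree_prod_eq_sum_degree) simp
    finally have "degree (\<Prod>g<n. \<Prod>j=0..<d. coeff_at_diff (G g) (p * sys xs (Suc g) j) (sys xs g j)) =
       (\<Sum>g<n. \<Sum>j=0..<d. degree (coeff_at_diff (G g) (p * sys xs (Suc g) j) (sys xs g j)))" .
    then show ?thesis
      unfolding cost_def pos_def atLeast0LessThan
      using v cc_deg by (simp flip: sum.distrib)
  qed
  obtain x where x: "sorted_system x"
    and ux: "\<And>z. path_system z \<Longrightarrow> cost z \<le> cost x \<Longrightarrow> \<forall>g\<le>n. \<forall>j<d. z g j = x g j"
    using unique_optimal[OF W] by blast
  define ys where "ys = map (\<lambda>g. restrict (x (Suc g)) {0..<d}) [0..<n]"
  have xs_sys: "sys ys g j = x g j" if "g \<le> n" "j < d" for g j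
    using x that by (cases g) (auto simp: sys0 sysS ys_def sorted_system_def)
  \<comment> \<open>Going back from level \<open>n\<close>, a position grows at most by the factor
    \<open>p\<close> per level, so the box of size B = p^n d contains the optimal system.\<close>
  have bnd: "x g j \<le> p ^ (n - g) * Suc j" if "g \<le> n" "j < d" for g j
    using that(1)
  proof (induction rule: inc_induct)
    case base
    then show ?case using x that by (simp add: sorted_system_def)
  next
    case (step g)
    have "x g j \<le> p * x (Suc g) j" using x step that by (auto simp: sorted_system_def valid_def)
    also have "\<dots> \<le> p * (p ^ (n - Suc g) * Suc j)" using step by (intro mult_le_mono2)
    also have "\<dots> = p ^ (n - g) * Suc j"
    proof -
      have "n - g = Suc (n - Suc g)" using step by simp
      then show ?thesis by (simp only: power_Suc mult.assoc)
    qed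
    finally show ?case .
  qed
  have xB: "x g j \<le> B" if "g \<le> n" "j < d" for g j
  proof -
    have "p ^ (n - g) * Suc j \<le> p ^ n * d" using that p2 by (intro mult_le_mono power_increasing) auto
    then show ?thesis using bnd[OF that] by (simp add: B_def)
  qed
  have xinj: "inj_on (x g) {..<d}" if "g \<le> n" for g
    using sorted_imp_path_system[OF x] that by (auto simp: path_system_def)
  have ysL: "ys \<in> ?L"
  proof -
    have mem: "restrict (x (Suc g)) {0..<d} \<in> {X \<in> PiE {0..<d} (\<lambda>_. {..B}). inj_on X {0..<d}}" if "g < n" for g
      using xB[of "Suc g"] xinj[of "Suc g"] that
      by (simp only: mem_Collect_eq restrict_PiE inj_on_restrict_eq atLeast0LessThan) simp
    have "set ys \<subseteq> {X \<in> PiE {0..<d} (\<lambda>_. {..B}). inj_on X {0..<d}}"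
      unfolding ys_def set_map set_upt by (intro image_subsetI mem) simp
    moreover have "length ys = n" by (simp add: ys_def)
    ultimately show ?thesis unfolding level_lists_def by (intro CollectI conjI)
  qed
  have cost_ys: "cost (sys ys) = cost x" and val_ys: "valid (sys ys)"
    using x xs_sys by (auto simp: cost_def pos_def sorted_system_def valid_def)
  have fin1: "level_det d p 0 1 (sys ys n) = (1 :: 'r poly)"
    using x xs_sys by (intro level_det_final_one) (auto simp: sorted_system_def)
  have nz0: "?w ys \<noteq> 0"
    unfolding w_eq[OF ysL] fin1 using val_ys cc_ne by (auto simp: valid_def pos_def)
  have deg0: "degree (?w ys) + cost x = (\<Sum>g<n. \<Sum>j<d. prefix_sum g (A g))"
    unfolding w_eq[OF ysL] fin1 using deg[OF val_ys] cost_ys by simp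
  have small: "?w xs = 0 \<or> degree (?w xs) < degree (?w ys)" if xs: "xs \<in> ?L" "xs \<noteq> ys" for xs
  proof (cases "?w xs = 0")
    case False
    have ps: "path_system (sys xs)" using path[OF xs(1) False] .
    have "\<not> cost (sys xs) \<le> cost x"
    proof
      assume "cost (sys xs) \<le> cost x"
      then have eq: "\<And>g j. g \<le> n \<Longrightarrow> j < d \<Longrightarrow> sys xs g j = x g j" using ux[OF ps] by blast
      have "xs = ys"
      proof (rule nth_equalityI)
        show "length xs = length ys" using xs by (simp add: level_lists_def ys_def)
        fix g assume "g < length xs"
        then have g: "g < n" using xs by (simp add: level_lists_def)
        have "xs ! g \<in> PiE {0..<d} (\<lambda>_. {..B})" "ys ! g \<in> PiE {0..<d} (\<lambda>_. {..B})"
          using level_listsD(2)[OF xs(1) g] level_listsD(2)[OF ysL g] .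
        then show "xs ! g = ys ! g"
          using eq[of "Suc g"] xs_sys[of "Suc g"] g by (intro PiE_ext[of "xs ! g" "{0..<d}"]) (auto simp: sysS)
      qed
      then show False using xs by simp
    qed
    moreover have "valid (sys xs)" using ps by (simp add: path_system_def)
    then have "degree (\<Prod>g<n. \<Prod>j=0..<d. coeff_at_diff (G g) (p * sys xs (Suc g) j) (sys xs g j)) + cost (sys xs) = degree (?w ys) + cost x"
      using deg deg0 by simp
    moreover have "degree (?w xs) \<le> degree (\<Prod>g<n. \<Prod>j=0..<d. coeff_at_diff (G g) (p * sys xs (Suc g) j) (sys xs g j))"
      unfolding w_eq[OF xs(1)]
      using degree_mult_le[of "\<Prod>g<n. \<Prod>j=0..<d. coeff_at_diff (G g) (p * sys xs (Suc g) j) (sys xs g j)" "level_det d p 0 1 (sys xs n)"]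
      by (simp only: level_det_final_degree add_0_right)
    ultimately show ?thesis by linarith
  qed simp
  have "sum ?w ?L \<noteq> 0"
    by (rule sum_unique_degree(1)[where ?s0.0 = ys and f = ?w, OF finite_level_lists ysL nz0 small])
  then show ?thesis
    using level_det_unroll[OF _ _ F, of d B n Suc] p2 by (simp add: B_def)
qed

end


section \<open>Digits\<close>


definition digit :: "nat \<Rightarrow> nat \<Rightarrow> nat \<Rightarrow> nat" where
  "digit b K i = K div b ^ i mod b"

lemma digit_Suc: "digit b K (Suc i) = digit b (K div b) i"
  by (simp add: digit_def div_mult2_eq)

lemma digit_less: "2 \<le> b \<Longrightarrow> digit b K i < b"
  by (simp add: digit_def)

lemma digit_eq_0: "K < b ^ i \<Longrightarrow> digit b K i = 0"
  by (simp add: digit_def)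

lemma digits_mod: "(\<Sum>i<m. b ^ i * digit b K i) = K mod b ^ m"
proof (induction m)
  case (Suc m)
  have "K mod b ^ Suc m = b ^ m * (K div b ^ m mod b) + K mod b ^ m"
    by (metis mod_mult2_eq power_Suc2)
  then show ?case using Suc.IH by (simp add: digit_def)
qed simp

lemma digits_eq: "K < b ^ m \<Longrightarrow> (\<Sum>i<m. b ^ i * digit b K i) = K"
  by (simp add: digits_mod)

lemma digit_sum_eq:
  assumes q: "2 \<le> q" and "K < q ^ S" shows "digit_sum q K = (\<Sum>i<S. digit q K i)"
  using assms(2)
proof (induction S arbitrary: K)
  case 0
  then show ?case by (subst digit_sum.simps) simp
next
  case (Suc S)
  have "K div q < q ^ S" using Suc.prems q by (simp add: div_less_iff_less_mult mult.commute)
  then have "K mod q + digit_sum q (K div q) = (\<Sum>i<Suc S. digit q K i)"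
    using Suc.IH by (simp add: sum.lessThan_Suc_shift digit_Suc del: sum.lessThan_Suc) (simp add: digit_def)
  then show ?case
    using q by (cases "K = 0") (subst digit_sum.simps, simp add: digit_def)+
qed

lemma digit_power: "digit (p ^ n) K s = (\<Sum>e<n. p ^ e * digit p K (s * n + e))"
proof -
  have "digit p (K div (p ^ n) ^ s) e = digit p K (s * n + e)" for e
    by (simp add: digit_def power_add power_mult div_mult2_eq mult.commute[of s])
  then show ?thesis using digits_mod[where m = n and b = p and K = "K div (p ^ n) ^ s"]
    by (simp add: digit_def[of "p ^ n"])
qed

lemma sum_nat_double:
  fixes f :: "nat \<Rightarrow> 'a::comm_monoid_add"
  shows "(\<Sum>s<S. \<Sum>e<n. f (s * n + e)) = (\<Sum>j<S * n. f j)"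
proof -
  have "(\<Sum>e<n. f (s * n + e)) = sum f {s * n..<s * n + n}" for s
    by (rule sum.reindex_bij_witness[where i = "\<lambda>j. j - s * n" and j = "\<lambda>e. s * n + e"]) auto
  then show ?thesis by (simp add: sum.nat_group)
qed

lemma digit_shift: "2 \<le> p \<Longrightarrow> digit p (p ^ i * K) j = (if j < i then 0 else digit p K (j - i))"
proof (cases "j < i")
  case True
  assume p: "2 \<le> p"
  have "i = j + Suc (i - Suc j)" using True by simp
  then have "p ^ i * K = p ^ j * (p * (p ^ (i - Suc j) * K))" by (metis mult.assoc power_Suc power_add)
  then have "p ^ i * K div p ^ j = p * (p ^ (i - Suc j) * K)" using p
    by (metis nonzero_mult_div_cancel_left not_numeral_le_zero power_not_zero)
  then show ?thesis using True by (simp add: digit_def)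
next
  case False
  assume p: "2 \<le> p"
  have "p ^ j = p ^ i * p ^ (j - i)" using False by (simp flip: power_add)
  then show ?thesis using False p by (simp add: digit_def)
qed

definition class_size :: "nat \<Rightarrow> nat \<Rightarrow> nat \<Rightarrow> nat \<Rightarrow> nat \<Rightarrow> nat" where
  "class_size p n K S e = (\<Sum>s<S. digit p K (s * n + e))"

text \<open>Multiplication by p^i moves a base-p digit of class \<open>e\<close> to class (e + i)
  mod n, which determines its weight within a base-q digit.\<close>

lemma digit_sum_shift:
  assumes p: "2 \<le> p" and n: "0 < n" and i: "i < n" and K: "K < p ^ (S * n)"
  shows "digit_sum (p ^ n) (p ^ i * K) = (\<Sum>e<n. p ^ ((e + i) mod n) * class_size p n K S e)"
proof -
  have q: "2 \<le> p ^ n" using p n by (metis One_nat_def Suc_leI le_trans power_increasing power_one_right one_le_numeral order.trans)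
  have "p ^ i * K < p ^ n * p ^ (S * n)"
  proof -
    have "p ^ i \<le> p ^ n" using p i by (intro power_increasing) auto
    then have "p ^ i * K \<le> p ^ n * K" by simp
    also have "\<dots> < p ^ n * p ^ (S * n)" using K p by simp
    finally show ?thesis .
  qed
  then have "digit_sum (p ^ n) (p ^ i * K) = (\<Sum>s<Suc S. digit (p ^ n) (p ^ i * K) s)"
    by (intro digit_sum_eq[OF q]) (simp add: power_mult[symmetric] power_add[symmetric] mult.commute[of S])
  also have "\<dots> = (\<Sum>s<Suc S. \<Sum>e<n. p ^ ((s * n + e) mod n) * digit p (p ^ i * K) (s * n + e))"
    unfolding digit_power by (intro sum.cong refl) simp
  also have "\<dots> = (\<Sum>j<Suc S * n. p ^ (j mod n) * digit p (p ^ i * K) j)"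
    by (rule sum_nat_double)
  also have "\<dots> = (\<Sum>j\<in>{i..<i + S * n}. p ^ (j mod n) * digit p (p ^ i * K) j)"
  proof (rule sum.mono_neutral_right)
    show "{i..<i + S * n} \<subseteq> {..<Suc S * n}" using i by auto
    show "\<forall>j\<in>{..<Suc S * n} - {i..<i + S * n}. p ^ (j mod n) * digit p (p ^ i * K) j = 0"
    proof
      fix j assume "j \<in> {..<Suc S * n} - {i..<i + S * n}"
      then have "j < i \<or> S * n \<le> j - i" by auto
      moreover have "K < p ^ (j - i)" if "S * n \<le> j - i"
        using K p power_increasing[OF that, of p] by linarith
      ultimately show "p ^ (j mod n) * digit p (p ^ i * K) j = 0" using p by (auto simp: digit_shift digit_eq_0)
    qed
  qed auto
  also have "\<dots> = (\<Sum>j<S * n. p ^ ((j + i) mod n) * digit p K j)"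
    by (rule sum.reindex_bij_witness[where i = "\<lambda>j. j + i" and j = "\<lambda>j. j - i"]) (use p in \<open>auto simp: digit_shift\<close>)
  also have "\<dots> = (\<Sum>s<S. \<Sum>e<n. p ^ ((s * n + e + i) mod n) * digit p K (s * n + e))"
    by (rule sum_nat_double[symmetric])
  also have "\<dots> = (\<Sum>e<n. \<Sum>s<S. p ^ ((e + i) mod n) * digit p K (s * n + e))"
    by (subst sum.swap) (simp add: add.assoc)
  finally show ?thesis by (simp add: class_size_def sum_distrib_left)
qed

text \<open>Classes e >= b receive weight p^(e - b), the others wrap around to p^(e + n - b). After
  multiplication by p^b these are p^e and p^n p^e = p^e + (p^n - 1) p^e. Lower bounds for shifted
  digit sums thereby become lower bounds for the low classes.\<close>

lemma digit_sum_rotation: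
  assumes p: "2 \<le> p" and b: "0 < b" "b < n" and K: "K < p ^ (S * n)"
  shows "p ^ b * digit_sum (p ^ n) (p ^ (n - b) * K) =
    digit_sum (p ^ n) K + (p ^ n - 1) * (\<Sum>e<b. p ^ e * class_size p n K S e)"
proof -
  let ?A = "class_size p n K S"
  have e: "p ^ b * (p ^ ((e + (n - b)) mod n) * a) = p ^ e * a + (p ^ n - 1) * (if e < b then p ^ e * a else 0)"
    if "e < n" for e a
  proof (cases "e < b")
    case True
    then have "(e + (n - b)) mod n = e + (n - b)" using b by simp
    then have "p ^ b * p ^ ((e + (n - b)) mod n) = p ^ n * p ^ e"
      using b by (simp add: add.commute flip: power_add)
    moreover have "p ^ n * (p ^ e * a) = p ^ e * a + (p ^ n - 1) * (p ^ e * a)"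
      using p by (simp add: diff_mult_distrib)
    ultimately show ?thesis using True by (simp only: if_True mult.assoc[symmetric])
  next
    case False
    then have "e + (n - b) = (e - b) + n" using b that by simp
    then have "(e + (n - b)) mod n = e - b" using that by (metis less_imp_diff_less mod_add_self2 mod_less)
    then show ?thesis using False by (simp flip: power_add mult.assoc)
  qed
  have "p ^ b * digit_sum (p ^ n) (p ^ (n - b) * K) = (\<Sum>e<n. p ^ b * (p ^ ((e + (n - b)) mod n) * ?A e))"
    using digit_sum_shift[OF p _ _ K, of "n - b"] b by (simp add: sum_distrib_left)
  also have "\<dots> = (\<Sum>e<n. p ^ e * ?A e) + (p ^ n - 1) * (\<Sum>e<n. if e < b then p ^ e * ?A e else 0)"
    using e by (simp add: sum.distrib sum_distrib_left)
  also have "(\<Sum>e<n. if e < b then p ^ e * ?A e else 0) = (\<Sum>e<b. p ^ e * ?A e)"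
    using b by (intro sum.mono_neutral_cong_right) auto
  also have "(\<Sum>e<n. p ^ e * ?A e) = digit_sum (p ^ n) K"
    using digit_sum_shift[OF p _ _ K, of 0] b by simp
  finally show ?thesis .
qed

text \<open>The two summands occupy disjoint digit positions, so there is no carry.\<close>

lemma digit_sum_append:
  assumes q: "2 \<le> q" and "m < q ^ N"
  shows "digit_sum q (m + q ^ N * m') = digit_sum q m + digit_sum q m'"
  using assms(2)
proof (induction N arbitrary: m)
  case 0
  then show ?case by (simp add: digit_sum.simps[of q 0])
next
  case (Suc N)
  have st: "digit_sum q a = a mod q + digit_sum q (a div q)" for a
    using q by (cases "a = 0") (subst digit_sum.simps, simp)+
  have "m div q < q ^ N" using Suc.prems q by (simp add: div_less_iff_less_mult mult.commute)
  moreover have "(m + q ^ Suc N * m') mod q = m mod q" by (simp add: mult.assoc)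
  moreover have "(m + q ^ Suc N * m') div q = m div q + q ^ N * m'" using q by (simp add: mult.assoc)
  ultimately show ?case using Suc.IH[of "m div q"] st[of "m + q ^ Suc N * m'"] st[of m] by simp
qed

lemma digit_sum_base_mult:
  assumes "2 \<le> q" shows "digit_sum q (q * m) = digit_sum q m"
  using digit_sum_append[OF assms, of 0 1 m] assms by (simp add: digit_sum.simps[of q 0])

section \<open>Base-p tokens, sorted by value\<close>

primrec token_values :: "nat \<Rightarrow> nat \<Rightarrow> nat \<Rightarrow> nat \<Rightarrow> nat \<Rightarrow> nat list" where
  "token_values p n K e 0 = []"
| "token_values p n K e (Suc S) = token_values p n K e S @ replicate (digit p K (S * n + e)) (p ^ (S * n + e))"

lemma length_token_values: "length (token_values p n K e S) = class_size p n K S e"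
  by (induction S) (auto simp: class_size_def)

lemma set_token_values: "x \<in> set (token_values p n K e S) \<Longrightarrow> \<exists>s<S. x = p ^ (s * n + e)"
  by (induction S) (auto split: if_splits intro: less_SucI)

lemma token_values_less:
  assumes "2 \<le> p" "0 < n" "x \<in> set (token_values p n K e S)" shows "2 * x \<le> p ^ (S * n + e)"
proof -
  obtain s where s: "s < S" "x = p ^ (s * n + e)" using set_token_values[OF assms(3)] by blast
  have "Suc s * n \<le> S * n" using s by (intro mult_le_mono1) simp
  then have "Suc (s * n + e) \<le> S * n + e" using assms(2) by simp
  then have "p ^ Suc (s * n + e) \<le> p ^ (S * n + e)" using assms(1) by (intro power_increasing) auto
  moreover have "2 * x \<le> p * x" using assms(1) by (rule mult_le_mono1)
  ultimately show ?thesis using s by (simp only: power_Suc order_trans)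
qed

lemma sorted_token_values: "2 \<le> p \<Longrightarrow> 0 < n \<Longrightarrow> sorted (token_values p n K e S)"
proof (induction S)
  case (Suc S)
  then show ?case using token_values_less[of p n _ K e S] by (fastforce simp: sorted_append)
qed simp

text \<open>One place contributes at most p - 1 equal tokens, so p - 1 tokens further on a later
  place of the same class is reached.\<close>

lemma token_values_double:
  assumes "2 \<le> p" "0 < n" "i + (p - 1) < length (token_values p n K e S)"
  shows "2 * token_values p n K e S ! i \<le> token_values p n K e S ! (i + (p - 1))"
  using assms(3)
proof (induction S)
  case (Suc S)
  let ?l = "length (token_values p n K e S)"
  show ?case
  proof (cases "i + (p - 1) < ?l")
    case True
    then show ?thesis using Suc.IH by (simp add: nth_append)
  next
    case False
    have "digit p K (S * n + e) \<le> p - 1" using digit_less[OF assms(1), of K "S * n + e"] by simp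
    then have il: "i < ?l" using Suc.prems by simp
    then have "2 * token_values p n K e S ! i \<le> p ^ (S * n + e)" using token_values_less[OF assms(1,2)] nth_mem by blast
    moreover have "token_values p n K e (Suc S) ! i = token_values p n K e S ! i" using il by (simp add: nth_append)
    moreover have "token_values p n K e (Suc S) ! (i + (p - 1)) = p ^ (S * n + e)"
      unfolding token_values.simps nth_append if_not_P[OF False]
      using False Suc.prems by (intro List.nth_replicate) auto
    ultimately show ?thesis by simp
  qed
qed simp

text \<open>Over all classes, the tokens below p^t sum to at most the number formed by the last
  \<open>t\<close> base-p digits of \<open>K\<close>.\<close>

lemma sum_token_values_less:
  assumes p: "2 \<le> p"
  shows "(\<Sum>c<n. \<Sum>j | j < length (token_values p n K c S) \<and> token_values p n K c S ! j < p ^ t. token_values p n K c S ! j) < p ^ t"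
proof -
  have "(\<Sum>j | j < length (token_values p n K c S) \<and> token_values p n K c S ! j < p ^ t. token_values p n K c S ! j) =
      (\<Sum>s<S. if s * n + c < t then p ^ (s * n + c) * digit p K (s * n + c) else 0)" for c
  proof -
    have "(\<Sum>j | j < length xs \<and> P (xs ! j). xs ! j) = sum_list (map (\<lambda>x. if P x then x else 0) xs)" for xs :: "nat list" and P
    proof -
      have "sum_list (map (\<lambda>x. if P x then x else 0) xs) = (\<Sum>j<length xs. if P (xs ! j) then xs ! j else 0)"
        by (simp add: sum_list_sum_nth atLeast0LessThan)
      also have "\<dots> = (\<Sum>j | j < length xs \<and> P (xs ! j). xs ! j)"
        by (intro sum.mono_neutral_cong_right) auto
      finally show ?thesis by simp
    qed
    moreover have "sum_list (map (\<lambda>x. if x < p ^ t then x else 0) (token_values p n K c S)) = 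
      (\<Sum>s<S. if s * n + c < t then p ^ (s * n + c) * digit p K (s * n + c) else 0)"
      using p by (induction S) (auto simp: sum_list_replicate mult.commute power_strict_increasing_iff)
    ultimately show ?thesis by (rule trans)
  qed
  then have "(\<Sum>c<n. \<Sum>j | j < length (token_values p n K c S) \<and> token_values p n K c S ! j < p ^ t. token_values p n K c S ! j) =
     (\<Sum>s<S. \<Sum>c<n. if s * n + c < t then p ^ (s * n + c) * digit p K (s * n + c) else 0)"
    by (simp add: sum.swap[of _ "{..<S}"])
  also have "\<dots> = (\<Sum>j<S * n. if j < t then p ^ j * digit p K j else 0)" by (rule sum_nat_double)
  also have "\<dots> \<le> (\<Sum>j<t. p ^ j * digit p K j)"
  proof -
    have "(\<Sum>j<S * n. if j < t then p ^ j * digit p K j else 0) = (\<Sum>j\<in>{..<S * n} \<inter> {..<t}. p ^ j * digit p K j)"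
      by (intro sum.mono_neutral_cong_right) auto
    also have "\<dots> \<le> (\<Sum>j<t. p ^ j * digit p K j)" by (intro sum_mono2) auto
    finally show ?thesis .
  qed
  also have "\<dots> = K mod p ^ t" by (rule digits_mod)
  also have "\<dots> < p ^ t" using p by simp
  finally show ?thesis .
qed


section \<open>Power sums of monic polynomials\<close>


lemma CHAR_finite_field:
  assumes "prime p" "CARD('a::{finite,field}) = p ^ n" shows "CHAR('a) = p"
proof -
  have "prime CHAR('a)" by (rule prime_CHAR_semidom[OF finite_imp_CHAR_pos]) (rule finite)
  moreover have "CHAR('a) dvd p ^ n"
    using of_nat_card_eq_0[where 'a='a] unfolding assms(2) of_nat_eq_0_iff_char_dvd .
  then have "CHAR('a) dvd p" using prime_dvd_power[OF \<open>prime CHAR('a)\<close>] by blast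
  ultimately show ?thesis using assms(1) by (simp add: primes_dvd_imp_eq)
qed

lemma power_card_power: "(a :: 'a::{finite,field}) ^ (CARD('a) ^ N) = a"
proof (induction N)
  case (Suc N)
  have "a ^ CARD('a) ^ Suc N = (a ^ CARD('a)) ^ CARD('a) ^ N" by (simp only: power_Suc power_mult)
  then show ?case by (simp only: power_card Suc.IH)
qed simp

text \<open>The q-th power fixes the coefficients, so a^(q^N) is \<open>a\<close> evaluated at
  \<theta>^(q^N).\<close>

lemma frobenius_eval:
  fixes a :: "'a::{finite,field} poly"
  assumes "prime p" "CARD('a) = p ^ n"
  shows "a ^ (CARD('a) ^ N) = (\<Sum>i\<le>degree a. [:coeff a i:] * monom 1 (CARD('a) ^ N) ^ i)"
proof -
  have ch: "CHAR('a) = p" using CHAR_finite_field[OF assms] .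
  have "a ^ (CARD('a) ^ N) = (\<Sum>i\<le>degree a. monom (coeff a i) i) ^ (CARD('a) ^ N)"
    by (simp add: poly_as_sum_of_monoms)
  also have "\<dots> = (\<Sum>i\<le>degree a. monom (coeff a i) i ^ (CARD('a) ^ N))"
    by (rule freshmans_dream_sum'[where n = "n * N"]) (simp_all add: ch assms power_mult)
  also have "\<dots> = (\<Sum>i\<le>degree a. [:coeff a i:] * monom 1 (CARD('a) ^ N) ^ i)"
    by (intro sum.cong refl) (simp add: monom_power power_card_power smult_monom mult.commute[of "CARD('a) ^ N"])
  finally show ?thesis .
qed

definition power_sum_poly :: "nat \<Rightarrow> nat \<Rightarrow> 'a::{finite,field} poly" where
  "power_sum_poly d K = (\<Sum>a\<in>monic_deg d. a ^ K)"

lemma poly_S_d: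
  assumes "prime p" "CARD('a::{finite,field}) = p ^ n"
  shows "poly (S_d \<beta> k d) (monom 1 (CARD('a) ^ N)) = (power_sum_poly d (k + CARD('a) ^ N * \<beta>) :: 'a poly)"
proof -
  have ev: "poly (chi_t a) (monom 1 (CARD('a) ^ N)) = a ^ (CARD('a) ^ N)" for a :: "'a poly"
  proof -
    have "degree (chi_t a) = degree a" unfolding chi_t_def by (rule degree_map_poly) auto
    then show ?thesis
      unfolding frobenius_eval[OF assms] poly_altdef by (simp add: chi_t_def coeff_map_poly)
  qed
  have "poly (chi_t a ^ \<beta> * [:a ^ k:]) (monom 1 (CARD('a) ^ N)) = a ^ (k + CARD('a) ^ N * \<beta>)" for a :: "'a poly"
    unfolding power_add power_mult poly_mult poly_power ev poly_pCons poly_0 by simp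
  then show ?thesis
    unfolding S_d_def power_sum_poly_def poly_sum by (intro sum.cong refl)
qed

lemma power_sum_poly_frobenius:
  assumes "prime p" "CARD('a::{finite,field}) = p ^ n"
  shows "power_sum_poly d (p ^ i * K) = (power_sum_poly d K :: 'a poly) ^ p ^ i"
proof -
  have ch: "CHAR('a) = p" using CHAR_finite_field[OF assms] .
  have "(power_sum_poly d K :: 'a poly) ^ p ^ i = (\<Sum>a\<in>monic_deg d. (a ^ K) ^ p ^ i)"
    unfolding power_sum_poly_def by (rule freshmans_dream_sum'[where n = i]) (simp_all add: ch assms)
  then show ?thesis unfolding power_mult[symmetric] mult.commute[of K] by (simp only: power_sum_poly_def)
qed

text \<open>These are base-q tokens: the pair (s, i) labels one of the equal factors a^(q^s) of a^K.
  They are to be distinguished from the base-p tokens in \<open>token_values\<close>.\<close>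

definition tokens :: "nat \<Rightarrow> nat \<Rightarrow> nat \<Rightarrow> (nat \<times> nat) set" where
  "tokens q K S = (SIGMA s:{..<S}. {..<digit q K s})"

lemma finite_tokens: "finite (tokens q K S)"
  by (simp add: tokens_def)

lemma card_tokens: "2 \<le> q \<Longrightarrow> K < q ^ S \<Longrightarrow> card (tokens q K S) = digit_sum q K"
  by (simp add: tokens_def digit_sum_eq)

lemma prod_tokens: "(\<Prod>t\<in>tokens q K S. f (fst t)) = (\<Prod>s<S. f s ^ digit q K s)"
proof -
  have "(\<Prod>s<S. \<Prod>i<digit q K s. f s) = (\<Prod>(s, i)\<in>(SIGMA s:{..<S}. {..<digit q K s}). f s)"
    by (rule prod.Sigma) auto
  then show ?thesis by (simp add: tokens_def case_prod_beta)
qed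

lemma power_sum_poly_eq:
  assumes "prime p" and card: "CARD('a::{finite,field}) = p ^ n" and K: "K < CARD('a) ^ S"
    and L: "digit_sum CARD('a) K < (d + 1) * (CARD('a) - 1)"
  shows "(power_sum_poly d K :: 'a poly) = (-1) ^ d *
    (\<Sum>J\<in>balanced (tokens CARD('a) K S) d CARD('a). \<Prod>t\<in>tokens CARD('a) K S. monom 1 (CARD('a) ^ fst t) ^ J t)"
proof -
  let ?q = "CARD('a)" and ?I = "tokens CARD('a) K S"
  let ?x = "\<lambda>t. monom (1 :: 'a) (?q ^ fst t)"
  let ?\<Phi> = "\<lambda>c. \<Prod>t\<in>?I. (\<Sum>j<d. [:c j:] * ?x t ^ j) + ?x t ^ d"
  have q2: "2 \<le> ?q" by (rule card_ge_2)
  have "a ^ K = ?\<Phi> (restrict (coeff a) {..<d})" if a: "a \<in> monic_deg d" for a :: "'a poly"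
  proof -
    have "a ^ K = a ^ (\<Sum>s<S. ?q ^ s * digit ?q K s)" using digits_eq[OF K] by simp
    also have "\<dots> = (\<Prod>s<S. (a ^ ?q ^ s) ^ digit ?q K s)" by (simp add: power_sum power_mult)
    also have "\<dots> = (\<Prod>t\<in>?I. a ^ ?q ^ fst t)" by (rule prod_tokens[symmetric])
    also have "\<dots> = ?\<Phi> (restrict (coeff a) {..<d})"
    proof (intro prod.cong refl)
      fix t
      have d: "degree a = d" "coeff a d = 1" using a by (auto simp: monic_deg_def)
      show "a ^ ?q ^ fst t = (\<Sum>j<d. [:restrict (coeff a) {..<d} j:] * ?x t ^ j) + ?x t ^ d"
        unfolding frobenius_eval[OF assms(1,2)] d(1) by (simp add: d lessThan_Suc_atMost[symmetric])
    qed
    finally show ?thesis .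
  qed
  then have "(power_sum_poly d K :: 'a poly) = (\<Sum>a\<in>monic_deg d. ?\<Phi> (restrict (coeff a) {..<d}))"
    unfolding power_sum_poly_def by (intro sum.cong) auto
  also have "\<dots> = (\<Sum>c\<in>PiE {..<d} (\<lambda>_. UNIV). ?\<Phi> c)"
    by (rule sum.reindex_bij_betw[OF monic_deg_bij])
  also have "\<dots> = (-1) ^ d * (\<Sum>J\<in>balanced ?I d ?q. \<Prod>t\<in>?I. ?x t ^ J t)"
    using L card_tokens[OF q2 K] by (intro monic_sum_eq finite_tokens) simp
  finally show ?thesis .
qed

text \<open>A balanced assignment uses d (q - 1) tokens, more than there are.\<close>

theorem power_sum_poly_eq_0:
  assumes "prime p" and card: "CARD('a::{finite,field}) = p ^ n" and L: "digit_sum CARD('a) K < d * (CARD('a) - 1)"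
  shows "(power_sum_poly d K :: 'a poly) = 0"
proof -
  let ?q = "CARD('a)"
  have q2: "2 \<le> ?q" by (rule card_ge_2)
  have K: "K < ?q ^ K" using less_exp[of K] power_mono[OF q2, of K] by linarith
  have "balanced (tokens ?q K K) d ?q = {}"
  proof (rule ccontr)
    assume "\<not> ?thesis"
    then obtain J where "J \<in> balanced (tokens ?q K K) d ?q" by blast
    then have "(\<Sum>j<d. card {s \<in> tokens ?q K K. J s = j}) = d * (?q - 1)" by (simp add: balanced_def)
    then show False using sum_card_fibres[OF finite_tokens, of ?q K K J d] L card_tokens[OF q2 K] by simp
  qed
  then show ?thesis using power_sum_poly_eq[OF assms(1,2) K, of d] L by simp
qed

section \<open>Factorization by classes of base-p digits\<close>

lemma of_nat_choose_neq_0: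
  assumes "prime p" "CHAR('r::comm_ring_1) = p" "m < p" "j \<le> m"
  shows "of_nat (m choose j) \<noteq> (0 :: 'r)"
proof
  assume "of_nat (m choose j) = (0 :: 'r)"
  then have "p dvd (m choose j)" using assms(2) of_nat_eq_0_iff_char_dvd by blast
  then have "p dvd fact m" using binomial_fact_lemma[OF assms(4)] by (metis dvd_mult)
  then show False using assms prime_dvd_fact_iff by (meson not_le)
qed

text \<open>This is the factor \<open>G_e\<close> of the overview; its roots in y are the powers of
  \<theta> whose exponents are the token values of class \<open>e\<close>, with
  multiplicity.\<close>

definition class_poly :: "nat \<Rightarrow> nat \<Rightarrow> nat \<Rightarrow> nat \<Rightarrow> nat \<Rightarrow> 'a::field poly poly" where
  "class_poly p n K S e = (\<Prod>s<S. [:monom 1 (p ^ (s * n + e)), -1:] ^ digit p K (s * n + e))"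

text \<open>Induction on the number of places: a new place brings a value \<open>u\<close> above all
  earlier ones, with multiplicity \<open>m\<close>. The term that takes y from as many old factors
  as possible has strictly the highest degree, and its binomial coefficient is nonzero because m <
  p.\<close>

lemma class_poly_coeff:
  assumes p: "prime p" "CHAR('a::field) = p" and n: "0 < n"
  shows "(w \<le> length (token_values p n K e S) \<longrightarrow> coeff (class_poly p n K S e :: 'a poly poly) w \<noteq> 0 \<and>
     degree (coeff (class_poly p n K S e :: 'a poly poly) w) + (\<Sum>i<w. token_values p n K e S ! i) = (\<Sum>i<length (token_values p n K e S). token_values p n K e S ! i))
   \<and> (length (token_values p n K e S) < w \<longrightarrow> coeff (class_poly p n K S e :: 'a poly poly) w = 0)"
proof (induction S arbitrary: w)
  case 0
  then show ?case by (auto simp: class_poly_def)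
next
  case (Suc S)
  have p2: "2 \<le> p" using p prime_ge_2_nat by blast
  define G where "G = (class_poly p n K S e :: 'a poly poly)"
  define t where "t = token_values p n K e S"
  define l where "l = length t"
  define u where "u = p ^ (S * n + e)"
  define m where "m = digit p K (S * n + e)"
  define Q where "Q = [:monom (1 :: 'a) u, -1:] ^ m"
  define P where "P w = (\<Sum>i<w. t ! i)" for w
  have mp: "m < p" unfolding m_def using p2 by (rule digit_less)
  have G': "class_poly p n K (Suc S) e = G * Q"
    by (simp add: class_poly_def G_def Q_def u_def m_def)
  have t': "token_values p n K e (Suc S) = t @ replicate m u" by (simp add: t_def u_def m_def)
  have Gc: "coeff G w \<noteq> 0" "degree (coeff G w) + P w = P l" if "w \<le> l" for w
    using Suc.IH[of w] that by (auto simp: G_def t_def l_def P_def)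
  have G0: "coeff G w = 0" if "l < w" for w
    using Suc.IH[of w] that by (auto simp: G_def t_def l_def)
  have Qc: "coeff Q j = Polynomial.smult (of_nat (m choose j) * (-1) ^ j) (monom 1 (u * (m - j)))" if "j \<le> m" for j
    unfolding Q_def coeff_linear_poly_power[OF that]
    by (simp add: monom_power of_nat_poly minus_one_power_iff)
  have bn: "of_nat (m choose j) * (-1) ^ j \<noteq> (0 :: 'a)" if "j \<le> m" for j
    using of_nat_choose_neq_0[OF p mp that] by simp
  have Qn: "coeff Q j \<noteq> 0" "degree (coeff Q j) = u * (m - j)" if "j \<le> m" for j
    unfolding Qc[OF that] using bn[OF that] by (simp_all add: degree_monom_eq)
  have Q0: "coeff Q j = 0" if "m < j" for j
  proof (rule coeff_eq_0)
    have "degree Q \<le> 1 * m" unfolding Q_def by (rule order_trans[OF degree_power_le]) simp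
    then show "degree Q < j" using that by simp
  qed
  have tu: "t ! i < u" if "i < l" for i
  proof -
    have "2 * t ! i \<le> u" unfolding u_def t_def using token_values_less[OF p2 n] nth_mem that l_def t_def by blast
    moreover have "0 < u" using p2 by (simp add: u_def)
    ultimately show ?thesis by linarith
  qed
  have Pstep: "P j \<le> P i + (j - i) * u \<and> (i < j \<longrightarrow> P j < P i + (j - i) * u)" if "i \<le> j" "j \<le> l" for i j
    using that
  proof (induction j)
    case (Suc j)
    show ?case
    proof (cases "i = Suc j")
      case False
      then have ij: "i \<le> j" using Suc.prems by simp
      have "P (Suc j) = P j + t ! j" by (simp add: P_def)
      moreover have "(Suc j - i) * u = (j - i) * u + u" using ij by (simp add: Suc_diff_le)
      ultimately show ?thesis using Suc.IH ij Suc.prems tu[of j] by simp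
    qed simp
  qed simp
  \<comment> \<open>To form y^w, the factors of smaller degree in \<theta> are used up before those
    of degree \<open>u\<close>.\<close>
  define i0 where "i0 = min w l"
  have coeff_eq: "coeff (G * Q) w = (\<Sum>i\<le>w. coeff G i * coeff Q (w - i))" by (simp add: coeff_mult)
  show ?case
  proof (cases "w \<le> l + m")
    case False
    have z: "coeff G i * coeff Q (w - i) = 0" for i
      using G0[of i] Q0[of "w - i"] False by (cases "l < i") auto
    have "coeff (G * Q) w = 0" unfolding coeff_eq by (rule sum.neutral) (blast intro: z)
    then show ?thesis using False by (simp only: G' t') (simp add: l_def)
  next
    case True
    have i0: "i0 \<le> l" "i0 \<le> w" "w - i0 \<le> m" using True by (auto simp: i0_def)
    have nz: "coeff G i0 * coeff Q (w - i0) \<noteq> 0" using Gc[OF i0(1)] Qn[OF i0(3)] by simp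
    have dg0: "degree (coeff G i0 * coeff Q (w - i0)) = degree (coeff G i0) + u * (m - (w - i0))"
      using Gc[OF i0(1)] Qn[OF i0(3)] by (simp add: degree_mult_eq)
    have small: "coeff G i * coeff Q (w - i) = 0 \<or> degree (coeff G i * coeff Q (w - i)) < degree (coeff G i0 * coeff Q (w - i0))"
      if "i \<in> {..w}" "i \<noteq> i0" for i
    proof (cases "i \<le> l \<and> w - i \<le> m")
      case False
      then show ?thesis using G0[of i] Q0[of "w - i"] by (auto simp: not_le)
    next
      case ok: True
      have lt: "i < i0" using that ok by (auto simp: i0_def)
      have "degree (coeff G i * coeff Q (w - i)) = degree (coeff G i) + u * (m - (w - i))"
        using Gc[of i] Qn[of "w - i"] ok by (simp add: degree_mult_eq)
      moreover have "degree (coeff G i) + P i = degree (coeff G i0) + P i0" using Gc(2)[of i] Gc(2)[OF i0(1)] ok by simp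
      moreover have "P i0 < P i + (i0 - i) * u" using Pstep[of i i0] lt i0 by simp
      moreover have "u * (m - (w - i0)) = u * (m - (w - i)) + (i0 - i) * u"
      proof -
        have "m - (w - i0) = (m - (w - i)) + (i0 - i)" using lt i0 ok by simp
        then show ?thesis by (simp add: algebra_simps)
      qed
      ultimately show ?thesis unfolding dg0 by linarith
    qed
    have "coeff (G * Q) w \<noteq> 0 \<and> degree (coeff (G * Q) w) = degree (coeff G i0) + u * (m - (w - i0))"
      unfolding coeff_eq dg0[symmetric]
      using sum_unique_degree[where ?s0.0 = i0 and f = "\<lambda>i. coeff G i * coeff Q (w - i)", OF _ _ nz small, of "{..w}"] i0
      by simp
    moreover have "degree (coeff G i0) + u * (m - (w - i0)) + (\<Sum>i<w. (t @ replicate m u) ! i) = (\<Sum>i<l + m. (t @ replicate m u) ! i)"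
    proof -
      have S1: "(\<Sum>i<a. (t @ replicate m u) ! i) = P a" if "a \<le> l" for a
        unfolding P_def using that by (intro sum.cong) (auto simp: nth_append l_def)
      have S2: "(\<Sum>i<l + a. (t @ replicate m u) ! i) = P l + a * u" if "a \<le> m" for a
        using that
      proof (induction a)
        case 0
        then show ?case using S1[of l] by simp
      next
        case (Suc a)
        then show ?case by (simp add: nth_append l_def)
      qed
      show ?thesis
      proof (cases "w \<le> l")
        case True
        then have "i0 = w" by (simp add: i0_def)
        then show ?thesis using S1[OF True] S2[of m] Gc(2)[OF True] by (simp add: mult.commute)
      next
        case False
        then have w: "i0 = l" "w = l + (w - l)" by (auto simp: i0_def)
        have "(\<Sum>i<w. (t @ replicate m u) ! i) = P l + (w - l) * u"
          using S2[of "w - l"] True w by simp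
        moreover have "degree (coeff G l) = 0" using Gc(2)[of l] by simp
        moreover have "u * (m - (w - l)) + (w - l) * u = m * u"
        proof -
          have "(m - (w - l)) * u + (w - l) * u = m * u"
            unfolding add_mult_distrib[symmetric] using True by simp
          then show ?thesis by (simp only: mult.commute[of u])
        qed
        ultimately show ?thesis using w S2[of m] by simp
      qed
    qed
    ultimately show ?thesis using True by (simp only: G' t') (simp add: l_def)
  qed
qed

lemma pcompose_monom_monom:
  "pcompose (monom 1 a) (monom 1 b) = (monom 1 (a * b) :: 'r::comm_ring_1 poly)"
proof (induction a)
  case (Suc a)
  then show ?case by (simp add: monom_Suc pcompose_pCons mult_monom)
qed (simp add: one_pCons pcompose_pCons)

lemma pcompose_power: "pcompose (f ^ k) h = pcompose f h ^ k" for f :: "'r::comm_ring_1 poly"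
  by (induction k) (simp_all add: pcompose_mult one_pCons pcompose_pCons)

lemma freshmans_dream_diff:
  fixes x y :: "'r::comm_ring_1"
  assumes "prime CHAR('r)" "m = CHAR('r) ^ k"
  shows "(x - y) ^ m = x ^ m - y ^ m"
  using freshmans_dream'[OF assms, of "x - y" y] by (simp add: algebra_simps)

text \<open>The factors of class \<open>g\<close> and above, with exponents of y divided by p^g, so
  that each level of the path expansion substitutes y^p just once.\<close>

definition tower :: "nat \<Rightarrow> nat \<Rightarrow> nat \<Rightarrow> nat \<Rightarrow> nat \<Rightarrow> 'a::field poly poly" where
  "tower p n K S g = (\<Prod>e\<in>{g..<n}. pcompose (class_poly p n K S e) (monom 1 (p ^ (e - g))))"

lemma tower_step:
  assumes "g < n"
  shows "(tower p n K S g :: 'a::field poly poly) = class_poly p n K S g * pcompose (tower p n K S (Suc g)) (monom 1 p)"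
proof -
  have "{g..<n} = insert g {Suc g..<n}" using assms by auto
  then have "(tower p n K S g :: 'a poly poly) = pcompose (class_poly p n K S g) (monom 1 1) *
     (\<Prod>e\<in>{Suc g..<n}. pcompose (class_poly p n K S e) (monom 1 (p ^ (e - g))))"
    by (simp add: tower_def)
  also have "pcompose (class_poly p n K S g) (monom 1 1) = (class_poly p n K S g :: 'a poly poly)"
  proof -
    have "monom 1 1 = [:0, 1 :: 'a poly:]" by (simp add: monom_Suc monom_0)
    then show ?thesis by (simp only: pcompose_idR)
  qed
  also have "(\<Prod>e\<in>{Suc g..<n}. pcompose (class_poly p n K S e) (monom 1 (p ^ (e - g)))) =
     (pcompose (tower p n K S (Suc g)) (monom 1 p) :: 'a poly poly)"
    unfolding tower_def pcompose_prod
  proof (intro prod.cong refl)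
    fix e assume "e \<in> {Suc g..<n}"
    then have "e - g = Suc (e - Suc g)" by (metis Suc_diff_Suc Suc_le_eq atLeastLessThan_iff)
    then have "p ^ (e - g) = p ^ (e - Suc g) * p" by simp
    then show "pcompose (class_poly p n K S e) (monom 1 (p ^ (e - g))) =
       pcompose (pcompose (class_poly p n K S e) (monom 1 (p ^ (e - Suc g)))) (monom 1 p :: 'a poly poly)"
      by (simp only: pcompose_assoc[symmetric] pcompose_monom_monom)
  qed
  finally show ?thesis .
qed

text \<open>By Frobenius the p^e-th power of \<theta>^(q^s) - y is \<theta>^(p^(s n + e)) - y^(p^e).
  The base-p tokens of all classes thus reassemble into the base-q tokens.\<close>

lemma tower_0:
  assumes "prime p" "CHAR('a::field) = p"
  shows "(tower p n K S 0 :: 'a poly poly) = (\<Prod>t\<in>tokens (p ^ n) K S. [:monom 1 ((p ^ n) ^ fst t), -1:])"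
proof -
  let ?f = "\<lambda>s. [:monom (1 :: 'a) ((p ^ n) ^ s), -1:]"
  have pc: "pcompose [:monom (1 :: 'a) (p ^ (s * n + e)), -1:] (monom 1 (p ^ e)) = ?f s ^ p ^ e" for s e
  proof -
    have "?f s = [:monom (1 :: 'a) ((p ^ n) ^ s):] - monom 1 1" by (simp add: monom_Suc monom_0)
    then have "?f s ^ p ^ e = [:monom (1 :: 'a) ((p ^ n) ^ s):] ^ p ^ e - monom 1 1 ^ p ^ e"
      using assms by (simp only:) (rule freshmans_dream_diff[where k = e], simp_all)
    also have "[:monom (1 :: 'a) ((p ^ n) ^ s):] ^ p ^ e = [:monom 1 (p ^ (s * n + e)):]"
      by (simp add: poly_const_pow monom_power power_add power_mult[symmetric] mult.commute)
    finally show ?thesis by (simp add: pcompose_pCons monom_power)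
  qed
  have "(tower p n K S 0 :: 'a poly poly) = (\<Prod>e<n. \<Prod>s<S. (?f s ^ p ^ e) ^ digit p K (s * n + e))"
    unfolding tower_def class_poly_def pcompose_prod atLeast0LessThan
    by (intro prod.cong refl) (simp add: pcompose_power pc)
  also have "\<dots> = (\<Prod>s<S. \<Prod>e<n. ?f s ^ (p ^ e * digit p K (s * n + e)))"
    by (subst prod.swap) (simp add: power_mult)
  also have "\<dots> = (\<Prod>s<S. ?f s ^ digit (p ^ n) K s)"
    by (simp add: digit_power power_sum)
  also have "\<dots> = (\<Prod>t\<in>tokens (p ^ n) K S. ?f (fst t))" by (rule prod_tokens[symmetric])
  finally show ?thesis .
qed

lemma token_classes_token_values:
  assumes p: "2 \<le> p" and n: "0 < n"
  shows "token_classes p n (class_size p n K S) (\<lambda>e i. token_values p n K e S ! i)"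
proof
  show "2 \<le> p" by fact
next
  fix b i j assume "b < n" "i \<le> j" "j < class_size p n K S b"
  then show "token_values p n K b S ! i \<le> token_values p n K b S ! j"
    using sorted_nth_mono[OF sorted_token_values[OF p n, of K b S]] by (simp add: length_token_values)
next
  fix b i assume "b < n" "i < class_size p n K S b"
  then have "token_values p n K b S ! i \<in> set (token_values p n K b S)" by (simp add: length_token_values)
  then show "0 < token_values p n K b S ! i" using set_token_values p by fastforce
next
  fix b i assume "b < n" "i + (p - 1) < class_size p n K S b"
  then show "2 * token_values p n K b S ! i \<le> token_values p n K b S ! (i + (p - 1))"
    by (intro token_values_double[OF p n]) (simp add: length_token_values)
next
  fix b c i j assume bc: "b < n" "c < n" "b \<noteq> c" and "i < class_size p n K S b" "j < class_size p n K S c"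
  then have "token_values p n K b S ! i \<in> set (token_values p n K b S)" "token_values p n K c S ! j \<in> set (token_values p n K c S)"
    by (simp_all add: length_token_values)
  then obtain s s' where s: "token_values p n K b S ! i = p ^ (s * n + b)" "token_values p n K c S ! j = p ^ (s' * n + c)"
    using set_token_values by metis
  have dbl: "2 * p ^ u \<le> p ^ w" if "u < w" for u w
  proof -
    have "2 * p ^ u \<le> p * p ^ u" using p by (rule mult_le_mono1)
    also have "\<dots> = p ^ Suc u" by simp
    also have "\<dots> \<le> p ^ w" using that p by (intro power_increasing) auto
    finally show ?thesis .
  qed
  \<comment> \<open>Places of different classes are incongruent modulo \<open>n\<close>, so their
    values are different powers of \<open>p\<close>.\<close>
  have "(s * n + b) mod n = b" "(s' * n + c) mod n = c" using bc by simp_all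
  then have "s * n + b \<noteq> s' * n + c" using bc by metis
  then show "2 * token_values p n K b S ! i \<le> token_values p n K c S ! j \<or> 2 * token_values p n K c S ! j \<le> token_values p n K b S ! i"
    unfolding s using dbl by (meson linorder_neqE_nat)
next
  fix b i assume "b < n" "i < class_size p n K S b"
  then have "token_values p n K b S ! i \<in> set (token_values p n K b S)" by (simp add: length_token_values)
  then obtain s where s: "token_values p n K b S ! i = p ^ (s * n + b)" using set_token_values by metis
  show "(\<Sum>c<n. \<Sum>j | j < class_size p n K S c \<and> token_values p n K c S ! j < token_values p n K b S ! i. token_values p n K c S ! j)
      < token_values p n K b S ! i"
    unfolding s length_token_values[symmetric] by (rule sum_token_values_less[OF p])
qed

text \<open>The bound \<open>upper\<close> makes the determinant a multiple of the power sum;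
  \<open>lower\<close>, through all shifts, supplies the path system behind the nonvanishing of the
  determinant.\<close>

theorem power_sum_poly_neq_0:
  assumes p: "prime p" and card: "CARD('a::{finite,field}) = p ^ n" and n: "0 < n"
    and upper: "digit_sum (p ^ n) K < (d + 1) * (p ^ n - 1)"
    and lower: "\<And>i. i < n \<Longrightarrow> d * (p ^ n - 1) \<le> digit_sum (p ^ n) (p ^ i * K)"
  shows "(power_sum_poly d K :: 'a poly) \<noteq> 0"
proof -
  let ?q = "p ^ n"
  have p2: "2 \<le> p" using p by (rule prime_ge_2_nat)
  have q2: "2 \<le> ?q" using card_ge_2[where 'a='a] card by simp
  have ch: "CHAR('a) = p" using CHAR_finite_field[OF p card] .
  \<comment> \<open>Any number of digits with K < q^S serves.\<close>
  define S where "S = K"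
  have K: "K < ?q ^ S" using less_exp[of K] power_mono[OF q2, of K] unfolding S_def by linarith
  have K': "K < p ^ (S * n)" using K by (simp only: power_mult[symmetric] mult.commute)
  interpret token_classes p n d "class_size p n K S" "\<lambda>e i. token_values p n K e S ! i"
    by (rule token_classes_token_values[OF p2 n])
  have ds: "digit_sum ?q K = (\<Sum>c<n. p ^ c * class_size p n K S c)"
    using digit_sum_shift[OF p2 n n K'] by simp
  have W: "(p ^ b - 1) * d \<le> (\<Sum>c<b. p ^ c * class_size p n K S c)" if b: "b \<le> n" for b
  proof -
    consider "b = 0" | "b = n" | "0 < b" "b < n" using b by linarith
    then show ?thesis
    proof cases
      case 1
      then show ?thesis by simp
    next
      case 2
      then show ?thesis using lower[OF n] ds by (simp add: mult.commute)
    next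
      case 3
      let ?W = "\<Sum>c<b. p ^ c * class_size p n K S c"
      have "p ^ b * (d * (?q - 1)) \<le> p ^ b * digit_sum ?q (p ^ (n - b) * K)"
        using lower[of "n - b"] 3 by (intro mult_le_mono2) simp
      also have "\<dots> = digit_sum ?q K + (?q - 1) * ?W" by (rule digit_sum_rotation[OF p2 3 K'])
      also have "\<dots> < (d + 1) * (?q - 1) + (?q - 1) * ?W" using upper by simp
      finally have "(p ^ b * d) * (?q - 1) < (d + 1 + ?W) * (?q - 1)"
        by (simp only: mult.assoc add_mult_distrib mult.commute[of "?q - 1"])
      \<comment> \<open>The unit by which \<open>upper\<close> exceeds d (q - 1) is absorbed by
        strictness over the integers.\<close>
      then have "p ^ b * d < d + 1 + ?W" using mult_less_cancel2 by blast
      then show ?thesis by (simp add: diff_mult_distrib)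
    qed
  qed
  define F where "F = (tower p n K S :: nat \<Rightarrow> 'a poly poly)"
  have "level_det d p n (F 0) Suc \<noteq> 0"
  proof (rule level_det_neq_0[OF W, where G = "class_poly p n K S"])
    show "F g = class_poly p n K S g * pcompose (F (Suc g)) (monom 1 p)" if "g < n" for g
      unfolding F_def by (rule tower_step[OF that])
    show "F n = 1" by (simp add: F_def tower_def)
    show "coeff (class_poly p n K S g :: 'a poly poly) w \<noteq> 0 \<and>
        degree (coeff (class_poly p n K S g :: 'a poly poly) w) + prefix_sum g w = prefix_sum g (class_size p n K S g)"
      if "g < n" "w \<le> class_size p n K S g" for g w
      using class_poly_coeff[OF p ch n, of w K g S] that unfolding prefix_sum_def length_token_values by blast
    show "coeff (class_poly p n K S g :: 'a poly poly) w = 0" if "g < n" "class_size p n K S g < w" for g w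
      using class_poly_coeff[OF p ch n, of w K g S] that unfolding length_token_values by blast
  qed
  \<comment> \<open>Rows of \<open>level_det\<close> belong to starting positions, rows of
    \<open>dual_matrix\<close> to end places.\<close>
  moreover have "level_det d p n (F 0) Suc = det (dual_matrix d ?q (F 0))"
  proof -
    have "mat d d (\<lambda>(j, i). coeff_at_diff (F 0) (?q * Suc i) (Suc j)) = transpose_mat (dual_matrix d ?q (F 0))"
      by (intro eq_matI) (simp_all add: dual_matrix_def)
    then show ?thesis unfolding level_det_def
      using det_transpose[of "dual_matrix d ?q (F 0)" d] by (simp add: dual_matrix_def)
  qed
  moreover have "\<exists>c. det (dual_matrix d ?q (F 0)) =
      c * (\<Sum>J\<in>balanced (tokens ?q K S) d ?q. \<Prod>t\<in>tokens ?q K S. monom 1 (?q ^ fst t) ^ J t)"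
    unfolding F_def tower_0[OF p ch]
    by (rule det_dual_matrix[where n = n]) (use p upper card_tokens[OF q2 K] finite_tokens in \<open>simp_all add: ch\<close>)
  ultimately have "(\<Sum>J\<in>balanced (tokens ?q K S) d ?q. \<Prod>t\<in>tokens ?q K S. monom (1 :: 'a) (?q ^ fst t) ^ J t) \<noteq> 0"
    by auto
  then show ?thesis
    using power_sum_poly_eq[OF p card, of K S d] K upper by (simp add: card)
qed

theorem theorem3p1p1:
  fixes p n \<beta> k :: nat
  assumes "prime p" and "n \<ge> 1" and "card (UNIV :: 'a set) = p ^ n"
    and "\<beta> > 0" and "k > 0"
  defines "\<phi> \<equiv> Min {(digit_sum (p ^ n) (p ^ i * \<beta>) + digit_sum (p ^ n) (p ^ i * k)) div (p ^ n - 1) | i. i < n}"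
  shows "(S_d \<beta> k \<phi> :: ('a::{finite,field}) poly poly) \<noteq> 0 \<and> (\<forall>d > \<phi>. (S_d \<beta> k d :: 'a poly poly) = 0)"
proof -
  let ?q = "p ^ n"
  note p = assms(1) and card = assms(3)
  have n: "0 < n" using assms(2) by simp
  have q2: "2 \<le> ?q" using card_ge_2[where 'a='a] card by simp
  define l where "l i = digit_sum ?q (p ^ i * \<beta>) + digit_sum ?q (p ^ i * k)" for i
  let ?D = "{l i div (?q - 1) | i. i < n}"
  have \<phi>: "\<phi> = Min ?D" by (simp add: \<phi>_def l_def)
  have D: "finite ?D" "?D \<noteq> {}" using n by auto
  have "\<phi> \<in> ?D" unfolding \<phi> by (rule Min_in[OF D])
  then obtain i0 where i0: "i0 < n" "\<phi> = l i0 div (?q - 1)" by auto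
  have min: "\<phi> \<le> l i div (?q - 1)" if "i < n" for i
    unfolding \<phi> using that by (intro Min_le D) auto
  define K where "K N = k + ?q ^ N * \<beta>" for N
  have lK: "digit_sum ?q (p ^ i * K N) = l i" if "p ^ i * k < ?q ^ N" for i N
  proof -
    have "p ^ i * K N = p ^ i * k + ?q ^ N * (p ^ i * \<beta>)" by (simp add: K_def algebra_simps)
    then show ?thesis using digit_sum_append[OF q2 that] by (simp add: l_def)
  qed
  \<comment> \<open>With N > k there is room below q^N for every shift of \<open>k\<close> by i < n,
    so one \<open>N\<close> serves all \<open>i\<close>.\<close>
  have big: "p ^ i * k < ?q ^ N" if "i < n" "k < N" for i N
  proof -
    have "p ^ i \<le> ?q" using that prime_gt_0_nat[OF p] by (intro power_increasing) auto
    then have "p ^ i * k \<le> ?q * k" by simp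
    also have "k < ?q ^ k" using less_exp[of k] power_mono[OF q2, of k] by linarith
    then have "?q * k < ?q * ?q ^ k" using q2 by (intro mult_strict_left_mono) linarith+
    also have "\<dots> = ?q ^ Suc k" by simp
    also have "\<dots> \<le> ?q ^ N" using that q2 by (intro power_increasing) auto
    finally show ?thesis .
  qed
  \<comment> \<open>In a domain a power vanishes only with its base, so \<open>K N\<close> may be
    replaced by its shift with the least quotient.\<close>
  have frob: "(power_sum_poly d (K N) :: 'a poly) = 0 \<longleftrightarrow> (power_sum_poly d (p ^ i0 * K N) :: 'a poly) = 0" for d N
    unfolding power_sum_poly_frobenius[OF p card] using prime_gt_0_nat[OF p] by simp
  have link: "poly (S_d \<beta> k d) (monom 1 (?q ^ N)) = (power_sum_poly d (K N) :: 'a poly)" for d N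
    using poly_S_d[OF p card, of \<beta> k d N] unfolding card K_def .
  have "(S_d \<beta> k d :: 'a poly poly) = 0" if d: "\<phi> < d" for d
  proof (rule ccontr)
    assume nz: "(S_d \<beta> k d :: 'a poly poly) \<noteq> 0"
    \<comment> \<open>As a polynomial in t, the sum vanishes at \<theta>^(q^N) for every N > k,
      hence at infinitely many points.\<close>
    have "poly (S_d \<beta> k d) (monom 1 (?q ^ N)) = (0 :: 'a poly)" if "k < N" for N
    proof -
      have "l i0 < d * (?q - 1)" using d i0 q2 by (simp add: div_less_iff_less_mult)
      then have "(power_sum_poly d (p ^ i0 * K N) :: 'a poly) = 0"
        using power_sum_poly_eq_0[OF p card, of "p ^ i0 * K N" d] lK[OF big[OF i0(1) that]] by (simp add: card)
      then show ?thesis unfolding link frob .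
    qed
    then have "(\<lambda>N. monom 1 (?q ^ N)) ` {k<..} \<subseteq> {x :: 'a poly. poly (S_d \<beta> k d) x = 0}" by auto
    moreover have "inj_on (\<lambda>N. monom (1 :: 'a) (?q ^ N)) {k<..}"
    proof (rule inj_onI)
      fix N M assume "monom (1 :: 'a) (?q ^ N) = monom 1 (?q ^ M)"
      then have "?q ^ N = ?q ^ M" by (metis degree_monom_eq one_neq_zero)
      then show "N = M" using q2 by (simp add: power_inject_exp)
    qed
    then have "infinite ((\<lambda>N. monom (1 :: 'a) (?q ^ N)) ` {k<..})"
      using infinite_Ioi[of k] finite_imageD by blast
    ultimately show False using poly_roots_finite[OF nz] finite_subset by blast
  qed
  moreover have "(S_d \<beta> k \<phi> :: 'a poly poly) \<noteq> 0"
  proof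
    assume z: "(S_d \<beta> k \<phi> :: 'a poly poly) = 0"
    \<comment> \<open>For nonvanishing a single evaluation point is enough.\<close>
    define N where "N = Suc k"
    have lN: "digit_sum ?q (p ^ i * K N) = l i" if "i < n" for i
      using lK[OF big[OF that]] by (simp add: N_def)
    have "(power_sum_poly \<phi> (p ^ i0 * K N) :: 'a poly) \<noteq> 0"
    proof (rule power_sum_poly_neq_0[OF p card n])
      have "l i0 < (?q - 1) + l i0 div (?q - 1) * (?q - 1)"
        by (rule dividend_less_div_times) (use q2 in simp)
      also have "\<dots> = (\<phi> + 1) * (?q - 1)" unfolding i0(2) by (simp only: add_mult_distrib mult_1 add.commute)
      finally show "digit_sum ?q (p ^ i0 * K N) < (\<phi> + 1) * (?q - 1)" using lN[OF i0(1)] by simp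
      fix i assume i: "i < n"
      \<comment> \<open>Shifts of the shifted exponent are again shifts by an index below
        \<open>n\<close>: a full turn multiplies by \<open>q\<close>, which keeps the digit
        sum.\<close>
      have "\<exists>j<n. digit_sum ?q (p ^ i * (p ^ i0 * K N)) = l j"
      proof (cases "i + i0 < n")
        case True
        have "p ^ i * (p ^ i0 * K N) = p ^ (i + i0) * K N" by (simp add: power_add)
        then have "digit_sum ?q (p ^ i * (p ^ i0 * K N)) = l (i + i0)" by (simp only: lN[OF True])
        then show ?thesis using True by blast
      next
        case False
        have "n + (i + i0 - n) = i + i0" using False by simp
        then have "p ^ i * (p ^ i0 * K N) = ?q * (p ^ (i + i0 - n) * K N)"
          by (metis mult.assoc power_add)
        then have "digit_sum ?q (p ^ i * (p ^ i0 * K N)) = digit_sum ?q (p ^ (i + i0 - n) * K N)"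
          by (simp only: digit_sum_base_mult[OF q2])
        moreover have "i + i0 - n < n" using i i0(1) by simp
        ultimately show ?thesis using lN by auto
      qed
      then obtain j where j: "j < n" "digit_sum ?q (p ^ i * (p ^ i0 * K N)) = l j" by blast
      have "\<phi> * (?q - 1) \<le> l j div (?q - 1) * (?q - 1)" using min[OF j(1)] by (rule mult_le_mono1)
      also have "\<dots> \<le> l j" by (rule div_times_less_eq_dividend)
      finally show "\<phi> * (?q - 1) \<le> digit_sum ?q (p ^ i * (p ^ i0 * K N))" using j by simp
    qed
    then have "(power_sum_poly \<phi> (K N) :: 'a poly) \<noteq> 0" using frob by blast
    then show False using link[of \<phi> N] z by simp
  qed
  ultimately show ?thesis by blast
qed

end
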